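(* Let $K\subset\mathbb{R}^n$ be a non-trivial closed convex cone, $G\in\mathbb{R}^{m\times n}$ a standard Gaussian matrix, and $L\equiv\{x\in\mathbb{R}^m: x_{\ell+1}=\dots=x_m=0\}$ for an integer $\ell$ with $\max\{1,(m-\delta(K))_+\}\le\ell\le m$. Assume there is $\tau\in(0,1/2)$ with $m-\ell\le(1-\tau)\delta(K)$. Then there is a constant $c=c(\tau)>0$ such that for every $\epsilon\in(0,1/2)$ and every integer $k$ with $1\le k\le\min\{\ell,\,c\,\mathscr{L}(\epsilon^2\delta(K))\}$, with probability at least $1-\exp(-c\epsilon^2\delta(K))$, $$(1-\epsilon)B_k\big(\sqrt{\delta(K)-m+\ell}\big)\subset\Pi_{m\to k}\big(L\cap GK_n\big)\subset(1+\epsilon)B_k\big(\sqrt{\delta(K)-m+\ell}\big).$$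
   Context: A standard Gaussian matrix has i.i.d. $\mathcal{N}(0,1)$ entries. $B_n$ is the closed Euclidean unit ball of $\mathbb{R}^n$, $K_n\equiv K\cap B_n$, $GK_n\equiv\{G\mu:\mu\in K_n\}$, $B_k(r)$ is the closed Euclidean ball of radius $r$ centered at $0$ in $\mathbb{R}^k$, $\Pi_{m\to k}:\mathbb{R}^m\to\mathbb{R}^k$ is the projection onto the first $k$ coordinates, and $\mathscr{L}(x)\equiv x/\log(e\vee(1/x))$. $a_+=\max(a,0)$. A closed convex cone is non-trivial if it is not $\{0\}$. $\delta(K)\equiv\mathbb{E}\|\Pi_K(g)\|^2$ with $g\sim\mathcal{N}(0,I_n)$, where $\Pi_K$ is the Euclidean metric projection onto $K$. *)

theory Defs
  imports "HOL-Analysis.Analysis" "HOL-Probability.Probability"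
begin

text \<open>Vectors of R^n are represented as functions nat => real vanishing at indices >= n
  (coordinate i+1 of the paper is index i here).\<close>

definition Rn :: "nat \<Rightarrow> (nat \<Rightarrow> real) set" where
  "Rn n = {x. \<forall>i\<ge>n. x i = 0}"

definition sqnorm :: "nat \<Rightarrow> (nat \<Rightarrow> real) \<Rightarrow> real" where
  "sqnorm n x = (\<Sum>i<n. (x i)^2)"

text \<open>Non-trivial closed convex cone in R^n (closedness w.r.t. the product topology,
  which on R^n x {0} coincides with the Euclidean topology).\<close>
definition nontrivial_closed_convex_cone :: "nat \<Rightarrow> (nat \<Rightarrow> real) set \<Rightarrow> bool" where
  "nontrivial_closed_convex_cone n K \<longleftrightarrow>
     K \<subseteq> Rn n \<and> (\<lambda>_. 0) \<in> K \<and> closed K \<and>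
     (\<forall>x\<in>K. \<forall>t::real. t \<ge> 0 \<longrightarrow> (\<lambda>i. t * x i) \<in> K) \<and>
     (\<forall>x\<in>K. \<forall>y\<in>K. (\<lambda>i. x i + y i) \<in> K) \<and>
     K \<noteq> {\<lambda>_. 0}"

definition proj_cone :: "nat \<Rightarrow> (nat \<Rightarrow> real) set \<Rightarrow> (nat \<Rightarrow> real) \<Rightarrow> (nat \<Rightarrow> real)" where
  "proj_cone n K g = (THE p. p \<in> K \<and> (\<forall>y\<in>K. sqnorm n (\<lambda>i. g i - p i) \<le> sqnorm n (\<lambda>i. g i - y i)))"

definition gauss_vec :: "nat \<Rightarrow> (nat \<Rightarrow> real) measure" where
  "gauss_vec n = PiM {..<n} (\<lambda>_. std_normal_distribution)"

definition gauss_mat :: "nat \<Rightarrow> nat \<Rightarrow> (nat \<times> nat \<Rightarrow> real) measure" where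
  "gauss_mat m n = PiM ({..<m} \<times> {..<n}) (\<lambda>_. std_normal_distribution)"

definition stat_dim :: "nat \<Rightarrow> (nat \<Rightarrow> real) set \<Rightarrow> real" where
  "stat_dim n K = (\<integral>g. sqnorm n (proj_cone n K g) \<partial>gauss_vec n)"

definition matvec :: "nat \<Rightarrow> nat \<Rightarrow> (nat \<times> nat \<Rightarrow> real) \<Rightarrow> (nat \<Rightarrow> real) \<Rightarrow> (nat \<Rightarrow> real)" where
  "matvec m n G \<mu> = (\<lambda>i. if i < m then (\<Sum>j<n. G (i, j) * \<mu> j) else 0)"

definition cone_ball :: "nat \<Rightarrow> (nat \<Rightarrow> real) set \<Rightarrow> (nat \<Rightarrow> real) set" where
  "cone_ball n K = {\<mu> \<in> K. sqnorm n \<mu> \<le> 1}"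

definition GK :: "nat \<Rightarrow> nat \<Rightarrow> (nat \<times> nat \<Rightarrow> real) \<Rightarrow> (nat \<Rightarrow> real) set \<Rightarrow> (nat \<Rightarrow> real) set" where
  "GK m n G K = matvec m n G ` cone_ball n K"

definition Lsub :: "nat \<Rightarrow> nat \<Rightarrow> (nat \<Rightarrow> real) set" where
  "Lsub m l = {x \<in> Rn m. \<forall>i. l \<le> i \<and> i < m \<longrightarrow> x i = 0}"

definition proj_first :: "nat \<Rightarrow> (nat \<Rightarrow> real) \<Rightarrow> (nat \<Rightarrow> real)" where
  "proj_first k x = (\<lambda>i. if i < k then x i else 0)"

definition ballk :: "nat \<Rightarrow> real \<Rightarrow> (nat \<Rightarrow> real) set" where
  "ballk k r = {y \<in> Rn k. sqrt (sqnorm k y) \<le> r}"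

definition scale_set :: "real \<Rightarrow> (nat \<Rightarrow> real) set \<Rightarrow> (nat \<Rightarrow> real) set" where
  "scale_set a S = (\<lambda>y. (\<lambda>i. a * y i)) ` S"

definition Lfun :: "real \<Rightarrow> real" where
  "Lfun x = x / ln (max (exp 1) (1 / x))"

end

theory Submission
  imports Defs
begin

text \<open>Write \<open>p = m - l\<close>. Only the first \<open>k\<close> and the last \<open>p\<close> rows of \<open>G\<close> matter. By separation, failure of
  one of the two inclusions is a bound for a min-max over
  \<open>w = (u, v)\<close>, \<open>|u| = 1\<close>, and \<open>\<mu> \<in> K\<close>, \<open>|\<mu>| = 1\<close>, of the bilinear form \<open>\<langle>w, G \<mu>\<rangle>\<close>, the multiplier
  \<open>v \<in> \<real>\<^sup>p\<close> encoding the constraint \<open>x \<in> L\<close>. Gordon's comparison inequality replaces the form by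
  \<open>|w| \<langle>g, \<mu>\<rangle> + \<langle>h, w\<rangle>\<close>. Its optimum over \<open>\<mu>\<close> and \<open>v\<close> is explicit: with \<open>A = |\<Pi>\<^sub>K g|\<close>, \<open>H\<close> the norm of
  the last \<open>p\<close> and \<open>H'\<close> that of the first \<open>k\<close> coordinates of \<open>h\<close>, it lies within \<open>H'\<close> of
  \<open>sqrt (A\<^sup>2 - H\<^sup>2)\<close>. The three norms are support functions of subsets of the unit ball and so
  concentrate around \<open>sqrt (\<delta>(K))\<close>, \<open>sqrt p\<close> and below \<open>sqrt k\<close> at scale 1.
  If \<open>c \<le> 1\<close>, then \<open>1 \<le> k \<le> c \<L>(\<epsilon>\<^sup>2 \<delta>(K))\<close> forces \<open>\<epsilon>\<^sup>2 \<delta>(K) \<ge> 1 / c\<close>, and only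
  \<open>\<L>(x) \<le> x\<close> is used.\<close>

section \<open>Gaussian vectors and rotations\<close>

text \<open>Gordon's inequality compares finite fields, while the multiplier ranges over an
  unbounded space, where finite nets are not at hand. The passage to the continuum therefore goes
  through dense sequences and monotone limits, with a comparison event on the decoupled side that is
  uniform in the outer index. The two inclusions correspond to two orders of optimisation. For the
  lower one the separating direction \<open>w\<close> is the outer index and \<open>\<mu>\<close>
  the inner one. For the upper one the pair of \<open>u\<close> and \<open>\<mu>\<close> is outer,
  the multiplier is inner, and all signs are reversed. In both cases one of \<open>w\<close>,
  \<open>\<mu>\<close> is fixed along a row, which makes the covariances agree there, up to one
  discrepancy: the decoupled field has twice the variance of the bilinear form. An independent
  scalar multiple of |w| repairs this, and restricting to its nonpositive values removes it again at
  the price of a factor 2. Rotation invariance of Gaussian vectors is used twice: for concentration,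
  and to make Gaussian averages a semigroup that can be cut into small steps.\<close>

abbreviation N01 :: "real measure" where
  "N01 \<equiv> std_normal_distribution"

abbreviation gauss :: "'i set \<Rightarrow> ('i \<Rightarrow> real) measure" where
  "gauss R \<equiv> PiM R (\<lambda>_. N01)"

lemma prob_space_std_normal: "prob_space N01"
  by (rule prob_space_normal_density) simp

lemma product_prob_space_std_normal: "product_prob_space (\<lambda>_. N01)"
proof -
  interpret prob_space N01 by (rule prob_space_std_normal)
  show ?thesis by unfold_locales
qed

lemma prob_space_gauss: "prob_space (gauss R)"
  by (rule prob_space_PiM) (rule prob_space_std_normal)

text \<open>Translation invariance in the sheared coordinate for each fixed value of the other; the
  order of integration is exchanged so that the sheared coordinate is the inner one.\<close>

lemma nn_integral_shear1:
  fixes \<psi> :: "real \<times> real \<Rightarrow> ennreal"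
  assumes [measurable]: "\<psi> \<in> borel_measurable borel"
  shows "(\<integral>\<^sup>+x. \<integral>\<^sup>+y. \<psi> (x + a * y, y) \<partial>lborel \<partial>lborel) = (\<integral>\<^sup>+x. \<integral>\<^sup>+y. \<psi> (x, y) \<partial>lborel \<partial>lborel)"
proof -
  have "(\<integral>\<^sup>+x. \<integral>\<^sup>+y. \<psi> (x + a * y, y) \<partial>lborel \<partial>lborel) = (\<integral>\<^sup>+y. \<integral>\<^sup>+x. \<psi> (x + a * y, y) \<partial>lborel \<partial>lborel)"
    by (rule lborel_pair.Fubini'[symmetric]) measurable
  also have "\<dots> = (\<integral>\<^sup>+y. \<integral>\<^sup>+x. \<psi> (x, y) \<partial>lborel \<partial>lborel)"
  proof (rule nn_integral_cong)
    fix y :: real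
    show "(\<integral>\<^sup>+x. \<psi> (x + a * y, y) \<partial>lborel) = (\<integral>\<^sup>+x. \<psi> (x, y) \<partial>lborel)"
      using nn_integral_real_affine[of "\<lambda>x. \<psi> (x, y)" 1 "a * y"] by (simp add: add.commute)
  qed
  also have "\<dots> = (\<integral>\<^sup>+x. \<integral>\<^sup>+y. \<psi> (x, y) \<partial>lborel \<partial>lborel)"
    by (rule lborel_pair.Fubini') measurable
  finally show ?thesis .
qed

lemma nn_integral_shear2:
  fixes \<psi> :: "real \<times> real \<Rightarrow> ennreal"
  assumes [measurable]: "\<psi> \<in> borel_measurable borel"
  shows "(\<integral>\<^sup>+x. \<integral>\<^sup>+y. \<psi> (x, y + b * x) \<partial>lborel \<partial>lborel) = (\<integral>\<^sup>+x. \<integral>\<^sup>+y. \<psi> (x, y) \<partial>lborel \<partial>lborel)"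
proof (rule nn_integral_cong)
  fix x :: real
  show "(\<integral>\<^sup>+y. \<psi> (x, y + b * x) \<partial>lborel) = (\<integral>\<^sup>+y. \<psi> (x, y) \<partial>lborel)"
    using nn_integral_real_affine[of "\<lambda>y. \<psi> (x, y)" 1 "b * x"] by (simp add: add.commute)
qed

text \<open>A plane rotation is a product of three shears.\<close>
lemma nn_integral_rotate_lborel:
  fixes \<psi> :: "real \<times> real \<Rightarrow> ennreal" and c s :: real
  assumes [measurable]: "\<psi> \<in> borel_measurable borel" and cs: "c\<^sup>2 + s\<^sup>2 = 1" and c: "c \<ge> 0"
  shows "(\<integral>\<^sup>+x. \<integral>\<^sup>+y. \<psi> (c * x + s * y, - s * x + c * y) \<partial>lborel \<partial>lborel)
    = (\<integral>\<^sup>+x. \<integral>\<^sup>+y. \<psi> (x, y) \<partial>lborel \<partial>lborel)"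
proof -
  \<comment> \<open>For \<open>c = cos \<phi>\<close>, \<open>s = sin \<phi>\<close> this is
    \<open>tan (\<phi> / 2)\<close>, the slope of the two outer shears; the middle one has slope
    \<open>- s\<close>. The assumption \<open>c \<ge> 0\<close> keeps the denominator away from
    0.\<close>
  define a where "a = s / (1 + c)"
  have s2: "s * s = (1 - c) * (1 + c)" using cs by (simp add: power2_eq_square algebra_simps)
  have as: "a * s = 1 - c" using c s2 by (simp add: a_def)
  have ac: "a * (1 + c) = s" using c by (simp add: a_def)
  define \<psi>1 where "\<psi>1 = (\<lambda>(x, y). \<psi> (x + a * y, y))"
  define \<psi>2 where "\<psi>2 = (\<lambda>(x, y). \<psi>1 (x, y + (- s) * x))"
  have m1[measurable]: "\<psi>1 \<in> borel_measurable borel"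
    unfolding \<psi>1_def by (simp add: borel_prod[symmetric])
  have m2[measurable]: "\<psi>2 \<in> borel_measurable borel"
    unfolding \<psi>2_def by (simp add: borel_prod[symmetric])
  have eq: "\<psi> (c * x + s * y, - s * x + c * y) = \<psi>2 (x + a * y, y)" for x y
  proof -
    have 1: "y + (- s) * (x + a * y) = - s * x + c * y"
    proof -
      have "y + (- s) * (x + a * y) = - s * x + (1 - a * s) * y"
        by (simp add: algebra_simps)
      then show ?thesis by (simp only: as) simp
    qed
    have "x + a * y + a * (- s * x + c * y) = (1 - a * s) * x + (a * (1 + c)) * y"
      by (simp add: algebra_simps)
    also have "\<dots> = c * x + s * y" by (simp add: as ac)
    finally have "x + a * y + a * (- s * x + c * y) = c * x + s * y" .
    then show ?thesis unfolding \<psi>2_def \<psi>1_def using 1 by simp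
  qed
  have "(\<integral>\<^sup>+x. \<integral>\<^sup>+y. \<psi> (c * x + s * y, - s * x + c * y) \<partial>lborel \<partial>lborel) = (\<integral>\<^sup>+x. \<integral>\<^sup>+y. \<psi>2 (x, y) \<partial>lborel \<partial>lborel)"
    unfolding eq by (rule nn_integral_shear1[OF m2])
  also have "\<dots> = (\<integral>\<^sup>+x. \<integral>\<^sup>+y. \<psi>1 (x, y) \<partial>lborel \<partial>lborel)"
    using nn_integral_shear2[OF m1, of "- s"] by (simp add: \<psi>2_def)
  also have "\<dots> = (\<integral>\<^sup>+x. \<integral>\<^sup>+y. \<psi> (x, y) \<partial>lborel \<partial>lborel)"
    using nn_integral_shear1[OF assms(1), of a] by (simp add: \<psi>1_def)
  finally show ?thesis .
qed

lemma nn_integral_std_normal: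
  assumes [measurable]: "f \<in> borel_measurable borel"
  shows "(\<integral>\<^sup>+x. f x \<partial>N01) = (\<integral>\<^sup>+x. ennreal (std_normal_density x) * f x \<partial>lborel)"
  by (subst nn_integral_density) auto

text \<open>The joint density of two standard normals depends on
  \<open>x\<^sup>2 + y\<^sup>2\<close> alone, so the invariance of Lebesgue measure carries
  over.\<close>

lemma nn_integral_rotate_std_normal:
  fixes \<phi> :: "real \<times> real \<Rightarrow> ennreal" and c s :: real
  assumes [measurable]: "\<phi> \<in> borel_measurable (borel \<Otimes>\<^sub>M borel)" and cs: "c\<^sup>2 + s\<^sup>2 = 1" and c: "c \<ge> 0"
  shows "(\<integral>\<^sup>+x. \<integral>\<^sup>+y. \<phi> (c * x + s * y, - s * x + c * y) \<partial>N01 \<partial>N01)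
    = (\<integral>\<^sup>+x. \<integral>\<^sup>+y. \<phi> (x, y) \<partial>N01 \<partial>N01)"
proof -
  interpret N: prob_space N01 by (rule prob_space_std_normal)
  have sf: "sigma_finite_measure N01" ..
  have [measurable_cong]: "sets N01 = sets borel" by simp
  define \<psi> where "\<psi> = (\<lambda>(x, y). ennreal (std_normal_density x) * (ennreal (std_normal_density y) * \<phi> (x, y)))"
  have m: "\<psi> \<in> borel_measurable borel"
    unfolding \<psi>_def borel_prod[symmetric] by measurable
  have red: "(\<integral>\<^sup>+x. \<integral>\<^sup>+y. f (x, y) \<partial>N01 \<partial>N01)
     = (\<integral>\<^sup>+x. \<integral>\<^sup>+y. ennreal (std_normal_density x) * (ennreal (std_normal_density y) * f (x, y)) \<partial>lborel \<partial>lborel)"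
    if f[measurable]: "f \<in> borel_measurable (borel \<Otimes>\<^sub>M borel)" for f :: "real \<times> real \<Rightarrow> ennreal"
  proof -
    have "(\<integral>\<^sup>+x. \<integral>\<^sup>+y. f (x, y) \<partial>N01 \<partial>N01)
      = (\<integral>\<^sup>+x. (\<integral>\<^sup>+y. ennreal (std_normal_density y) * f (x, y) \<partial>lborel) \<partial>N01)"
      by (intro nn_integral_cong nn_integral_std_normal) measurable
    also have "\<dots> = (\<integral>\<^sup>+x. ennreal (std_normal_density x) * (\<integral>\<^sup>+y. ennreal (std_normal_density y) * f (x, y) \<partial>lborel) \<partial>lborel)"
      by (rule nn_integral_std_normal) measurable
    finally show ?thesis by (simp add: nn_integral_cmult)
  qed
  have inv: "std_normal_density x * std_normal_density y
     = std_normal_density (c * x + s * y) * std_normal_density (- s * x + c * y)" for x y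
  proof -
    have "(c * x + s * y)\<^sup>2 + (- s * x + c * y)\<^sup>2 = (c\<^sup>2 + s\<^sup>2) * (x\<^sup>2 + y\<^sup>2)"
      by (simp add: power2_eq_square algebra_simps)
    then have "(c * x + s * y)\<^sup>2 + (- s * x + c * y)\<^sup>2 = x\<^sup>2 + y\<^sup>2" using cs by simp
    then have "- x\<^sup>2 / 2 + - y\<^sup>2 / 2 = - (c * x + s * y)\<^sup>2 / 2 + - (- s * x + c * y)\<^sup>2 / 2"
      by linarith
    then have "exp (- x\<^sup>2 / 2) * exp (- y\<^sup>2 / 2) = exp (- (c * x + s * y)\<^sup>2 / 2) * exp (- (- s * x + c * y)\<^sup>2 / 2)"
      by (simp only: exp_add[symmetric])
    then show ?thesis
      unfolding std_normal_density_def by (simp only: mult.assoc mult.left_commute)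
  qed
  have "(\<integral>\<^sup>+x. \<integral>\<^sup>+y. \<phi> (c * x + s * y, - s * x + c * y) \<partial>N01 \<partial>N01)
    = (\<integral>\<^sup>+x. \<integral>\<^sup>+y. ennreal (std_normal_density x) * (ennreal (std_normal_density y) * \<phi> (c * x + s * y, - s * x + c * y)) \<partial>lborel \<partial>lborel)"
    using red[of "\<lambda>(x, y). \<phi> (c * x + s * y, - s * x + c * y)"] by simp
  also have "\<dots> = (\<integral>\<^sup>+x. \<integral>\<^sup>+y. \<psi> (c * x + s * y, - s * x + c * y) \<partial>lborel \<partial>lborel)"
    unfolding \<psi>_def prod.case mult.assoc[symmetric] ennreal_mult'[OF normal_density_nonneg, symmetric]
    by (subst inv) (rule refl)
  also have "\<dots> = (\<integral>\<^sup>+x. \<integral>\<^sup>+y. \<psi> (x, y) \<partial>lborel \<partial>lborel)"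
    by (rule nn_integral_rotate_lborel[OF m cs c])
  also have "\<dots> = (\<integral>\<^sup>+x. \<integral>\<^sup>+y. \<phi> (x, y) \<partial>N01 \<partial>N01)"
    by (subst red) (simp_all add: \<psi>_def)
  finally show ?thesis .
qed


text \<open>Induction on \<open>R\<close>: the pair of coordinates at the new index is rotated by
  the planar case, the others by the induction hypothesis. The function \<open>\<phi>'\<close> is
  the integrand with the new pair already integrated out.\<close>

lemma nn_integral_rotate_gauss:
  fixes c s :: real
  assumes R: "finite R" and cs: "c\<^sup>2 + s\<^sup>2 = 1" and c: "c \<ge> 0"
    and "\<phi> \<in> borel_measurable (gauss R \<Otimes>\<^sub>M gauss R)"
  shows "(\<integral>\<^sup>+x. \<integral>\<^sup>+y. \<phi> (\<lambda>r\<in>R. c * x r + s * y r, \<lambda>r\<in>R. - s * x r + c * y r) \<partial>gauss R \<partial>gauss R)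
    = (\<integral>\<^sup>+x. \<integral>\<^sup>+y. \<phi> (x, y) \<partial>gauss R \<partial>gauss R)"
  using R assms(4)
proof (induction R arbitrary: \<phi> rule: finite_induct)
  case empty
  then show ?case by (simp add: PiM_empty nn_integral_count_space_finite restrict_def)
next
  case (insert i R)
  interpret product_prob_space "\<lambda>_. N01" by (rule product_prob_space_std_normal)
  interpret N: prob_space N01 by (rule prob_space_std_normal)
  interpret G: prob_space "gauss R" by (rule prob_space_gauss)
  interpret NG: pair_sigma_finite N01 "gauss R" ..
  have red: "(\<integral>\<^sup>+x. \<integral>\<^sup>+y. f (x, y) \<partial>gauss (insert i R) \<partial>gauss (insert i R))
      = (\<integral>\<^sup>+x. \<integral>\<^sup>+y. (\<integral>\<^sup>+t. \<integral>\<^sup>+u. f (x(i := t), y(i := u))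
            \<partial>N01 \<partial>N01) \<partial>gauss R \<partial>gauss R)"
    if f[measurable]: "f \<in> borel_measurable (gauss (insert i R) \<Otimes>\<^sub>M gauss (insert i R))" for f
  proof -
    interpret G': prob_space "gauss (insert i R)" by (rule prob_space_gauss)
    have "(\<lambda>x. \<integral>\<^sup>+y. f (x, y) \<partial>gauss (insert i R)) \<in> borel_measurable (gauss (insert i R))"
      by (intro G'.borel_measurable_nn_integral) simp
    then have "(\<integral>\<^sup>+x. \<integral>\<^sup>+y. f (x, y) \<partial>gauss (insert i R) \<partial>gauss (insert i R))
      = (\<integral>\<^sup>+x. \<integral>\<^sup>+t. (\<integral>\<^sup>+y. f (x(i := t), y) \<partial>gauss (insert i R)) \<partial>N01 \<partial>gauss R)"
      using insert by (subst product_nn_integral_insert) auto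
    also have "\<dots> = (\<integral>\<^sup>+x. \<integral>\<^sup>+t. (\<integral>\<^sup>+y. \<integral>\<^sup>+u. f (x(i := t), y(i := u)) \<partial>N01 \<partial>gauss R) \<partial>N01 \<partial>gauss R)"
    proof (intro nn_integral_cong product_nn_integral_insert insert)
      fix x t assume x: "x \<in> space (gauss R)"
      then have "x(i := t) \<in> space (gauss (insert i R))"
        by (auto simp: space_PiM PiE_def extensional_def)
      then show "(\<lambda>y. f (x(i := t), y)) \<in> borel_measurable (gauss (insert i R))"
        by (intro measurable_compose[OF _ f] measurable_Pair1')
    qed
    \<comment> \<open>Exchanging \<open>y\<close> and \<open>t\<close> brings the two new
      coordinates \<open>t\<close> and \<open>u\<close> next to each other, as the plane rotation
      requires.\<close>
    also have "\<dots> = (\<integral>\<^sup>+x. (\<integral>\<^sup>+y. \<integral>\<^sup>+t. \<integral>\<^sup>+u. f (x(i := t), y(i := u)) \<partial>N01 \<partial>N01 \<partial>gauss R) \<partial>gauss R)"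
    proof (rule nn_integral_cong)
      fix x assume x[measurable]: "x \<in> space (gauss R)"
      have 1: "(\<lambda>t. x(i := t)) \<in> N01 \<rightarrow>\<^sub>M gauss (insert i R)"
        using measurable_component_update[OF x] insert by blast
      have [measurable]: "(\<lambda>p. x(i := fst (fst p))) \<in> (N01 \<Otimes>\<^sub>M gauss R) \<Otimes>\<^sub>M N01 \<rightarrow>\<^sub>M gauss (insert i R)"
        by (rule measurable_compose[OF _ 1]) measurable
      have [measurable]: "(\<lambda>p. (snd (fst p))(i := snd p)) \<in> (N01 \<Otimes>\<^sub>M gauss R) \<Otimes>\<^sub>M N01 \<rightarrow>\<^sub>M gauss (insert i R)"
        by (rule measurable_fun_upd[where J=R]) auto
      have "(\<lambda>p. f (x(i := fst (fst p)), (snd (fst p))(i := snd p))) \<in> borel_measurable ((N01 \<Otimes>\<^sub>M gauss R) \<Otimes>\<^sub>M N01)"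
        by measurable
      then have "(\<lambda>p. \<integral>\<^sup>+u. f (x(i := fst p), (snd p)(i := u)) \<partial>N01) \<in> borel_measurable (N01 \<Otimes>\<^sub>M gauss R)"
        by (intro M.borel_measurable_nn_integral) (simp add: case_prod_beta')
      then show "(\<integral>\<^sup>+t. \<integral>\<^sup>+y. \<integral>\<^sup>+u. f (x(i := t), y(i := u)) \<partial>N01 \<partial>gauss R \<partial>N01)
        = (\<integral>\<^sup>+y. \<integral>\<^sup>+t. \<integral>\<^sup>+u. f (x(i := t), y(i := u)) \<partial>N01 \<partial>N01 \<partial>gauss R)"
        by (intro NG.Fubini'[symmetric]) (simp add: case_prod_beta')
    qed
    finally show ?thesis .
  qed
  note [measurable] = insert.prems
  define \<phi>' where "\<phi>' = (\<lambda>(x, y). \<integral>\<^sup>+t. \<integral>\<^sup>+u. \<phi> (x(i := t), y(i := u)) \<partial>N01 \<partial>N01)"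
  have upd1[measurable]: "(\<lambda>p. (fst (fst (fst p)))(i := snd (fst p))) \<in> ((gauss R \<Otimes>\<^sub>M gauss R) \<Otimes>\<^sub>M N01) \<Otimes>\<^sub>M N01 \<rightarrow>\<^sub>M gauss (insert i R)"
    by (rule measurable_fun_upd[where J=R]) auto
  have upd2[measurable]: "(\<lambda>p. (snd (fst (fst p)))(i := snd p)) \<in> ((gauss R \<Otimes>\<^sub>M gauss R) \<Otimes>\<^sub>M N01) \<Otimes>\<^sub>M N01 \<rightarrow>\<^sub>M gauss (insert i R)"
    by (rule measurable_fun_upd[where J=R]) auto
  have "(\<lambda>p. \<phi> ((fst (fst (fst p)))(i := snd (fst p)), (snd (fst (fst p)))(i := snd p))) \<in> borel_measurable (((gauss R \<Otimes>\<^sub>M gauss R) \<Otimes>\<^sub>M N01) \<Otimes>\<^sub>M N01)"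
    by measurable
  then have [measurable]: "\<phi>' \<in> borel_measurable (gauss R \<Otimes>\<^sub>M gauss R)"
    unfolding \<phi>'_def case_prod_beta'
    by (intro M.borel_measurable_nn_integral) (simp add: case_prod_beta')
  have rotm: "(\<lambda>(x, y). (\<lambda>r\<in>I. c * x r + s * y r, \<lambda>r\<in>I. - s * x r + c * y r)) \<in> gauss I \<Otimes>\<^sub>M gauss I \<rightarrow>\<^sub>M gauss I \<Otimes>\<^sub>M gauss I" for I
    by measurable
  have "(\<integral>\<^sup>+x. \<integral>\<^sup>+y. \<phi> (\<lambda>r\<in>insert i R. c * x r + s * y r, \<lambda>r\<in>insert i R. - s * x r + c * y r) \<partial>gauss (insert i R) \<partial>gauss (insert i R))
    = (\<integral>\<^sup>+x. \<integral>\<^sup>+y. (\<integral>\<^sup>+t. \<integral>\<^sup>+u. \<phi> (\<lambda>r\<in>insert i R. c * (x(i := t)) r + s * (y(i := u)) r, \<lambda>r\<in>insert i R. - s * (x(i := t)) r + c * (y(i := u)) r)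
            \<partial>N01 \<partial>N01) \<partial>gauss R \<partial>gauss R)"
    using red[of "\<lambda>p. \<phi> (case p of (x, y) \<Rightarrow> (\<lambda>r\<in>insert i R. c * x r + s * y r, \<lambda>r\<in>insert i R. - s * x r + c * y r))"] measurable_compose[OF rotm insert.prems]
    by (simp del: fun_upd_apply)
  also have "\<dots> = (\<integral>\<^sup>+x. \<integral>\<^sup>+y. \<phi>' (\<lambda>r\<in>R. c * x r + s * y r, \<lambda>r\<in>R. - s * x r + c * y r) \<partial>gauss R \<partial>gauss R)"
  proof (intro nn_integral_cong)
    fix x y assume xy: "x \<in> space (gauss R)" "y \<in> space (gauss R)"
    define x' where "x' = (\<lambda>r\<in>R. c * x r + s * y r)"
    define y' where "y' = (\<lambda>r\<in>R. - s * x r + c * y r)"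
    have xy': "x' \<in> space (gauss R)" "y' \<in> space (gauss R)"
      by (auto simp: x'_def y'_def space_PiM)
    have 1: "(\<lambda>t. x'(i := t)) \<in> N01 \<rightarrow>\<^sub>M gauss (insert i R)"
      using measurable_component_update[OF xy'(1)] insert by blast
    have 2: "(\<lambda>t. y'(i := t)) \<in> N01 \<rightarrow>\<^sub>M gauss (insert i R)"
      using measurable_component_update[OF xy'(2)] insert by blast
    have [measurable]: "(\<lambda>p. x'(i := fst p)) \<in> borel \<Otimes>\<^sub>M borel \<rightarrow>\<^sub>M gauss (insert i R)"
      by (rule measurable_compose[OF _ 1]) auto
    have [measurable]: "(\<lambda>p. y'(i := snd p)) \<in> borel \<Otimes>\<^sub>M borel \<rightarrow>\<^sub>M gauss (insert i R)"
      by (rule measurable_compose[OF _ 2]) auto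
    have e: "(\<lambda>r\<in>insert i R. c * (x(i := t)) r + s * (y(i := u)) r) = x'(i := c * t + s * u)"
       "(\<lambda>r\<in>insert i R. - s * (x(i := t)) r + c * (y(i := u)) r) = y'(i := - s * t + c * u)" for t u
      using insert.hyps(2) by (auto simp: x'_def y'_def fun_eq_iff)
    have "(\<integral>\<^sup>+t. \<integral>\<^sup>+u. \<phi> (x'(i := c * t + s * u), y'(i := - s * t + c * u)) \<partial>N01 \<partial>N01)
      = (\<integral>\<^sup>+t. \<integral>\<^sup>+u. \<phi> (x'(i := t), y'(i := u)) \<partial>N01 \<partial>N01)"
      using nn_integral_rotate_std_normal[OF _ cs c, of "\<lambda>(t, u). \<phi> (x'(i := t), y'(i := u))"]
      by (simp add: case_prod_beta')
    then show "(\<integral>\<^sup>+t. \<integral>\<^sup>+u. \<phi> (\<lambda>r\<in>insert i R. c * (x(i := t)) r + s * (y(i := u)) r, \<lambda>r\<in>insert i R. - s * (x(i := t)) r + c * (y(i := u)) r)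
            \<partial>N01 \<partial>N01) = \<phi>' (\<lambda>r\<in>R. c * x r + s * y r, \<lambda>r\<in>R. - s * x r + c * y r)"
      unfolding e by (simp add: \<phi>'_def x'_def y'_def)
  qed
  also have "\<dots> = (\<integral>\<^sup>+x. \<integral>\<^sup>+y. \<phi>' (x, y) \<partial>gauss R \<partial>gauss R)"
    by (rule insert.IH) measurable
  also have "\<dots> = (\<integral>\<^sup>+x. \<integral>\<^sup>+y. \<phi> (x, y) \<partial>gauss (insert i R) \<partial>gauss (insert i R))"
    by (subst red[OF insert.prems]) (simp add: \<phi>'_def)
  finally show ?case .
qed

section \<open>Concentration of support functions\<close>

abbreviation (input) ip :: "'i set \<Rightarrow> ('i \<Rightarrow> real) \<Rightarrow> ('i \<Rightarrow> real) \<Rightarrow> real" where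
  "ip R s x \<equiv> \<Sum>r\<in>R. s r * x r"

abbreviation (input) l1 :: "'i set \<Rightarrow> ('i \<Rightarrow> real) \<Rightarrow> real" where
  "l1 R x \<equiv> \<Sum>r\<in>R. \<bar>x r\<bar>"

lemma ip_le_norm: "ip R u v \<le> sqrt (\<Sum>r\<in>R. (u r)\<^sup>2) * sqrt (\<Sum>r\<in>R. (v r)\<^sup>2)"
proof -
  have "ip R u v \<le> (\<Sum>r\<in>R. \<bar>u r\<bar> * \<bar>v r\<bar>)"
    by (intro sum_mono) (simp add: abs_mult[symmetric])
  also have "\<dots> \<le> sqrt (\<Sum>r\<in>R. (u r)\<^sup>2) * sqrt (\<Sum>r\<in>R. (v r)\<^sup>2)"
    using L2_set_mult_ineq[of u v R] by (simp add: L2_set_def)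
  finally show ?thesis .
qed

section \<open>Exponential moments of a standard Gaussian vector\<close>

lemma gauss_mgf1:
  shows "integrable N01 (\<lambda>x. exp (t * x))"
    and "(\<integral>x. exp (t * x) \<partial>N01) = exp (t\<^sup>2 / 2)"
proof -
  have e: "std_normal_density x * exp (t * x) = exp (t\<^sup>2 / 2) * normal_density t 1 x" for x
  proof -
    have "- x\<^sup>2 / 2 + t * x = t\<^sup>2 / 2 + - (x - t)\<^sup>2 / 2"
      by (simp add: power2_eq_square field_simps)
    then have "exp (- x\<^sup>2 / 2) * exp (t * x) = exp (t\<^sup>2 / 2) * exp (- (x - t)\<^sup>2 / 2)"
      by (simp only: exp_add[symmetric])
    then show ?thesis unfolding normal_density_def by simp
  qed
  show "integrable N01 (\<lambda>x. exp (t * x))"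
    by (subst integrable_density) (auto simp: e)
  show "(\<integral>x. exp (t * x) \<partial>N01) = exp (t\<^sup>2 / 2)"
    by (subst integral_density) (auto simp: e)
qed

lemma gauss_mgf:
  assumes R: "finite R"
  shows "integrable (gauss R) (\<lambda>x. exp (ip R s x))"
    and "(\<integral>x. exp (ip R s x) \<partial>gauss R) = exp ((\<Sum>r\<in>R. (s r)\<^sup>2) / 2)"
proof -
  interpret product_prob_space "\<lambda>_. N01" by (rule product_prob_space_std_normal)
  show "integrable (gauss R) (\<lambda>x. exp (ip R s x))"
    unfolding exp_sum[OF R] using R by (intro product_integrable_prod) (auto intro: gauss_mgf1)
  show "(\<integral>x. exp (ip R s x) \<partial>gauss R) = exp ((\<Sum>r\<in>R. (s r)\<^sup>2) / 2)"
    unfolding exp_sum[OF R] using R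
    by (subst product_integral_prod) (auto simp: gauss_mgf1 exp_sum sum_divide_distrib)
qed

text \<open>A common integrable majorant: it dominates a support function, its square and its
  exponentials, and later the cubic Taylor remainder.\<close>

lemma gauss_exp_abs_integrable:
  assumes R: "finite R"
  shows "integrable (gauss R) (\<lambda>x. exp (k * l1 R x))"
proof -
  interpret product_prob_space "\<lambda>_. N01" by (rule product_prob_space_std_normal)
  have 1: "integrable N01 (\<lambda>x. exp (k * \<bar>x\<bar>))"
  proof (rule Bochner_Integration.integrable_bound)
    show "integrable N01 (\<lambda>x. exp (k * x) + exp (- k * x))"
      using gauss_mgf1(1)[of k] gauss_mgf1(1)[of "-k"] by (intro Bochner_Integration.integrable_add)
    show "AE x in N01. norm (exp (k * \<bar>x\<bar>)) \<le> norm (exp (k * x) + exp (- k * x))"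
    proof (rule AE_I2)
      fix x
      have "exp (k * \<bar>x\<bar>) \<le> exp (k * x) + exp (- k * x)"
        by (cases "x < 0") (auto simp: add_increasing add_increasing2)
      then show "norm (exp (k * \<bar>x\<bar>)) \<le> norm (exp (k * x) + exp (- k * x))" by simp
    qed
  qed simp
  show ?thesis
    unfolding sum_distrib_left exp_sum[OF R] using R 1 by (intro product_integrable_prod) auto
qed

text \<open>\<open>F\<close> is the support function of some set in the unit ball of \<open>\<real>\<^sup>R\<close>; the set is left implicit and
  \<open>s\<close> is a maximizer at \<open>x\<close>, hence a subgradient.\<close>
definition support_fun :: "'i set \<Rightarrow> (('i \<Rightarrow> real) \<Rightarrow> real) \<Rightarrow> bool" where
  "support_fun R F \<longleftrightarrow> F \<in> borel_measurable (gauss R) \<and>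
     (\<forall>x. \<exists>s. (\<Sum>r\<in>R. (s r)\<^sup>2) \<le> 1 \<and> F x = ip R s x \<and> (\<forall>y. ip R s y \<le> F y))"

lemma support_fun_measurable: "support_fun R F \<Longrightarrow> F \<in> borel_measurable (gauss R)"
  by (simp add: support_fun_def)

lemma support_funE:
  assumes "support_fun R F"
  obtains s where "(\<Sum>r\<in>R. (s r)\<^sup>2) \<le> 1" "F x = ip R s x" "\<And>y. ip R s y \<le> F y"
  using assms unfolding support_fun_def by blast

text \<open>A support function is defined on all of \<open>'i \<Rightarrow> real\<close>, while
  points of \<open>gauss R\<close> are restricted to \<open>R\<close>. The subgradient at a point
  pairs only with coordinates in \<open>R\<close>, so values elsewhere cannot matter.\<close>

lemma support_fun_cong:
  assumes F: "support_fun R F" and xy: "\<And>r. r \<in> R \<Longrightarrow> x r = y r"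
  shows "F x = F y"
proof -
  have "F x \<le> F y" if "\<And>r. r \<in> R \<Longrightarrow> x r = y r" for x y
  proof -
    obtain s where s: "F x = ip R s x" "\<And>y. ip R s y \<le> F y" using support_funE[OF F, of x] by blast
    have "ip R s x = ip R s y" using that by (intro sum.cong) auto
    then show ?thesis using s by metis
  qed
  then show ?thesis using xy by (metis order_antisym)
qed

lemma ip_le_sum_abs:
  assumes R: "finite R" and s: "(\<Sum>r\<in>R. (s r)\<^sup>2) \<le> 1"
  shows "\<bar>ip R s x\<bar> \<le> l1 R x"
proof -
  have "\<bar>s r\<bar> \<le> 1" if "r \<in> R" for r
  proof -
    have "(s r)\<^sup>2 \<le> (\<Sum>r\<in>R. (s r)\<^sup>2)" using R that by (intro member_le_sum) auto
    with s show ?thesis using abs_square_le_1[of "s r"] by simp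
  qed
  then have "\<bar>s r * x r\<bar> \<le> \<bar>x r\<bar>" if "r \<in> R" for r
    using that by (simp add: abs_mult mult_left_le_one_le)
  then have "(\<Sum>r\<in>R. \<bar>s r * x r\<bar>) \<le> l1 R x" by (rule sum_mono)
  then show ?thesis using sum_abs[of "\<lambda>r. s r * x r" R] by linarith
qed

lemma support_fun_bound:
  assumes R: "finite R" and F: "support_fun R F"
  shows "\<bar>F x\<bar> \<le> l1 R x"
proof -
  obtain s where s: "(\<Sum>r\<in>R. (s r)\<^sup>2) \<le> 1" "F x = ip R s x" using support_funE[OF F, of x] by blast
  then show ?thesis using ip_le_sum_abs[OF R s(1)] by simp
qed

text \<open>A subgradient \<open>s\<close> at \<open>z\<close> bounds the increment by
  \<open>(1 - cos a) * F z - sin a * ip R s w\<close>. Since \<open>s\<close> depends on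
  \<open>z\<close> only and \<open>w\<close> is independent of it, the integral over
  \<open>w\<close> is an exact Gaussian moment generating function. The first summand is of second
  order in \<open>a\<close> and may be bounded crudely through \<open>l1 R z\<close>.\<close>

lemma support_fun_step:
  fixes a k :: real
  assumes R: "finite R" and F: "support_fun R F" and k: "k \<ge> 0"
  shows "(\<integral>\<^sup>+z. \<integral>\<^sup>+w. ennreal (exp (k * (F z - F (\<lambda>r\<in>R. cos a * z r + sin a * w r)))) \<partial>gauss R \<partial>gauss R)
    \<le> ennreal ((\<integral>z. exp (k * (1 - cos a) * l1 R z) \<partial>gauss R) * exp (k\<^sup>2 * (sin a)\<^sup>2 / 2))"
proof -
  have inner: "(\<integral>\<^sup>+w. ennreal (exp (k * (F z - F (\<lambda>r\<in>R. cos a * z r + sin a * w r)))) \<partial>gauss R)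
     \<le> ennreal (exp (k * (1 - cos a) * l1 R z) * exp (k\<^sup>2 * (sin a)\<^sup>2 / 2))" for z
  proof -
    obtain s where s: "(\<Sum>r\<in>R. (s r)\<^sup>2) \<le> 1" "F z = ip R s z" "\<And>y. ip R s y \<le> F y"
      using support_funE[OF F, of z] by blast
    let ?C = "exp (k * (1 - cos a) * F z)"
    define s' where "s' = (\<lambda>r. - (k * sin a) * s r)"
    have "(\<integral>\<^sup>+w. ennreal (exp (k * (F z - F (\<lambda>r\<in>R. cos a * z r + sin a * w r)))) \<partial>gauss R)
      \<le> (\<integral>\<^sup>+w. ennreal (?C * exp (ip R s' w)) \<partial>gauss R)"
    proof (rule nn_integral_mono, rule ennreal_leI)
      fix w
      have "ip R s (\<lambda>r\<in>R. cos a * z r + sin a * w r) = cos a * F z + sin a * ip R s w"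
        unfolding s(2) sum_distrib_left by (simp add: sum.distrib[symmetric] algebra_simps)
      then have "F z - F (\<lambda>r\<in>R. cos a * z r + sin a * w r) \<le> (1 - cos a) * F z - sin a * ip R s w"
        using s(3)[of "\<lambda>r\<in>R. cos a * z r + sin a * w r"] by (simp add: algebra_simps)
      then have "k * (F z - F (\<lambda>r\<in>R. cos a * z r + sin a * w r)) \<le> k * ((1 - cos a) * F z - sin a * ip R s w)"
        using k by (rule mult_left_mono)
      also have "\<dots> = k * (1 - cos a) * F z + ip R s' w"
        by (simp add: s'_def algebra_simps sum_distrib_left sum_negf)
      finally show "exp (k * (F z - F (\<lambda>r\<in>R. cos a * z r + sin a * w r))) \<le> ?C * exp (ip R s' w)"
        by (simp add: exp_add[symmetric])
    qed
    also have "\<dots> = ennreal (\<integral>w. ?C * exp (ip R s' w) \<partial>gauss R)"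
      using gauss_mgf(1)[OF R] by (intro nn_integral_eq_integral) auto
    also have "(\<integral>w. ?C * exp (ip R s' w) \<partial>gauss R) = ?C * exp ((\<Sum>r\<in>R. (s' r)\<^sup>2) / 2)"
      using gauss_mgf[OF R] by simp
    also have "ennreal \<dots> \<le> ennreal (exp (k * (1 - cos a) * l1 R z) * exp (k\<^sup>2 * (sin a)\<^sup>2 / 2))"
    proof (intro ennreal_leI mult_mono)
      have "k * (1 - cos a) * F z \<le> k * (1 - cos a) * l1 R z"
        using support_fun_bound[OF R F, of z] k by (intro mult_left_mono) auto
      then show "?C \<le> exp (k * (1 - cos a) * l1 R z)" by simp
      have "(\<Sum>r\<in>R. (s' r)\<^sup>2) = k\<^sup>2 * (sin a)\<^sup>2 * (\<Sum>r\<in>R. (s r)\<^sup>2)"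
        by (simp add: s'_def power_mult_distrib sum_distrib_left)
      also have "\<dots> \<le> k\<^sup>2 * (sin a)\<^sup>2" using s(1) by (simp add: mult_left_le)
      finally show "exp ((\<Sum>r\<in>R. (s' r)\<^sup>2) / 2) \<le> exp (k\<^sup>2 * (sin a)\<^sup>2 / 2)" by simp
    qed auto
    finally show ?thesis .
  qed
  have "(\<integral>\<^sup>+z. \<integral>\<^sup>+w. ennreal (exp (k * (F z - F (\<lambda>r\<in>R. cos a * z r + sin a * w r)))) \<partial>gauss R \<partial>gauss R)
    \<le> (\<integral>\<^sup>+z. ennreal (exp (k * (1 - cos a) * l1 R z) * exp (k\<^sup>2 * (sin a)\<^sup>2 / 2)) \<partial>gauss R)"
    by (intro nn_integral_mono inner)
  also have "\<dots> = ennreal (\<integral>z. exp (k * (1 - cos a) * l1 R z) * exp (k\<^sup>2 * (sin a)\<^sup>2 / 2) \<partial>gauss R)"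
    using gauss_exp_abs_integrable[OF R] by (intro nn_integral_eq_integral) auto
  finally show ?thesis by simp
qed

text \<open>Jensen's inequality for \<open>exp\<close>. The steps of the rotation are dependent, so
  the exponential of their sum is split by convexity instead; this scales each increment by
  \<open>N\<close>, which is harmless for increments of size about \<open>1 / N\<close>.\<close>

lemma exp_sum_le_average:
  assumes "N > 0"
  shows "exp (\<Sum>j<N. d j) \<le> (1 / real N) * (\<Sum>j<N. exp (real N * d j))"
proof -
  have "exp (\<Sum>j<N. (1 / real N) *\<^sub>R (real N * d j)) \<le> (\<Sum>j<N. (1 / real N) * exp (real N * d j))"
    using assms by (intro convex_on_sum[OF _ _ exp_convex]) auto
  then show ?thesis using assms by (simp add: sum_distrib_left)
qed

lemma one_minus_cos_le: "1 - cos x \<le> x\<^sup>2 / (2::real)"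
proof -
  have "(sin (x / 2))\<^sup>2 \<le> (x / 2)\<^sup>2"
    using abs_sin_x_le_abs_x[of "x / 2"] by (intro abs_le_square_iff[THEN iffD1])
  then show ?thesis using cos_double_sin[of "x / 2"] by (simp add: power_divide)
qed

text \<open>The Maurey--Pisier rotation from \<open>x\<close> to \<open>y\<close>, cut into \<open>N\<close> equal steps: convexity bounds each
  increment of \<open>F\<close> by a subgradient, which is independent of the direction of the step, so \<open>F\<close> need
  not be differentiable.\<close>
lemma support_fun_exp_diff_N:
  assumes R: "finite R" and F: "support_fun R F" and l: "l \<ge> 0" and N: "N > 0"
  shows "(\<integral>\<^sup>+x. \<integral>\<^sup>+y. ennreal (exp (l * (F x - F y))) \<partial>gauss R \<partial>gauss R)
    \<le> ennreal ((\<integral>z. exp (2 * l / real N * l1 R z) \<partial>gauss R) * exp (2 * l\<^sup>2))"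
proof -
  interpret G: prob_space "gauss R" by (rule prob_space_gauss)
  interpret GG: pair_sigma_finite "gauss R" "gauss R" ..
  note [measurable] = support_fun_measurable[OF F]
  define a where "a = pi / (2 * real N)"
  define Z where "Z = (\<lambda>j x y. \<lambda>r\<in>R. cos (real j * a) * x r + sin (real j * a) * y r)"
  define d where "d = (\<lambda>j x y. F (Z j x y) - F (Z (Suc j) x y))"
  have [measurable]: "(\<lambda>(x, y). d j x y) \<in> borel_measurable (gauss R \<Otimes>\<^sub>M gauss R)" for j
    unfolding d_def Z_def by measurable
  have Na: "real N * a = pi / 2" using N by (simp add: a_def)
  let ?M = "ennreal ((\<integral>z. exp (2 * l / real N * l1 R z) \<partial>gauss R) * exp (2 * l\<^sup>2))"
  \<comment> \<open>From \<open>pi < 4\<close> alone: \<open>pi\<^sup>2 / 8 \<le> 2\<close> produces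
    both the factor \<open>2 * l / real N\<close> and the exponent
    \<open>2 * l\<^sup>2\<close>.\<close>
  have pi2: "pi\<^sup>2 < 16" using pi_less_4 power_strict_mono[of pi 4 2] by simp
  have step: "(\<integral>\<^sup>+x. \<integral>\<^sup>+y. ennreal (exp (real N * (l * d j x y))) \<partial>gauss R \<partial>gauss R) \<le> ?M" if "j < N" for j
  proof -
    let ?k = "real N * l"
    define t where "t = real j * a"
    have t: "0 \<le> t" "t \<le> pi / 2"
    proof -
      show "0 \<le> t" by (simp add: t_def a_def)
      have "t \<le> real N * a" unfolding t_def using that by (intro mult_right_mono) (auto simp: a_def)
      then show "t \<le> pi / 2" using Na by simp
    qed
    have ct: "cos t \<ge> 0" using t by (intro cos_ge_zero) auto
    \<comment> \<open>In coordinates rotated by \<open>t\<close> the \<open>j\<close>-th point is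
      the first vector, and the next point is that vector rotated by \<open>a\<close> towards the
      second. By invariance every step then has the same law as the first one.\<close>
    define \<phi> where "\<phi> = (\<lambda>(z, w). ennreal (exp (?k * (F z - F (\<lambda>r\<in>R. cos a * z r + sin a * w r)))))"
    have [measurable]: "\<phi> \<in> borel_measurable (gauss R \<Otimes>\<^sub>M gauss R)" unfolding \<phi>_def by measurable
    have "ennreal (exp (real N * (l * d j x y)))
      = \<phi> (\<lambda>r\<in>R. cos t * x r + sin t * y r, \<lambda>r\<in>R. - sin t * x r + cos t * y r)" for x y
    proof -
      have "Z (Suc j) x y = (\<lambda>r\<in>R. cos a * (\<lambda>r\<in>R. cos t * x r + sin t * y r) r + sin a * (\<lambda>r\<in>R. - sin t * x r + cos t * y r) r)"
      proof
        fix r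
        have "real (Suc j) * a = t + a" by (simp add: t_def algebra_simps)
        then show "Z (Suc j) x y r = (\<lambda>r\<in>R. cos a * (\<lambda>r\<in>R. cos t * x r + sin t * y r) r + sin a * (\<lambda>r\<in>R. - sin t * x r + cos t * y r) r) r"
          by (simp add: Z_def cos_add sin_add algebra_simps)
      qed
      then show ?thesis by (simp add: \<phi>_def d_def Z_def t_def mult.assoc)
    qed
    then have "(\<integral>\<^sup>+x. \<integral>\<^sup>+y. ennreal (exp (real N * (l * d j x y))) \<partial>gauss R \<partial>gauss R)
      = (\<integral>\<^sup>+x. \<integral>\<^sup>+y. \<phi> (\<lambda>r\<in>R. cos t * x r + sin t * y r, \<lambda>r\<in>R. - sin t * x r + cos t * y r) \<partial>gauss R \<partial>gauss R)"
      by simp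
    also have "\<dots> = (\<integral>\<^sup>+x. \<integral>\<^sup>+y. \<phi> (x, y) \<partial>gauss R \<partial>gauss R)"
      using ct by (intro nn_integral_rotate_gauss[OF R]) auto
    also have "\<dots> \<le> ennreal ((\<integral>z. exp (?k * (1 - cos a) * l1 R z) \<partial>gauss R) * exp (?k\<^sup>2 * (sin a)\<^sup>2 / 2))"
      unfolding \<phi>_def prod.case using l by (intro support_fun_step[OF R F]) auto
    also have "\<dots> \<le> ?M"
    proof (intro ennreal_leI mult_mono)
      have "?k * (1 - cos a) \<le> ?k * (a\<^sup>2 / 2)" using l by (intro mult_left_mono one_minus_cos_le) auto
      also have "\<dots> = l * (pi\<^sup>2 / 8) / real N" using N by (simp add: a_def power2_eq_square field_simps)
      also have "\<dots> \<le> l * 2 / real N" using l pi2 by (intro divide_right_mono mult_left_mono) auto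
      finally have k2: "?k * (1 - cos a) \<le> 2 * l / real N" by (simp add: mult.commute)
      show "(\<integral>z. exp (?k * (1 - cos a) * l1 R z) \<partial>gauss R) \<le> (\<integral>z. exp (2 * l / real N * l1 R z) \<partial>gauss R)"
      proof (intro integral_mono gauss_exp_abs_integrable[OF R])
        fix z :: "'a \<Rightarrow> real"
        show "exp (?k * (1 - cos a) * l1 R z) \<le> exp (2 * l / real N * l1 R z)"
          using mult_right_mono[OF k2, of "\<Sum>r\<in>R. \<bar>z r\<bar>"] by (simp add: sum_nonneg)
      qed
      have "(sin a)\<^sup>2 \<le> a\<^sup>2" using abs_sin_x_le_abs_x[of a] by (simp add: abs_le_square_iff)
      then have "?k\<^sup>2 * (sin a)\<^sup>2 \<le> ?k\<^sup>2 * a\<^sup>2" by (intro mult_left_mono) auto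
      also have "?k\<^sup>2 * a\<^sup>2 = l\<^sup>2 * (real N * a)\<^sup>2" by (simp add: power_mult_distrib mult_ac)
      also have "\<dots> = l\<^sup>2 * (pi\<^sup>2 / 4)" by (simp add: Na power_divide)
      also have "\<dots> \<le> l\<^sup>2 * 4" using pi2 by (intro mult_left_mono) auto
      finally show "exp (?k\<^sup>2 * (sin a)\<^sup>2 / 2) \<le> exp (2 * l\<^sup>2)" by simp
    qed auto
    finally show ?thesis .
  qed
  have "(\<integral>\<^sup>+x. \<integral>\<^sup>+y. ennreal (exp (l * (F x - F y))) \<partial>gauss R \<partial>gauss R)
    \<le> (\<integral>\<^sup>+x. \<integral>\<^sup>+y. (\<Sum>j<N. ennreal (1 / real N) * ennreal (exp (real N * (l * d j x y)))) \<partial>gauss R \<partial>gauss R)"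
  proof (intro nn_integral_mono)
    fix x y assume "x \<in> space (gauss R)" "y \<in> space (gauss R)"
    have cs: "cos (real N * a) = 0" "sin (real N * a) = 1" by (simp_all only: Na cos_pi_half sin_pi_half)
    have 0: "F (Z 0 x y) = F x" "F (Z N x y) = F y"
      using cs by (auto intro!: support_fun_cong[OF F] simp: Z_def)
    have "(\<Sum>j<N. d j x y) = F (Z 0 x y) - F (Z N x y)"
      unfolding d_def by (rule sum_lessThan_telescope')
    then have "l * (F x - F y) = (\<Sum>j<N. l * d j x y)" by (simp add: 0 sum_distrib_left[symmetric])
    then have "exp (l * (F x - F y)) \<le> (1 / real N) * (\<Sum>j<N. exp (real N * (l * d j x y)))"
      using exp_sum_le_average[OF N, of "\<lambda>j. l * d j x y"] by simp
    then have "ennreal (exp (l * (F x - F y))) \<le> ennreal (\<Sum>j<N. (1 / real N) * exp (real N * (l * d j x y)))"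
      by (simp add: sum_distrib_left ennreal_leI)
    also have "\<dots> = (\<Sum>j<N. ennreal (1 / real N) * ennreal (exp (real N * (l * d j x y))))"
      by (simp only: ennreal_mult'[symmetric, of "1 / real N"] zero_le_divide_1_iff of_nat_0_le_iff)
        (rule sum_ennreal[symmetric], simp)
    finally show "ennreal (exp (l * (F x - F y))) \<le> (\<Sum>j<N. ennreal (1 / real N) * ennreal (exp (real N * (l * d j x y))))" .
  qed
  also have "\<dots> = (\<Sum>j<N. ennreal (1 / real N) * (\<integral>\<^sup>+x. \<integral>\<^sup>+y. ennreal (exp (real N * (l * d j x y))) \<partial>gauss R \<partial>gauss R))"
  proof -
    define f where "f = (\<lambda>j p. case p of (x, y) \<Rightarrow> ennreal (exp (real N * (l * d j x y))))"
    have [measurable]: "f j \<in> borel_measurable (gauss R \<Otimes>\<^sub>M gauss R)" for j unfolding f_def by measurable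
    have "(\<integral>\<^sup>+x. \<integral>\<^sup>+y. (\<Sum>j<N. ennreal (1 / real N) * f j (x, y)) \<partial>gauss R \<partial>gauss R)
       = (\<integral>\<^sup>+p. (\<Sum>j<N. ennreal (1 / real N) * f j p) \<partial>(gauss R \<Otimes>\<^sub>M gauss R))"
      by (rule G.nn_integral_fst) measurable
    also have "\<dots> = (\<Sum>j<N. ennreal (1 / real N) * (\<integral>\<^sup>+p. f j p \<partial>(gauss R \<Otimes>\<^sub>M gauss R)))"
      by (simp add: nn_integral_sum nn_integral_cmult)
    also have "\<dots> = (\<Sum>j<N. ennreal (1 / real N) * (\<integral>\<^sup>+x. \<integral>\<^sup>+y. f j (x, y) \<partial>gauss R \<partial>gauss R))"
      by (simp add: G.nn_integral_fst)
    finally show ?thesis unfolding f_def prod.case .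
  qed
  also have "\<dots> \<le> (\<Sum>j<N. ennreal (1 / real N) * ?M)"
    by (intro sum_mono mult_left_mono step) auto
  also have "\<dots> = of_nat N * (ennreal (1 / real N) * ?M)" by simp
  also have "\<dots> = ?M"
    using N by (simp add: mult.assoc[symmetric] ennreal_of_nat_eq_real_of_nat ennreal_mult'[symmetric])
  finally show ?thesis .
qed

text \<open>As \<open>N\<close> grows the factor containing \<open>l1\<close> tends to 1 by
  dominated convergence. The sign of \<open>l\<close> is reversed by exchanging the two independent
  copies.\<close>

lemma support_fun_exp_diff:
  assumes R: "finite R" and F: "support_fun R F"
  shows "(\<integral>\<^sup>+x. \<integral>\<^sup>+y. ennreal (exp (l * (F x - F y))) \<partial>gauss R \<partial>gauss R) \<le> ennreal (exp (2 * l\<^sup>2))"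
proof -
  interpret G: prob_space "gauss R" by (rule prob_space_gauss)
  interpret GG: pair_sigma_finite "gauss R" "gauss R" ..
  note [measurable] = support_fun_measurable[OF F]
  have nonneg: "(\<integral>\<^sup>+x. \<integral>\<^sup>+y. ennreal (exp (l * (F x - F y))) \<partial>gauss R \<partial>gauss R) \<le> ennreal (exp (2 * l\<^sup>2))"
    if l: "l \<ge> 0" for l
  proof -
    have "(\<lambda>N. \<integral>z. exp (2 * l / real N * l1 R z) \<partial>gauss R) \<longlonglongrightarrow> (\<integral>z. 1 \<partial>gauss R)"
    proof (rule integral_dominated_convergence[where w="\<lambda>z. exp (2 * l * l1 R z)"])
      show "integrable (gauss R) (\<lambda>z. exp (2 * l * l1 R z))"
        by (rule gauss_exp_abs_integrable[OF R])
      show "AE z in gauss R. (\<lambda>N. exp (2 * l / real N * l1 R z)) \<longlonglongrightarrow> 1"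
      proof (rule AE_I2)
        fix z :: "'a \<Rightarrow> real"
        have "(\<lambda>N. 2 * l / real N * l1 R z) \<longlonglongrightarrow> 0 * l1 R z"
          by (intro tendsto_intros lim_const_over_n)
        then show "(\<lambda>N. exp (2 * l / real N * l1 R z)) \<longlonglongrightarrow> 1"
          using tendsto_exp by fastforce
      qed
      show "AE z in gauss R. norm (exp (2 * l / real N * l1 R z)) \<le> exp (2 * l * l1 R z)" for N
      proof (rule AE_I2)
        fix z :: "'a \<Rightarrow> real"
        have "2 * l / real N \<le> 2 * l" using l mult_left_mono[of 1 "real N" l] by (cases "N = 0") (auto simp: field_simps)
        then have "2 * l / real N * l1 R z \<le> 2 * l * l1 R z"
          by (intro mult_right_mono sum_nonneg) auto
        then show "norm (exp (2 * l / real N * l1 R z)) \<le> exp (2 * l * l1 R z)" by simp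
      qed
    qed measurable
    then have "(\<lambda>N. ennreal ((\<integral>z. exp (2 * l / real N * l1 R z) \<partial>gauss R) * exp (2 * l\<^sup>2)))
       \<longlonglongrightarrow> ennreal ((\<integral>z. 1 \<partial>gauss R) * exp (2 * l\<^sup>2))"
      by (intro tendsto_intros tendsto_ennrealI)
    then have lim: "(\<lambda>N. ennreal ((\<integral>z. exp (2 * l / real N * l1 R z) \<partial>gauss R) * exp (2 * l\<^sup>2)))
       \<longlonglongrightarrow> ennreal (exp (2 * l\<^sup>2))"
      by (simp add: G.prob_space)
    show ?thesis
      by (rule LIMSEQ_le_const[OF lim]) (intro exI[of _ 1] allI impI support_fun_exp_diff_N[OF R F l], simp)
  qed
  show ?thesis
  proof (cases "l \<ge> 0")
    case False
    have "(\<integral>\<^sup>+x. \<integral>\<^sup>+y. ennreal (exp (l * (F x - F y))) \<partial>gauss R \<partial>gauss R)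
      = (\<integral>\<^sup>+y. \<integral>\<^sup>+x. ennreal (exp (l * (F x - F y))) \<partial>gauss R \<partial>gauss R)"
      by (rule GG.Fubini'[symmetric]) measurable
    also have "\<dots> = (\<integral>\<^sup>+x. \<integral>\<^sup>+y. ennreal (exp ((- l) * (F x - F y))) \<partial>gauss R \<partial>gauss R)"
      by (simp add: algebra_simps)
    also have "\<dots> \<le> ennreal (exp (2 * (- l)\<^sup>2))" using False by (intro nonneg) auto
    finally show ?thesis by simp
  qed (rule nonneg)
qed

section \<open>Exponential, tail and second moment bounds around the mean\<close>

lemma support_fun_integrable:
  assumes R: "finite R" and F: "support_fun R F"
  shows "integrable (gauss R) (\<lambda>x. exp (l * F x))" "integrable (gauss R) F" "integrable (gauss R) (\<lambda>x. (F x)\<^sup>2)"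
proof -
  note [measurable] = support_fun_measurable[OF F]
  have b: "\<bar>F x\<bar> \<le> l1 R x" for x by (rule support_fun_bound[OF R F])
  show "integrable (gauss R) (\<lambda>x. exp (l * F x))"
  proof (rule Bochner_Integration.integrable_bound[OF gauss_exp_abs_integrable[OF R, of "\<bar>l\<bar>"]])
    show "AE x in gauss R. norm (exp (l * F x)) \<le> norm (exp (\<bar>l\<bar> * l1 R x))"
    proof (rule AE_I2)
      fix x
      have "l * F x \<le> \<bar>l\<bar> * \<bar>F x\<bar>" by (simp add: abs_mult[symmetric])
      also have "\<dots> \<le> \<bar>l\<bar> * l1 R x" using b by (rule mult_left_mono) simp
      finally show "norm (exp (l * F x)) \<le> norm (exp (\<bar>l\<bar> * l1 R x))" by simp
    qed
  qed measurable
  show "integrable (gauss R) F"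
  proof (rule Bochner_Integration.integrable_bound[OF gauss_exp_abs_integrable[OF R, of 1]])
    show "AE x in gauss R. norm (F x) \<le> norm (exp (1 * l1 R x))"
    proof (rule AE_I2)
      fix x
      show "norm (F x) \<le> norm (exp (1 * l1 R x))"
        unfolding real_norm_def abs_exp_cancel mult_1
        using b[of x] exp_ge_add_one_self[of "\<Sum>r\<in>R. \<bar>x r\<bar>"] by linarith
    qed
  qed measurable
  show "integrable (gauss R) (\<lambda>x. (F x)\<^sup>2)"
  proof (rule Bochner_Integration.integrable_bound[OF gauss_exp_abs_integrable[OF R, of 2]])
    show "AE x in gauss R. norm ((F x)\<^sup>2) \<le> norm (exp (2 * l1 R x))"
    proof (rule AE_I2)
      fix x
      have "\<bar>F x\<bar> \<le> exp (l1 R x)"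
        using b[of x] exp_ge_add_one_self[of "\<Sum>r\<in>R. \<bar>x r\<bar>"] by linarith
      then have "\<bar>F x\<bar>\<^sup>2 \<le> (exp (l1 R x))\<^sup>2" by (rule power_mono) simp
      then show "norm ((F x)\<^sup>2) \<le> norm (exp (2 * l1 R x))"
        by (simp add: exp_double)
    qed
  qed measurable
qed

text \<open>Jensen's inequality in the independent copy \<open>y\<close> replaces \<open>F y\<close>
  by its mean, which turns the bound for a difference of two copies into one for the centred
  function.\<close>

lemma support_fun_subgaussian:
  assumes R: "finite R" and F: "support_fun R F"
  defines "m \<equiv> \<integral>x. F x \<partial>gauss R"
  shows "integrable (gauss R) (\<lambda>x. exp (l * (F x - m)))"
    and "(\<integral>x. exp (l * (F x - m)) \<partial>gauss R) \<le> exp (2 * l\<^sup>2)"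
proof -
  interpret G: prob_space "gauss R" by (rule prob_space_gauss)
  note int = support_fun_integrable[OF R F]
  note [measurable] = support_fun_measurable[OF F]
  have e: "exp (l * (F x - c)) = exp (- l * c) * exp (l * F x)" for x c l
    by (simp add: exp_add[symmetric] algebra_simps)
  show I: "integrable (gauss R) (\<lambda>x. exp (l * (F x - m)))"
    unfolding e using int(1) by (intro integrable_mult_right)
  have jensen: "ennreal (exp (l * (F x - m))) \<le> (\<integral>\<^sup>+y. ennreal (exp (l * (F x - F y))) \<partial>gauss R)" for x
  proof -
    have e': "exp (l * (F x - F y)) = exp (l * F x) * exp ((- l) * F y)" for y
      by (simp add: exp_add[symmetric] algebra_simps)
    have I': "integrable (gauss R) (\<lambda>y. exp (l * (F x - F y)))"
      unfolding e' using int(1)[of "- l"] by (intro integrable_mult_right)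
    \<comment> \<open>Jensen by hand: the tangent line \<open>1 - u \<le> exp (- u)\<close> is used
      at \<open>u = l * (F y - m)\<close>, and the left-hand side has mean 1.\<close>
    have "exp (l * (F x - m)) = (\<integral>y. exp (l * (F x - m)) * (1 - l * (F y - m)) \<partial>gauss R)"
      using int(2) by (simp add: G.prob_space m_def)
    also have "\<dots> \<le> (\<integral>y. exp (l * (F x - F y)) \<partial>gauss R)"
    proof (rule integral_mono)
      show "integrable (gauss R) (\<lambda>y. exp (l * (F x - m)) * (1 - l * (F y - m)))" using int(2) by simp
      fix y
      have "exp (l * (F x - m)) * (1 - l * (F y - m)) \<le> exp (l * (F x - m)) * exp (- (l * (F y - m)))"
        using exp_ge_add_one_self[of "- (l * (F y - m))"] by (intro mult_left_mono) auto
      also have "\<dots> = exp (l * (F x - F y))" by (simp add: exp_add[symmetric] algebra_simps)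
      finally show "exp (l * (F x - m)) * (1 - l * (F y - m)) \<le> exp (l * (F x - F y))" .
    qed (rule I')
    finally show ?thesis by (subst nn_integral_eq_integral[OF I']) (auto intro: ennreal_leI)
  qed
  have "ennreal (\<integral>x. exp (l * (F x - m)) \<partial>gauss R) = (\<integral>\<^sup>+x. ennreal (exp (l * (F x - m))) \<partial>gauss R)"
    by (rule nn_integral_eq_integral[symmetric, OF I]) simp
  also have "\<dots> \<le> (\<integral>\<^sup>+x. \<integral>\<^sup>+y. ennreal (exp (l * (F x - F y))) \<partial>gauss R \<partial>gauss R)"
    by (intro nn_integral_mono jensen)
  also have "\<dots> \<le> ennreal (exp (2 * l\<^sup>2))" by (rule support_fun_exp_diff[OF R F])
  finally show "(\<integral>x. exp (l * (F x - m)) \<partial>gauss R) \<le> exp (2 * l\<^sup>2)" by simp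
qed

text \<open>Chernoff's bound at \<open>l = t / 4\<close>, the minimiser of
  \<open>2 * l\<^sup>2 - l * t\<close>; the minimum is \<open>- t\<^sup>2 / 8\<close>.\<close>

lemma support_fun_concentration:
  assumes R: "finite R" and F: "support_fun R F" and t: "t > 0"
  defines "m \<equiv> \<integral>x. F x \<partial>gauss R"
  shows "measure (gauss R) {x \<in> space (gauss R). F x \<ge> m + t} \<le> exp (- t\<^sup>2 / 8)"
    and "measure (gauss R) {x \<in> space (gauss R). F x \<le> m - t} \<le> exp (- t\<^sup>2 / 8)"
proof -
  interpret G: prob_space "gauss R" by (rule prob_space_gauss)
  note sg = support_fun_subgaussian[OF R F, folded m_def]
  have q: "2 * (t / 4)\<^sup>2 - t / 4 * t = - t\<^sup>2 / 8" by (simp add: power2_eq_square field_simps)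
  have "measure (gauss R) {x \<in> space (gauss R). F x - m \<ge> t} \<le> exp (- (t / 4) * t) * (LINT x:space (gauss R)|gauss R. exp (t / 4 * (F x - m)))"
    using t sg(1)[of "t / 4"] by (intro G.Chernoff_ineq_ge) (auto simp: set_integrable_def integrable_restrict_space cong: Bochner_Integration.integrable_cong)
  also have "(LINT x:space (gauss R)|gauss R. exp (t / 4 * (F x - m))) = (\<integral>x. exp (t / 4 * (F x - m)) \<partial>gauss R)"
    by (rule set_integral_space[OF sg(1)])
  also have "exp (- (t / 4) * t) * \<dots> \<le> exp (- (t / 4) * t) * exp (2 * (t / 4)\<^sup>2)"
    by (intro mult_left_mono sg(2)) auto
  also have "\<dots> = exp (- t\<^sup>2 / 8)" unfolding q[symmetric] by (simp add: exp_add[symmetric])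
  also have "{x \<in> space (gauss R). F x - m \<ge> t} = {x \<in> space (gauss R). F x \<ge> m + t}" by auto
  finally show "measure (gauss R) {x \<in> space (gauss R). F x \<ge> m + t} \<le> exp (- t\<^sup>2 / 8)" .
  have "measure (gauss R) {x \<in> space (gauss R). F x - m \<le> - t} \<le> exp ((t / 4) * (- t)) * (LINT x:space (gauss R)|gauss R. exp (- (t / 4) * (F x - m)))"
    using t sg(1)[of "- (t / 4)"] by (intro G.Chernoff_ineq_le) (auto simp: set_integrable_def integrable_restrict_space cong: Bochner_Integration.integrable_cong)
  also have "(LINT x:space (gauss R)|gauss R. exp (- (t / 4) * (F x - m))) = (\<integral>x. exp (- (t / 4) * (F x - m)) \<partial>gauss R)"
    by (rule set_integral_space[OF sg(1)])
  also have "exp ((t / 4) * (- t)) * \<dots> \<le> exp ((t / 4) * (- t)) * exp (2 * (- (t / 4))\<^sup>2)"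
    by (intro mult_left_mono sg(2)) auto
  also have "\<dots> = exp (- t\<^sup>2 / 8)" unfolding q[symmetric] by (simp add: exp_add[symmetric])
  also have "{x \<in> space (gauss R). F x - m \<le> - t} = {x \<in> space (gauss R). F x \<le> m - t}" by auto
  finally show "measure (gauss R) {x \<in> space (gauss R). F x \<le> m - t} \<le> exp (- t\<^sup>2 / 8)" .
qed

text \<open>Reduces the variance to the exponential moments at \<open>l = 1\<close> and
  \<open>l = - 1\<close>.\<close>

lemma square_le_exp: "u\<^sup>2 \<le> 2 * (exp u + exp (- u)) - (4::real)"
proof -
  have "u\<^sup>2 \<le> 2 * (exp u + exp (- u)) - 4" if "u \<ge> 0" for u :: real
    using exp_lower_Taylor_quadratic[OF that] exp_ge_add_one_self[of "- u"] by simp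
  from this[of u] this[of "- u"] show ?thesis by (cases "u \<ge> 0") (auto simp: add.commute)
qed

text \<open>The second moments of the three norms are explicit, their means are not. A variance
  bounded by an absolute constant allows the means to be compared with the square roots of the
  second moments.\<close>

lemma support_fun_mean:
  assumes R: "finite R" and F: "support_fun R F"
  shows "(\<integral>x. F x \<partial>gauss R)\<^sup>2 \<le> (\<integral>x. (F x)\<^sup>2 \<partial>gauss R)"
    and "(\<integral>x. (F x)\<^sup>2 \<partial>gauss R) \<le> (\<integral>x. F x \<partial>gauss R)\<^sup>2 + 26"
proof -
  interpret G: prob_space "gauss R" by (rule prob_space_gauss)
  note int = support_fun_integrable[OF R F]
  define m where "m = (\<integral>x. F x \<partial>gauss R)"
  have v: "(\<integral>x. (F x - m)\<^sup>2 \<partial>gauss R) = (\<integral>x. (F x)\<^sup>2 \<partial>gauss R) - m\<^sup>2"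
    unfolding m_def by (rule G.variance_eq[OF int(2,3)])
  have "0 \<le> (\<integral>x. (F x - m)\<^sup>2 \<partial>gauss R)" by (rule integral_nonneg_AE) simp
  then show "(\<integral>x. F x \<partial>gauss R)\<^sup>2 \<le> (\<integral>x. (F x)\<^sup>2 \<partial>gauss R)" using v unfolding m_def by linarith
  note sg = support_fun_subgaussian[OF R F, folded m_def]
  have "(F x - m)\<^sup>2 = (F x)\<^sup>2 - 2 * m * F x + m\<^sup>2" for x by (simp add: power2_eq_square algebra_simps)
  then have i2: "integrable (gauss R) (\<lambda>x. (F x - m)\<^sup>2)" using int by simp
  have "(\<integral>x. (F x - m)\<^sup>2 \<partial>gauss R) \<le> (\<integral>x. 2 * (exp (1 * (F x - m)) + exp (- 1 * (F x - m))) - 4 \<partial>gauss R)"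
  proof (intro integral_mono i2)
    show "integrable (gauss R) (\<lambda>x. 2 * (exp (1 * (F x - m)) + exp (- 1 * (F x - m))) - 4)"
      using sg(1)[of 1] sg(1)[of "- 1"] by simp
    show "(F x - m)\<^sup>2 \<le> 2 * (exp (1 * (F x - m)) + exp (- 1 * (F x - m))) - 4" for x
      using square_le_exp[of "F x - m"] by simp
  qed
  also have "\<dots> = 2 * ((\<integral>x. exp (1 * (F x - m)) \<partial>gauss R) + (\<integral>x. exp (- 1 * (F x - m)) \<partial>gauss R)) - 4"
    using sg(1)[of 1] sg(1)[of "- 1"] by (simp add: G.prob_space)
  also have "\<dots> \<le> 2 * (exp 2 + exp 2) - 4" using sg(2)[of 1] sg(2)[of "- 1"] by simp
  \<comment> \<open>The left-hand side is \<open>4 * exp 2 - 4\<close>, and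
    \<open>exp 1 < 2.72\<close> bounds it by about 25.6; this is the origin of 26.\<close>
  also have "\<dots> \<le> 26"
  proof -
    have "exp (2::real) = exp 1 * exp 1" by (simp add: exp_add[symmetric])
    also have "\<dots> \<le> 272 / 100 * (272 / 100)" using e_less_272 by (intro mult_mono) auto
    finally show ?thesis by simp
  qed
  finally show "(\<integral>x. (F x)\<^sup>2 \<partial>gauss R) \<le> (\<integral>x. F x \<partial>gauss R)\<^sup>2 + 26" using v by (simp add: m_def)
qed

section \<open>Smoothing\<close>

abbreviation (input) quad :: "'t set \<Rightarrow> ('t \<Rightarrow> 't \<Rightarrow> real) \<Rightarrow> ('t \<Rightarrow> real) \<Rightarrow> real" where
  "quad T q d \<equiv> (\<Sum>t\<in>T. \<Sum>u\<in>T. q t u * d t * d u) / 2"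

text \<open>A Taylor remainder that is uniform in \<open>z\<close> and \<open>d\<close> is all that the replacement argument needs,
  so \<open>f1\<close> and \<open>f2\<close> are not required to be derivatives in the sense of the library.\<close>
definition jet :: "'t set \<Rightarrow> (('t \<Rightarrow> real) \<Rightarrow> real) \<Rightarrow> (('t \<Rightarrow> real) \<Rightarrow> 't \<Rightarrow> real) \<Rightarrow>
    (('t \<Rightarrow> real) \<Rightarrow> 't \<Rightarrow> 't \<Rightarrow> real) \<Rightarrow> bool" where
  "jet T f f1 f2 \<longleftrightarrow> (\<exists>C\<ge>0. \<forall>z. \<bar>f z\<bar> \<le> C \<and> (\<forall>t\<in>T. \<bar>f1 z t\<bar> \<le> C) \<and> (\<forall>t\<in>T. \<forall>u\<in>T. \<bar>f2 z t u\<bar> \<le> C) \<and>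
     (\<forall>d. \<bar>f (\<lambda>t. z t + d t) - f z - ip T (f1 z) d - quad T (f2 z) d\<bar>
        \<le> C * l1 T d ^ 3))"

text \<open>The remainder of a product splits into four terms that contain remainders of the factors
  of order 3, 3, 2 and 1, with constants 1, 1, 3 and 3. The lower order remainders follow from the
  cubic one if \<open>D \<le> 1\<close>, and from the boundedness of the function and of its jet if
  \<open>D > 1\<close>.\<close>

lemma remainder_prod:
  fixes C D :: real
  assumes C: "C \<ge> 0" and D: "D \<ge> 0" and F: "\<bar>F\<bar> \<le> C" and a0: "\<bar>a0\<bar> \<le> C" and b0: "\<bar>b0\<bar> \<le> C"
    and a1: "\<bar>a1\<bar> \<le> C * D" and b1: "\<bar>b1\<bar> \<le> C * D" and a2: "\<bar>a2\<bar> \<le> C * D ^ 2" and b2: "\<bar>b2\<bar> \<le> C * D ^ 2"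
    and ra: "\<bar>F - a0 - a1 - a2\<bar> \<le> C * D ^ 3" and rb: "\<bar>G - b0 - b1 - b2\<bar> \<le> C * D ^ 3"
  shows "\<bar>F * G - a0 * b0 - (a0 * b1 + a1 * b0) - (a0 * b2 + a1 * b1 + a2 * b0)\<bar> \<le> 8 * C\<^sup>2 * D ^ 3"
proof -
  have r1: "\<bar>F - a0 - a1\<bar> \<le> 3 * C * D ^ 2"
  proof (cases "D \<le> 1")
    case True
    have "C * D ^ 3 \<le> C * D ^ 2" using C D True by (intro mult_left_mono power_decreasing) auto
    moreover have "C * D ^ 2 \<ge> 0" using C by simp
    ultimately show ?thesis using ra a2 by linarith
  next
    case False
    have "C * 1 \<le> C * D ^ 2" using C False by (intro mult_left_mono one_le_power) auto
    moreover have "C * D ^ 1 \<le> C * D ^ 2" using C False by (intro mult_left_mono power_increasing) auto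
    ultimately show ?thesis using F a0 a1 by simp
  qed
  have r0: "\<bar>F - a0\<bar> \<le> 3 * C * D"
  proof (cases "D \<le> 1")
    case True
    have "C * D ^ 3 \<le> C * D ^ 1" using C D True by (intro mult_left_mono power_decreasing) auto
    moreover have "C * D ^ 2 \<le> C * D ^ 1" using C D True by (intro mult_left_mono power_decreasing) auto
    ultimately show ?thesis using ra a2 a1 by simp
  next
    case False
    have "C * 1 \<le> C * D" using C False by (intro mult_left_mono) auto
    moreover have "0 \<le> C * D" using C D by simp
    ultimately show ?thesis using F a0 by linarith
  qed
  have "F * G - a0 * b0 - (a0 * b1 + a1 * b0) - (a0 * b2 + a1 * b1 + a2 * b0)
     = F * (G - b0 - b1 - b2) + (F - a0 - a1 - a2) * b0 + (F - a0 - a1) * b1 + (F - a0) * b2"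
    by (simp add: algebra_simps)
  also have "\<bar>\<dots>\<bar> \<le> \<bar>F\<bar> * \<bar>G - b0 - b1 - b2\<bar> + \<bar>F - a0 - a1 - a2\<bar> * \<bar>b0\<bar> + \<bar>F - a0 - a1\<bar> * \<bar>b1\<bar> + \<bar>F - a0\<bar> * \<bar>b2\<bar>"
    unfolding abs_mult[symmetric] by linarith
  also have "\<dots> \<le> C * (C * D ^ 3) + (C * D ^ 3) * C + (3 * C * D ^ 2) * (C * D) + (3 * C * D) * (C * D ^ 2)"
    using C D F b0 b1 b2 ra rb r0 r1 by (intro add_mono mult_mono) auto
  also have "\<dots> = 8 * C\<^sup>2 * D ^ 3" by (simp add: power2_eq_square power3_eq_cube)
  finally show ?thesis .
qed

lemma jet_bounds:
  fixes f1 :: "'t \<Rightarrow> real" and f2 :: "'t \<Rightarrow> 't \<Rightarrow> real" and C :: real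
  assumes T: "finite T" and "\<And>t. t \<in> T \<Longrightarrow> \<bar>f1 t\<bar> \<le> C" "\<And>t u. t \<in> T \<Longrightarrow> u \<in> T \<Longrightarrow> \<bar>f2 t u\<bar> \<le> C" and C: "C \<ge> 0"
  shows "\<bar>\<Sum>t\<in>T. f1 t * d t\<bar> \<le> C * l1 T d"
    and "\<bar>(\<Sum>t\<in>T. \<Sum>u\<in>T. f2 t u * d t * d u) / 2\<bar> \<le> C * l1 T d ^ 2"
proof -
  have "\<bar>\<Sum>t\<in>T. f1 t * d t\<bar> \<le> (\<Sum>t\<in>T. \<bar>f1 t * d t\<bar>)" by (rule sum_abs)
  also have "\<dots> \<le> (\<Sum>t\<in>T. C * \<bar>d t\<bar>)" using assms by (intro sum_mono) (auto simp: abs_mult intro: mult_right_mono)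
  finally show "\<bar>\<Sum>t\<in>T. f1 t * d t\<bar> \<le> C * l1 T d" by (simp add: sum_distrib_left)
  have "\<bar>\<Sum>t\<in>T. \<Sum>u\<in>T. f2 t u * d t * d u\<bar> \<le> (\<Sum>t\<in>T. \<Sum>u\<in>T. \<bar>f2 t u * d t * d u\<bar>)"
    by (rule order_trans[OF sum_abs sum_mono[OF sum_abs]])
  also have "\<dots> \<le> (\<Sum>t\<in>T. \<Sum>u\<in>T. C * (\<bar>d t\<bar> * \<bar>d u\<bar>))"
    using assms by (intro sum_mono) (auto simp: abs_mult mult.assoc intro!: mult_right_mono)
  also have "\<dots> = C * (\<Sum>t\<in>T. \<Sum>u\<in>T. \<bar>d t\<bar> * \<bar>d u\<bar>)"
    by (simp only: sum_distrib_left)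
  also have "\<dots> = C * l1 T d ^ 2"
    by (simp only: power2_eq_square sum_product)
  finally show "\<bar>(\<Sum>t\<in>T. \<Sum>u\<in>T. f2 t u * d t * d u) / 2\<bar> \<le> C * l1 T d ^ 2"
    using C by simp
qed

lemma jetE:
  assumes "jet T f f1 f2"
  obtains C where "C \<ge> 0" "\<And>z. \<bar>f z\<bar> \<le> C" "\<And>z t. t \<in> T \<Longrightarrow> \<bar>f1 z t\<bar> \<le> C"
    "\<And>z t u. t \<in> T \<Longrightarrow> u \<in> T \<Longrightarrow> \<bar>f2 z t u\<bar> \<le> C"
    "\<And>z d. \<bar>f (\<lambda>t. z t + d t) - f z - ip T (f1 z) d - quad T (f2 z) d\<bar>
        \<le> C * l1 T d ^ 3"
  using assms unfolding jet_def by blast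

lemma jet_mono_const:
  fixes x D C C' :: real
  shows "\<bar>x\<bar> \<le> C * D \<Longrightarrow> C \<le> C' \<Longrightarrow> D \<ge> 0 \<Longrightarrow> \<bar>x\<bar> \<le> C' * D"
  by (meson mult_right_mono order_trans)

text \<open>Both products of first derivatives occur in the second derivative because
  \<open>quad\<close> sums over ordered pairs and carries the factor 1/2.\<close>

lemma jet_mult:
  assumes T: "finite T" and f: "jet T f f1 f2" and g: "jet T g g1 g2"
  shows "jet T (\<lambda>z. f z * g z) (\<lambda>z t. f z * g1 z t + f1 z t * g z)
    (\<lambda>z t u. f z * g2 z t u + f1 z t * g1 z u + f1 z u * g1 z t + f2 z t u * g z)"
proof -
  obtain A where A: "A \<ge> 0" "\<And>z. \<bar>f z\<bar> \<le> A" "\<And>z t. t \<in> T \<Longrightarrow> \<bar>f1 z t\<bar> \<le> A"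
    "\<And>z t u. t \<in> T \<Longrightarrow> u \<in> T \<Longrightarrow> \<bar>f2 z t u\<bar> \<le> A"
    "\<And>z d. \<bar>f (\<lambda>t. z t + d t) - f z - ip T (f1 z) d - quad T (f2 z) d\<bar>
        \<le> A * l1 T d ^ 3" using f by (rule jetE) blast
  obtain B where B: "B \<ge> 0" "\<And>z. \<bar>g z\<bar> \<le> B" "\<And>z t. t \<in> T \<Longrightarrow> \<bar>g1 z t\<bar> \<le> B"
    "\<And>z t u. t \<in> T \<Longrightarrow> u \<in> T \<Longrightarrow> \<bar>g2 z t u\<bar> \<le> B"
    "\<And>z d. \<bar>g (\<lambda>t. z t + d t) - g z - ip T (g1 z) d - quad T (g2 z) d\<bar>
        \<le> B * l1 T d ^ 3" using g by (rule jetE) blast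
  define C where "C = max A B"
  have C0: "C \<ge> 0" and AC: "A \<le> C" and BC: "B \<le> C" using A(1) by (auto simp: C_def)
  have Af: "\<bar>f z\<bar> \<le> C" "t \<in> T \<Longrightarrow> \<bar>f1 z t\<bar> \<le> C" "t \<in> T \<Longrightarrow> u \<in> T \<Longrightarrow> \<bar>f2 z t u\<bar> \<le> C" for z t u
    using A(2)[of z] A(3)[of t z] A(4)[of t u z] AC by auto
  have Bg: "\<bar>g z\<bar> \<le> C" "t \<in> T \<Longrightarrow> \<bar>g1 z t\<bar> \<le> C" "t \<in> T \<Longrightarrow> u \<in> T \<Longrightarrow> \<bar>g2 z t u\<bar> \<le> C" for z t u
    using B(2)[of z] B(3)[of t z] B(4)[of t u z] BC by auto
  have pr: "\<bar>x\<bar> \<le> C \<Longrightarrow> \<bar>y\<bar> \<le> C \<Longrightarrow> \<bar>x * y\<bar> \<le> C\<^sup>2" for x y :: real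
    unfolding abs_mult power2_eq_square by (intro mult_mono) auto
  show ?thesis
    unfolding jet_def
  proof (intro exI[of _ "8 * C\<^sup>2"] conjI allI ballI)
    fix z
    have C2: "C\<^sup>2 \<ge> 0" by simp
    show "\<bar>f z * g z\<bar> \<le> 8 * C\<^sup>2" using pr[OF Af(1)[of z] Bg(1)[of z]] C2 by linarith
    fix t assume t: "t \<in> T"
    show "\<bar>f z * g1 z t + f1 z t * g z\<bar> \<le> 8 * C\<^sup>2"
      using pr[OF Af(1)[of z] Bg(2)[OF t, of z]] pr[OF Af(2)[OF t, of z] Bg(1)[of z]] C2 by linarith
    fix u assume u: "u \<in> T"
    show "\<bar>f z * g2 z t u + f1 z t * g1 z u + f1 z u * g1 z t + f2 z t u * g z\<bar> \<le> 8 * C\<^sup>2"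
      using pr[OF Af(1)[of z] Bg(3)[OF t u, of z]] pr[OF Af(2)[OF t, of z] Bg(2)[OF u, of z]]
        pr[OF Af(2)[OF u, of z] Bg(2)[OF t, of z]] pr[OF Af(3)[OF t u, of z] Bg(1)[of z]] C2 by linarith
  next
    fix z d :: "'a \<Rightarrow> real"
    let ?D = "\<Sum>t\<in>T. \<bar>d t\<bar>"
    have D: "?D \<ge> 0" by (rule sum_nonneg) simp
    let ?a1 = "\<Sum>t\<in>T. f1 z t * d t" let ?b1 = "\<Sum>t\<in>T. g1 z t * d t"
    let ?a2 = "quad T (f2 z) d" let ?b2 = "quad T (g2 z) d"
    have e1: "(\<Sum>t\<in>T. (f z * g1 z t + f1 z t * g z) * d t) = f z * ?b1 + ?a1 * g z"
      by (simp add: sum.distrib algebra_simps sum_distrib_left)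
    have "(\<Sum>t\<in>T. \<Sum>u\<in>T. (f z * g2 z t u + f1 z t * g1 z u + f1 z u * g1 z t + f2 z t u * g z) * d t * d u)
      = f z * (\<Sum>t\<in>T. \<Sum>u\<in>T. g2 z t u * d t * d u) + (\<Sum>t\<in>T. \<Sum>u\<in>T. (f1 z t * d t) * (g1 z u * d u))
        + (\<Sum>t\<in>T. \<Sum>u\<in>T. (g1 z t * d t) * (f1 z u * d u)) + (\<Sum>t\<in>T. \<Sum>u\<in>T. f2 z t u * d t * d u) * g z"
      by (simp add: sum.distrib[symmetric] sum_distrib_left sum_distrib_right algebra_simps)
    also have "\<dots> = f z * (\<Sum>t\<in>T. \<Sum>u\<in>T. g2 z t u * d t * d u) + 2 * (?a1 * ?b1) + (\<Sum>t\<in>T. \<Sum>u\<in>T. f2 z t u * d t * d u) * g z"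
      by (simp add: sum_product[symmetric] mult.commute)
    finally have e2: "(\<Sum>t\<in>T. \<Sum>u\<in>T. (f z * g2 z t u + f1 z t * g1 z u + f1 z u * g1 z t + f2 z t u * g z) * d t * d u) / 2
      = f z * ?b2 + ?a1 * ?b1 + ?a2 * g z" by (simp add: field_simps)
    note [simp del] = sum_divide_distrib
    have "\<bar>f (\<lambda>t. z t + d t) * g (\<lambda>t. z t + d t) - f z * g z - (f z * ?b1 + ?a1 * g z) - (f z * ?b2 + ?a1 * ?b1 + ?a2 * g z)\<bar> \<le> 8 * C\<^sup>2 * ?D ^ 3"
    proof (rule remainder_prod[OF C0 D])
      show "\<bar>?a1\<bar> \<le> C * ?D" "\<bar>?a2\<bar> \<le> C * ?D\<^sup>2"
        by (rule jet_bounds[OF T _ _ C0]; use Af in blast)+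
      show "\<bar>?b1\<bar> \<le> C * ?D" "\<bar>?b2\<bar> \<le> C * ?D\<^sup>2"
        by (rule jet_bounds[OF T _ _ C0]; use Bg in blast)+
      show "\<bar>f (\<lambda>t. z t + d t) - f z - ?a1 - ?a2\<bar> \<le> C * ?D ^ 3"
        by (rule jet_mono_const[OF A(5) AC]) (use D in simp)
      show "\<bar>g (\<lambda>t. z t + d t) - g z - ?b1 - ?b2\<bar> \<le> C * ?D ^ 3"
        by (rule jet_mono_const[OF B(5) BC]) (use D in simp)
    qed (rule Af Bg)+
    then show "\<bar>f (\<lambda>t. z t + d t) * g (\<lambda>t. z t + d t) - f z * g z - (\<Sum>t\<in>T. (f z * g1 z t + f1 z t * g z) * d t)
        - (\<Sum>t\<in>T. \<Sum>u\<in>T. (f z * g2 z t u + f1 z t * g1 z u + f1 z u * g1 z t + f2 z t u * g z) * d t * d u) / 2\<bar> \<le> 8 * C\<^sup>2 * ?D ^ 3"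
      unfolding e1 e2 .
  qed simp
qed

lemma jet_compl:
  assumes "jet T f f1 f2"
  shows "jet T (\<lambda>z. 1 - f z) (\<lambda>z t. - f1 z t) (\<lambda>z t u. - f2 z t u)"
proof -
  obtain A where A: "A \<ge> 0" "\<And>z. \<bar>f z\<bar> \<le> A" "\<And>z t. t \<in> T \<Longrightarrow> \<bar>f1 z t\<bar> \<le> A"
    "\<And>z t u. t \<in> T \<Longrightarrow> u \<in> T \<Longrightarrow> \<bar>f2 z t u\<bar> \<le> A"
    "\<And>z d. \<bar>f (\<lambda>t. z t + d t) - f z - ip T (f1 z) d - quad T (f2 z) d\<bar>
        \<le> A * l1 T d ^ 3" using assms by (rule jetE) blast
  show ?thesis
    unfolding jet_def
  proof (intro exI[of _ "A + 1"] conjI allI ballI)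
    fix z
    show "\<bar>1 - f z\<bar> \<le> A + 1" using A(2)[of z] by linarith
    fix t assume t: "t \<in> T"
    show "\<bar>- f1 z t\<bar> \<le> A + 1" using A(3)[OF t, of z] by linarith
    fix u assume u: "u \<in> T"
    show "\<bar>- f2 z t u\<bar> \<le> A + 1" using A(4)[OF t u, of z] by linarith
  next
    fix z d :: "'a \<Rightarrow> real"
    let ?D = "\<Sum>t\<in>T. \<bar>d t\<bar>"
    have D: "?D ^ 3 \<ge> 0" by (intro zero_le_power sum_nonneg) simp
    have "\<bar>f (\<lambda>t. z t + d t) - f z - ip T (f1 z) d - quad T (f2 z) d\<bar> \<le> (A + 1) * ?D ^ 3"
      by (rule jet_mono_const[OF A(5)[of z d] _ D]) simp
    then show "\<bar>1 - f (\<lambda>t. z t + d t) - (1 - f z) - (\<Sum>t\<in>T. - f1 z t * d t) - (\<Sum>t\<in>T. \<Sum>u\<in>T. - f2 z t u * d t * d u) / 2\<bar> \<le> (A + 1) * ?D ^ 3"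
      by (simp add: sum_negf)
  qed (use A(1) in simp)
qed

lemma jet_const: "jet T (\<lambda>z. c) (\<lambda>z t. 0) (\<lambda>z t u. 0)"
  unfolding jet_def by (intro exI[of _ "\<bar>c\<bar>"]) (auto intro!: mult_nonneg_nonneg zero_le_power sum_nonneg)

section \<open>The logistic function and its products\<close>

text \<open>A step function at 0, smoothed at scale \<open>1 / \<beta>\<close>. Its derivative is a
  polynomial in the function itself, so every derivative is bounded on the whole line, as
  \<open>jet\<close> demands.\<close>

definition logistic :: "real \<Rightarrow> real \<Rightarrow> real" where
  "logistic \<beta> x = 1 / (1 + exp (- (\<beta> * x)))"

lemma logistic_bounds: "0 < logistic \<beta> x" "logistic \<beta> x < 1"
proof -
  have p: "exp (- (\<beta> * x)) > 0" "1 + exp (- (\<beta> * x)) > 0"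
    using exp_gt_zero[of "- (\<beta> * x)"] by linarith+
  show "0 < logistic \<beta> x" unfolding logistic_def using p by simp
  show "logistic \<beta> x < 1" unfolding logistic_def using p by (subst divide_less_eq_1_pos) auto
qed

lemma logistic_deriv:
  "((logistic \<beta>) has_real_derivative \<beta> * (logistic \<beta> x * (1 - logistic \<beta> x))) (at x)"
proof -
  have p: "1 + exp (- (\<beta> * x)) > 0" using exp_gt_zero[of "- (\<beta> * x)"] by linarith
  have c: "1 - logistic \<beta> x = exp (- (\<beta> * x)) / (1 + exp (- (\<beta> * x)))"
    using p by (simp add: logistic_def field_simps)
  show ?thesis
    unfolding c unfolding logistic_def using p
    by (auto intro!: derivative_eq_intros simp: power2_eq_square field_simps)
qed

text \<open>With \<open>q = logistic \<beta> x\<close> the third derivative is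
  \<open>\<beta> ^ 3 * (q * (1 - q) * (1 - 6 * q + 6 * q\<^sup>2))\<close>, where
  \<open>q * (1 - q)\<close> and the quadratic factor are at most 1 in absolute value for
  \<open>0 < q < 1\<close>.\<close>

lemma logistic_taylor:
  fixes x d :: real
  assumes b: "\<beta> > 0"
  defines "p \<equiv> logistic \<beta> x"
  shows "\<bar>logistic \<beta> (x + d) - p - \<beta> * (p * (1 - p)) * d - \<beta>\<^sup>2 * (p * (1 - p) * (1 - 2 * p)) * d * d / 2\<bar> \<le> \<beta> ^ 3 * \<bar>d\<bar> ^ 3"
proof (cases "d = 0")
  case True
  then show ?thesis by (simp add: p_def)
next
  case False
  define diff where "diff = (\<lambda>m::nat. \<lambda>x. let p = logistic \<beta> x in if m = 0 then p else if m = 1 then \<beta> * (p * (1 - p))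
     else if m = 2 then \<beta>\<^sup>2 * (p * (1 - p) * (1 - 2 * p)) else \<beta> ^ 3 * (p * (1 - p) * (1 - 6 * p + 6 * p\<^sup>2)))"
  note D[derivative_intros] = DERIV_chain'[OF _ logistic_deriv]
  have d0: "diff 0 = logistic \<beta>" by (simp add: diff_def Let_def)
  have d3: "\<bar>diff 3 t\<bar> \<le> \<beta> ^ 3" for t
  proof -
    define q where "q = logistic \<beta> t"
    have q: "0 < q" "q < 1" unfolding q_def by (rule logistic_bounds)+
    have qq: "0 \<le> q * (1 - q)" "q * (1 - q) \<le> 1" using q by (auto intro: mult_le_one)
    have "\<bar>1 - 6 * q + 6 * q\<^sup>2\<bar> \<le> 1"
      using qq sum_squares_ge_zero[of "2 * q - 1" 0] by (simp add: abs_le_iff power2_eq_square algebra_simps)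
    then have "\<bar>q * (1 - q)\<bar> * \<bar>1 - 6 * q + 6 * q\<^sup>2\<bar> \<le> 1" using qq by (intro mult_le_one) auto
    then have "\<beta> ^ 3 * (\<bar>q * (1 - q)\<bar> * \<bar>1 - 6 * q + 6 * q\<^sup>2\<bar>) \<le> \<beta> ^ 3 * 1" using b by (intro mult_left_mono) auto
    then show ?thesis using b by (simp add: diff_def Let_def q_def abs_mult)
  qed
  have der: "\<forall>m t. m < 3 \<and> x - \<bar>d\<bar> \<le> t \<and> t \<le> x + \<bar>d\<bar> \<longrightarrow> DERIV (diff m) t :> diff (Suc m) t"
  proof (intro allI impI)
    fix m :: nat and t assume "m < 3 \<and> x - \<bar>d\<bar> \<le> t \<and> t \<le> x + \<bar>d\<bar>"
    then consider "m = 0" | "m = 1" | "m = 2" by linarith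
    then show "DERIV (diff m) t :> diff (Suc m) t"
      by cases (auto simp: diff_def Let_def power2_eq_square power3_eq_cube algebra_simps
          intro!: derivative_eq_intros logistic_deriv)
  qed
  have "\<exists>t. (if x + d < x then x + d < t \<and> t < x else x < t \<and> t < x + d) \<and>
      logistic \<beta> (x + d) = (\<Sum>m<3. (diff m x / fact m) * (x + d - x) ^ m) + (diff 3 t / fact 3) * (x + d - x) ^ 3"
    by (rule Taylor[OF _ d0 der]) (use False in auto)
  then obtain t where t: "logistic \<beta> (x + d) = (\<Sum>m<3. (diff m x / fact m) * (x + d - x) ^ m) + (diff 3 t / fact 3) * (x + d - x) ^ 3"
    by blast
  have "logistic \<beta> (x + d) - p - \<beta> * (p * (1 - p)) * d - \<beta>\<^sup>2 * (p * (1 - p) * (1 - 2 * p)) * d * d / 2 = (diff 3 t / 6) * d ^ 3"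
    unfolding t p_def by (simp add: eval_nat_numeral) (simp add: diff_def Let_def power2_eq_square eval_nat_numeral)
  also have "\<bar>\<dots>\<bar> \<le> \<beta> ^ 3 * \<bar>d\<bar> ^ 3"
    using d3[of t] unfolding abs_mult power_abs[symmetric] by (intro mult_right_mono) auto
  finally show ?thesis .
qed

lemma jet_logistic:
  assumes T: "finite T" and s: "s \<in> T" and b: "\<beta> > 0"
  shows "jet T (\<lambda>z. logistic \<beta> (z s)) (\<lambda>z t. if t = s then \<beta> * (logistic \<beta> (z s) * (1 - logistic \<beta> (z s))) else 0)
    (\<lambda>z t u. if t = s \<and> u = s then \<beta>\<^sup>2 * (logistic \<beta> (z s) * (1 - logistic \<beta> (z s)) * (1 - 2 * logistic \<beta> (z s))) else 0)"
proof -
  define C where "C = 1 + \<beta> + \<beta>\<^sup>2 + \<beta> ^ 3"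
  have b': "\<beta>\<^sup>2 > 0" "\<beta> ^ 3 > 0" using b by auto
  have C: "1 \<le> C" "\<beta> \<le> C" "\<beta>\<^sup>2 \<le> C" "\<beta> ^ 3 \<le> C" using b b' by (auto simp: C_def)
  have lb: "0 < logistic \<beta> x" "logistic \<beta> x < 1" for x by (rule logistic_bounds)+
  have l1: "\<bar>logistic \<beta> x * (1 - logistic \<beta> x)\<bar> \<le> 1" for x
    using lb[of x] unfolding abs_mult by (intro mult_le_one) auto
  have l2: "\<bar>logistic \<beta> x * (1 - logistic \<beta> x) * (1 - 2 * logistic \<beta> x)\<bar> \<le> 1" for x
    using lb[of x] l1[of x] unfolding abs_mult[of _ "1 - 2 * logistic \<beta> x"] by (intro mult_le_one) auto
  show ?thesis
    unfolding jet_def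
  proof (intro exI[of _ C] conjI allI ballI)
    fix z :: "'a \<Rightarrow> real"
    show "\<bar>logistic \<beta> (z s)\<bar> \<le> C" using lb[of "z s"] C by linarith
    fix t
    show "\<bar>if t = s then \<beta> * (logistic \<beta> (z s) * (1 - logistic \<beta> (z s))) else 0\<bar> \<le> C"
      using mult_mono[OF C(2) l1[of "z s"]] b C by (auto simp: abs_mult)
    fix u
    show "\<bar>if t = s \<and> u = s then \<beta>\<^sup>2 * (logistic \<beta> (z s) * (1 - logistic \<beta> (z s)) * (1 - 2 * logistic \<beta> (z s))) else 0\<bar> \<le> C"
      using mult_mono[OF C(3) l2[of "z s"]] b' C by (auto simp: abs_mult)
  next
    fix z d :: "'a \<Rightarrow> real"
    have ds: "\<bar>d s\<bar> \<le> l1 T d" using T s by (intro member_le_sum) auto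
    have e1: "(\<Sum>t\<in>T. (if t = s then c else 0) * d t) = c * d s" for c
      using T s by (simp add: if_distrib[of "\<lambda>x. x * _"] sum.delta cong: if_cong)
    have "(\<Sum>u\<in>T. (if t = s \<and> u = s then c else 0) * d t * d u) = (if t = s then c else 0) * d s * d t" for c t
      using T s by (cases "t = s") (auto simp: if_distrib[of "\<lambda>x. x * _"] sum.delta cong: if_cong)
    then have e2: "(\<Sum>t\<in>T. \<Sum>u\<in>T. (if t = s \<and> u = s then c else 0) * d t * d u) = c * d s * d s" for c
      using T s by (simp add: if_distrib[of "\<lambda>x. x * _"] sum.delta cong: if_cong)
    have "\<beta> ^ 3 * \<bar>d s\<bar> ^ 3 \<le> C * l1 T d ^ 3"
      using C b' by (intro mult_mono power_mono ds) auto
    then show "\<bar>logistic \<beta> (z s + d s) - logistic \<beta> (z s)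
       - (\<Sum>t\<in>T. (if t = s then \<beta> * (logistic \<beta> (z s) * (1 - logistic \<beta> (z s))) else 0) * d t)
       - (\<Sum>t\<in>T. \<Sum>u\<in>T. (if t = s \<and> u = s then \<beta>\<^sup>2 * (logistic \<beta> (z s) * (1 - logistic \<beta> (z s)) * (1 - 2 * logistic \<beta> (z s))) else 0) * d t * d u) / 2\<bar>
       \<le> C * l1 T d ^ 3"
      unfolding e1 e2 using logistic_taylor[OF b, of "z s" "d s"] by linarith
  qed (use C in simp)
qed

text \<open>A smooth version of the indicator of \<open>\<forall>i<a. \<exists>j<b. z (i, j) > 0\<close>.\<close>
definition soft_all_ex :: "real \<Rightarrow> nat \<Rightarrow> nat \<Rightarrow> (nat \<times> nat \<Rightarrow> real) \<Rightarrow> real" where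
  "soft_all_ex \<beta> a b z = (\<Prod>i<a. 1 - (\<Prod>j<b. 1 - logistic \<beta> (z (i, j))))"

text \<open>This product smooths the event that no entry of row \<open>i\<close> is positive, so it
  decreases in each entry and is a function of that row alone. Sign and support of the derivatives
  are recorded because they decide the sign of the mixed derivatives once rows are
  multiplied.\<close>

lemma jet_row:
  fixes i n :: nat
  assumes T: "finite T" and b: "\<beta> > 0" and sub: "{i} \<times> {..<n} \<subseteq> T"
  shows "\<exists>f1 f2. jet T (\<lambda>z. \<Prod>j<n. 1 - logistic \<beta> (z (i, j))) f1 f2 \<and> (\<forall>z t. f1 z t \<le> 0) \<and>
    (\<forall>z t. fst t \<noteq> i \<longrightarrow> f1 z t = 0) \<and> (\<forall>z t u. fst t \<noteq> i \<or> fst u \<noteq> i \<longrightarrow> f2 z t u = 0)"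
  using sub
proof (induction n)
  case 0
  show ?case using jet_const[of T 1] by (intro exI[of _ "\<lambda>z t. 0"] exI[of _ "\<lambda>z t u. 0"]) auto
next
  case (Suc n)
  then obtain f1 f2 where f: "jet T (\<lambda>z. \<Prod>j<n. 1 - logistic \<beta> (z (i, j))) f1 f2" "\<And>z t. f1 z t \<le> 0"
    "\<And>z t. fst t \<noteq> i \<Longrightarrow> f1 z t = 0" "\<And>z t u. fst t \<noteq> i \<or> fst u \<noteq> i \<Longrightarrow> f2 z t u = 0"
    using Suc.IH by (auto simp: lessThan_Suc)
  have in_T: "(i, n) \<in> T" using Suc.prems by auto
  let ?p = "\<lambda>z. logistic \<beta> (z (i, n))"
  define g1 where "g1 = (\<lambda>z t. - (if t = (i, n) then \<beta> * (?p z * (1 - ?p z)) else 0))"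
  define g2 where "g2 = (\<lambda>z t u. - (if t = (i, n) \<and> u = (i, n) then \<beta>\<^sup>2 * (?p z * (1 - ?p z) * (1 - 2 * ?p z)) else 0))"
  have g: "jet T (\<lambda>z. 1 - ?p z) g1 g2"
    unfolding g1_def g2_def using jet_compl[OF jet_logistic[OF T in_T b]] by simp
  have lb: "0 < logistic \<beta> x" "logistic \<beta> x < 1" for x by (rule logistic_bounds)+
  have lb': "0 \<le> 1 - logistic \<beta> x" "0 \<le> logistic \<beta> x" for x using lb[of x] by auto
  have g1: "g1 z t \<le> 0" for z t using b by (auto simp: g1_def intro!: mult_nonneg_nonneg lb')
  let ?f = "\<lambda>z. \<Prod>j<n. 1 - logistic \<beta> (z (i, j))"
  have f0: "0 \<le> ?f z" for z by (intro prod_nonneg ballI lb')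
  have J: "jet T (\<lambda>z. \<Prod>j<Suc n. 1 - logistic \<beta> (z (i, j))) (\<lambda>z t. ?f z * g1 z t + f1 z t * (1 - ?p z))
    (\<lambda>z t u. ?f z * g2 z t u + f1 z t * g1 z u + f1 z u * g1 z t + f2 z t u * (1 - ?p z))"
    using jet_mult[OF T f(1) g] by simp
  show ?case
  proof (intro exI conjI allI impI)
    show "?f z * g1 z t + f1 z t * (1 - ?p z) \<le> 0" for z t
      using mult_nonneg_nonpos[OF f0[of z] g1[of z t]] mult_nonpos_nonneg[OF f(2)[of z t] lb'(1)] by (rule add_nonpos_nonpos)
    show "?f z * g1 z t + f1 z t * (1 - ?p z) = 0" if "fst t \<noteq> i" for z t
      using that f(3)[OF that] by (auto simp: g1_def)
    show "?f z * g2 z t u + f1 z t * g1 z u + f1 z u * g1 z t + f2 z t u * (1 - ?p z) = 0" if "fst t \<noteq> i \<or> fst u \<noteq> i" for z t u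
      using that f(3)[of t z] f(3)[of u z] f(4)[OF that] by (auto simp: g1_def g2_def)
  qed (rule J)
qed

lemma row_bounds:
  fixes n :: nat shows "0 \<le> (\<Prod>j<n. 1 - logistic \<beta> (z (i, j)))" "(\<Prod>j<n. 1 - logistic \<beta> (z (i, j))) \<le> 1"
proof -
  have lb: "0 < logistic \<beta> x" "logistic \<beta> x < 1" for x by (rule logistic_bounds)+
  have lb': "0 \<le> 1 - logistic \<beta> x" "1 - logistic \<beta> x \<le> 1" for x using lb[of x] by auto
  show "0 \<le> (\<Prod>j<n. 1 - logistic \<beta> (z (i, j)))" by (intro prod_nonneg ballI lb')
  show "(\<Prod>j<n. 1 - logistic \<beta> (z (i, j))) \<le> 1" by (intro prod_le_1 conjI lb')
qed

lemma soft_all_ex_bounds: "0 \<le> soft_all_ex \<beta> a b z" "soft_all_ex \<beta> a b z \<le> 1"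
  unfolding soft_all_ex_def by (auto intro!: prod_nonneg prod_le_1 row_bounds)

text \<open>For entries in different rows the second derivative is a product of first derivatives of
  two row factors with the remaining factors, all nonnegative. Within a row the sign is left open;
  there the covariances in Gordon's inequality agree.\<close>

lemma jet_soft_all_ex:
  assumes T: "finite T" and b: "\<beta> > 0" and sub: "{..<m} \<times> {..<n} \<subseteq> T"
  shows "\<exists>f1 f2. jet T (soft_all_ex \<beta> m n) f1 f2 \<and> (\<forall>z t u. fst t \<noteq> fst u \<longrightarrow> f2 z t u \<ge> 0)"
proof -
  \<comment> \<open>The induction carries \<open>f1 z t \<ge> 0\<close> along, because the cross
    terms created by a new row are products of first derivatives.\<close>
  have "\<exists>f1 f2. jet T (soft_all_ex \<beta> m n) f1 f2 \<and> (\<forall>z t. f1 z t \<ge> 0) \<and> (\<forall>z t u. fst t \<noteq> fst u \<longrightarrow> f2 z t u \<ge> 0)"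
    using sub
  proof (induction m)
    case 0
    show ?case unfolding soft_all_ex_def using jet_const[of T 1]
      by (intro exI[of _ "\<lambda>z t. 0"] exI[of _ "\<lambda>z t u. 0"]) auto
  next
    case (Suc m)
    have "{..<m} \<times> {..<n} \<subseteq> T" using Suc.prems by (auto intro: less_SucI)
    with Suc.IH obtain f1 f2 where f: "jet T (soft_all_ex \<beta> m n) f1 f2" "\<And>z t. f1 z t \<ge> 0"
      "\<And>z t u. fst t \<noteq> fst u \<Longrightarrow> f2 z t u \<ge> 0" by blast
    have "{m} \<times> {..<n} \<subseteq> T" using Suc.prems by auto
    from jet_row[OF T b this] obtain q1 q2 where
      q: "jet T (\<lambda>z. \<Prod>j<n. 1 - logistic \<beta> (z (m, j))) q1 q2" "\<And>z t. q1 z t \<le> 0"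
      "\<And>z t u. fst t \<noteq> m \<or> fst u \<noteq> m \<Longrightarrow> q2 z t u = 0"
      by blast
    let ?g = "\<lambda>z. 1 - (\<Prod>j<n. 1 - logistic \<beta> (z (m, j)))"
    have J: "jet T (soft_all_ex \<beta> (Suc m) n) (\<lambda>z t. soft_all_ex \<beta> m n z * (- q1 z t) + f1 z t * ?g z)
      (\<lambda>z t u. soft_all_ex \<beta> m n z * (- q2 z t u) + f1 z t * (- q1 z u) + f1 z u * (- q1 z t) + f2 z t u * ?g z)"
      using jet_mult[OF T f(1) jet_compl[OF q(1)]] by (simp add: soft_all_ex_def[abs_def])
    have g0: "?g z \<ge> 0" for z using row_bounds(2)[where n=n and z=z and i=m] by simp
    have q1: "- q1 z t \<ge> 0" for z t using q(2)[of z t] by simp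
    show ?case
    proof (intro exI conjI allI impI)
      show "0 \<le> soft_all_ex \<beta> m n z * (- q1 z t) + f1 z t * ?g z" for z t
        by (intro add_nonneg_nonneg mult_nonneg_nonneg soft_all_ex_bounds q1 f g0)
      show "0 \<le> soft_all_ex \<beta> m n z * (- q2 z t u) + f1 z t * (- q1 z u) + f1 z u * (- q1 z t) + f2 z t u * ?g z"
        if "fst t \<noteq> fst u" for z t u
      proof -
        have "q2 z t u = 0" using that by (intro q(3)) auto
        moreover have "0 \<le> f1 z t * (- q1 z u) + f1 z u * (- q1 z t) + f2 z t u * ?g z"
          by (intro add_nonneg_nonneg mult_nonneg_nonneg q1 f g0 that)
        ultimately show ?thesis by simp
      qed
    qed (rule J)
  qed
  then show ?thesis by blast
qed

section \<open>Gaussian comparison\<close>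

lemma std_normal_moments:
  shows "integrable N01 (\<lambda>x. x ^ k)"
    and "(\<integral>x. x \<partial>N01) = 0" "(\<integral>x. x\<^sup>2 \<partial>N01) = 1"
proof -
  show "integrable N01 (\<lambda>x. x ^ k)"
    using integrable_std_normal_moment[of k] by (subst integrable_density) auto
  show "(\<integral>x. x \<partial>N01) = 0"
    using integral_std_normal_moment_odd[of 0] by (subst integral_density) auto
  show "(\<integral>x. x\<^sup>2 \<partial>N01) = 1"
    using integral_std_normal_moment_even[of 1] by (subst integral_density) (auto simp: power2_eq_square)
qed

lemma gauss_coord:
  assumes R: "finite R" and r: "r \<in> R"
  shows "integrable (gauss R) (\<lambda>x. x r)" "(\<integral>x. x r \<partial>gauss R) = 0"
proof -
  have d: "distr (gauss R) N01 (\<lambda>x. x r) = N01"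
    by (rule distr_PiM_component) (auto intro: prob_space_std_normal r)
  have m: "(\<lambda>x. x r) \<in> gauss R \<rightarrow>\<^sub>M N01"
    by (rule measurable_component_singleton[OF r])
  show "integrable (gauss R) (\<lambda>x. x r)"
    using integrable_distr[OF m, of "\<lambda>x. x"] std_normal_moments(1)[of 1] by (simp add: d)
  show "(\<integral>x. x r \<partial>gauss R) = 0"
    using integral_distr[OF m, of "\<lambda>x. x"] std_normal_moments(2) by (simp add: d)
qed

lemma gauss_cov:
  assumes R: "finite R" and r: "r \<in> R" and q: "q \<in> R"
  shows "integrable (gauss R) (\<lambda>x. x r * x q)" "(\<integral>x. x r * x q \<partial>gauss R) = (if r = q then 1 else 0)"
proof -
  interpret product_prob_space "\<lambda>_. N01" by (rule product_prob_space_std_normal)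
  interpret N: prob_space N01 by (rule prob_space_std_normal)
  \<comment> \<open>Exponents that write \<open>x r * x q\<close> as a product over all of
    \<open>R\<close>, so that independence applies to \<open>r = q\<close> and
    \<open>r \<noteq> q\<close> alike.\<close>
  define k where "k = (\<lambda>i. (if i = r then 1 else 0) + (if i = q then 1 else (0::nat)))"
  have e: "x r * x q = (\<Prod>i\<in>R. (x i) ^ k i)" for x :: "'a \<Rightarrow> real"
  proof -
    have "(\<Prod>i\<in>R. (x i) ^ k i) = (\<Prod>i\<in>R. if i = r then x i else 1) * (\<Prod>i\<in>R. if i = q then x i else 1)"
      unfolding prod.distrib[symmetric] by (intro prod.cong) (auto simp: k_def)
    then show ?thesis using R r q by simp
  qed
  show "integrable (gauss R) (\<lambda>x. x r * x q)"
    unfolding e using R std_normal_moments(1) by (intro product_integrable_prod) auto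
  have "(\<integral>x. x r * x q \<partial>gauss R) = (\<Prod>i\<in>R. \<integral>x. x ^ k i \<partial>N01)"
    unfolding e using R std_normal_moments(1) by (intro product_integral_prod) auto
  also have "\<dots> = (if r = q then 1 else 0)"
  proof (cases "r = q")
    case True
    have "(\<integral>x. x ^ k i \<partial>N01) = 1" for i
      using True std_normal_moments(3) M.prob_space by (cases "i = r") (auto simp: k_def eval_nat_numeral)
    then show ?thesis using True by simp
  next
    case False
    have "(\<integral>x. x ^ k r \<partial>N01) = 0"
      using False std_normal_moments(2) by (simp add: k_def)
    then show ?thesis using False R r by (simp, intro bexI[of _ r]) auto
  qed
  finally show "(\<integral>x. x r * x q \<partial>gauss R) = (if r = q then 1 else 0)" .
qed

lemma integral_sum_sum:
  fixes f :: "_ \<Rightarrow> _ \<Rightarrow> _ \<Rightarrow> real"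
  assumes "\<And>i j. i \<in> I \<Longrightarrow> j \<in> J \<Longrightarrow> integrable M (f i j)"
  shows "(\<integral>x. (\<Sum>i\<in>I. \<Sum>j\<in>J. f i j x) \<partial>M) = (\<Sum>i\<in>I. \<Sum>j\<in>J. \<integral>x. f i j x \<partial>M)"
proof -
  have "(\<integral>x. (\<Sum>i\<in>I. \<Sum>j\<in>J. f i j x) \<partial>M) = (\<Sum>i\<in>I. \<integral>x. (\<Sum>j\<in>J. f i j x) \<partial>M)"
    using assms by (intro Bochner_Integration.integral_sum Bochner_Integration.integrable_sum)
  also have "\<dots> = (\<Sum>i\<in>I. \<Sum>j\<in>J. \<integral>x. f i j x \<partial>M)"
    using assms by (intro sum.cong refl Bochner_Integration.integral_sum)
  finally show ?thesis .
qed

lemma gauss_ip: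
  assumes R: "finite R"
  shows "integrable (gauss R) (\<lambda>x. ip R s x)" "(\<integral>x. ip R s x \<partial>gauss R) = 0"
    and "integrable (gauss R) (\<lambda>x. ip R s x * ip R s' x)" "(\<integral>x. ip R s x * ip R s' x \<partial>gauss R) = ip R s s'"
proof -
  show "integrable (gauss R) (\<lambda>x. ip R s x)" using gauss_coord[OF R] by auto
  show "(\<integral>x. ip R s x \<partial>gauss R) = 0" using gauss_coord[OF R] by (subst Bochner_Integration.integral_sum) auto
  have e: "ip R s x * ip R s' x = (\<Sum>r\<in>R. \<Sum>q\<in>R. (s r * s' q) * (x r * x q))" for x
    by (simp add: sum_product mult_ac)
  show "integrable (gauss R) (\<lambda>x. ip R s x * ip R s' x)"
    unfolding e using gauss_cov[OF R] by (intro Bochner_Integration.integrable_sum integrable_mult_right) auto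
  have "(\<integral>x. ip R s x * ip R s' x \<partial>gauss R) = (\<Sum>r\<in>R. \<Sum>q\<in>R. (s r * s' q) * (\<integral>x. x r * x q \<partial>gauss R))"
    unfolding e using gauss_cov(1)[OF R] by (subst integral_sum_sum) auto
  also have "\<dots> = (\<Sum>r\<in>R. \<Sum>q\<in>R. (s r * s' q) * (if r = q then 1 else 0))"
    using gauss_cov(2)[OF R] by (intro sum.cong refl) auto
  also have "\<dots> = ip R s s'" using R by (intro sum.cong refl) (simp add: if_distrib[of "\<lambda>x. _ * x"] cong: if_cong)
  finally show "(\<integral>x. ip R s x * ip R s' x \<partial>gauss R) = ip R s s'" .
qed

section \<open>Averaging over Gaussian increments\<close>

text \<open>The increment is \<open>h\<close> times a Gaussian field whose covariance at
  \<open>t\<close>, \<open>u\<close> is \<open>ip R (A t) (A u)\<close>. As an operator on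
  \<open>f\<close> this is a heat semigroup with time \<open>h\<^sup>2\<close>.\<close>

definition gavg :: "'i set \<Rightarrow> ('t \<Rightarrow> 'i \<Rightarrow> real) \<Rightarrow> real \<Rightarrow> (('t \<Rightarrow> real) \<Rightarrow> real) \<Rightarrow> ('t \<Rightarrow> real) \<Rightarrow> real" where
  "gavg R A h f z = (\<integral>x. f (\<lambda>t. z t + h * ip R (A t) x) \<partial>gauss R)"

text \<open>A class preserved by averaging, so that all iterates of \<open>gavg\<close> are
  integrals of integrable functions.\<close>

definition bdd_meas :: "(('t::countable \<Rightarrow> real) \<Rightarrow> real) \<Rightarrow> bool" where
  "bdd_meas f \<longleftrightarrow> f \<in> borel_measurable borel \<and> (\<exists>B. \<forall>z. \<bar>f z\<bar> \<le> B)"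

lemma shift_measurable[measurable]:
  "(\<lambda>(z, x). (\<lambda>t. z t + h * ip R (A t) x)) \<in> borel \<Otimes>\<^sub>M gauss R \<rightarrow>\<^sub>M (borel :: ('t::countable \<Rightarrow> real) measure)"
proof (rule measurable_coordinatewise_then_product)
  fix t :: 't
  have [measurable]: "(\<lambda>z. z t) \<in> borel_measurable (borel :: ('t \<Rightarrow> real) measure)"
    by (rule measurable_product_coordinates)
  show "(\<lambda>p. (case p of (z, x) \<Rightarrow> \<lambda>t. z t + h * ip R (A t) x) t) \<in> borel_measurable (borel \<Otimes>\<^sub>M gauss R)"
    unfolding case_prod_beta' by measurable
qed

lemma shift_measurable1:
  "(\<lambda>x. (\<lambda>t. z t + h * ip R (A t) x)) \<in> gauss R \<rightarrow>\<^sub>M (borel :: ('t::countable \<Rightarrow> real) measure)"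
  by (rule measurable_coordinatewise_then_product) measurable

lemma bdd_meas_integrable:
  assumes "bdd_meas f"
  shows "integrable (gauss R) (\<lambda>x. f (\<lambda>t. z t + h * ip R (A t) x))"
proof -
  interpret G: prob_space "gauss R" by (rule prob_space_gauss)
  obtain B where B: "\<And>z. \<bar>f z\<bar> \<le> B" and f: "f \<in> borel_measurable borel" using assms by (auto simp: bdd_meas_def)
  show ?thesis
    by (rule G.integrable_const_bound[of _ B]) (auto simp: B intro!: measurable_compose[OF shift_measurable1 f])
qed

lemma gavg_bdd_meas:
  assumes "bdd_meas f"
  shows "bdd_meas (gavg R A h f)"
proof -
  interpret G: prob_space "gauss R" by (rule prob_space_gauss)
  obtain B where B: "\<And>z. \<bar>f z\<bar> \<le> B" and f[measurable]: "f \<in> borel_measurable borel"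
    using assms by (auto simp: bdd_meas_def)
  have "(\<lambda>p. f (case p of (z, x) \<Rightarrow> (\<lambda>t. z t + h * ip R (A t) x))) \<in> borel_measurable (borel \<Otimes>\<^sub>M gauss R)"
    by (rule measurable_compose[OF shift_measurable f])
  then have "(\<lambda>z. \<integral>x. f (\<lambda>t. z t + h * ip R (A t) x) \<partial>gauss R) \<in> borel_measurable borel"
    by (intro G.borel_measurable_lebesgue_integral) (simp add: case_prod_beta')
  moreover have "\<bar>gavg R A h f z\<bar> \<le> B" for z
  proof -
    have "\<bar>gavg R A h f z\<bar> \<le> (\<integral>x. \<bar>f (\<lambda>t. z t + h * ip R (A t) x)\<bar> \<partial>gauss R)"
      unfolding gavg_def by (rule integral_abs_bound)
    also have "\<dots> \<le> (\<integral>x. B \<partial>gauss R)"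
      using B by (intro integral_mono integrable_abs bdd_meas_integrable[OF assms]) auto
    finally show ?thesis by (simp add: G.prob_space)
  qed
  ultimately show ?thesis unfolding bdd_meas_def gavg_def[abs_def] by blast
qed

lemma gavg_mono:
  assumes f: "bdd_meas f" and g: "bdd_meas g" and le: "\<And>z. f z \<ge> g z - e"
  shows "gavg R A h f z \<ge> gavg R A h g z - e"
proof -
  interpret G: prob_space "gauss R" by (rule prob_space_gauss)
  have "gavg R A h g z - e = (\<integral>x. g (\<lambda>t. z t + h * ip R (A t) x) - e \<partial>gauss R)"
    unfolding gavg_def
    by (subst Bochner_Integration.integral_diff) (auto intro: bdd_meas_integrable[OF g] simp: G.prob_space)
  also have "\<dots> \<le> gavg R A h f z"
    unfolding gavg_def
    by (intro integral_mono bdd_meas_integrable[OF f] le Bochner_Integration.integrable_diff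
        bdd_meas_integrable[OF g] G.integrable_const)
  finally show ?thesis .
qed

lemma gavg_double_integrable:
  assumes "bdd_meas f"
  shows "integrable (gauss R \<Otimes>\<^sub>M gauss R) (\<lambda>(x, y). f (\<lambda>t. z t + h * ip R (A t) x + k * ip R (B t) y))"
proof -
  interpret G: prob_space "gauss R" by (rule prob_space_gauss)
  interpret GG: pair_prob_space "gauss R" "gauss R" ..
  obtain C where C: "\<And>z. \<bar>f z\<bar> \<le> C" and f: "f \<in> borel_measurable borel" using assms by (auto simp: bdd_meas_def)
  have "(\<lambda>p t. z t + h * ip R (A t) (fst p) + k * ip R (B t) (snd p)) \<in> gauss R \<Otimes>\<^sub>M gauss R \<rightarrow>\<^sub>M borel"
    by (rule measurable_coordinatewise_then_product) measurable
  from measurable_compose[OF this f] show ?thesis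
    by (intro GG.integrable_const_bound[of _ C]) (auto simp: C case_prod_beta')
qed

lemma gavg_commute:
  assumes f: "bdd_meas f"
  shows "gavg R A h (gavg R B k f) = gavg R B k (gavg R A h f)"
proof
  fix z
  interpret G: prob_space "gauss R" by (rule prob_space_gauss)
  interpret GG: pair_sigma_finite "gauss R" "gauss R" ..
  have "gavg R A h (gavg R B k f) z = (\<integral>x. \<integral>y. f (\<lambda>t. z t + h * ip R (A t) x + k * ip R (B t) y) \<partial>gauss R \<partial>gauss R)"
    unfolding gavg_def ..
  also have "\<dots> = (\<integral>y. \<integral>x. f (\<lambda>t. z t + h * ip R (A t) x + k * ip R (B t) y) \<partial>gauss R \<partial>gauss R)"
    by (rule GG.Fubini_integral[symmetric, OF gavg_double_integrable[OF f]])
  also have "\<dots> = gavg R B k (gavg R A h f) z"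
    unfolding gavg_def by (simp add: add_ac)
  finally show "gavg R A h (gavg R B k f) z = gavg R B k (gavg R A h f) z" .
qed

text \<open>The rotation invariance of an independent pair, applied to functions of the first
  component only.\<close>

lemma distr_rotate_gauss:
  assumes R: "finite R" and cs: "c\<^sup>2 + s\<^sup>2 = 1" and c: "c \<ge> 0"
  shows "distr (gauss R \<Otimes>\<^sub>M gauss R) (gauss R) (\<lambda>p. \<lambda>r\<in>R. c * fst p r + s * snd p r) = gauss R"
proof (rule measure_eqI)
  interpret G: prob_space "gauss R" by (rule prob_space_gauss)
  have m: "(\<lambda>p. \<lambda>r\<in>R. c * fst p r + s * snd p r) \<in> gauss R \<Otimes>\<^sub>M gauss R \<rightarrow>\<^sub>M gauss R" by measurable
  fix S assume "S \<in> sets (distr (gauss R \<Otimes>\<^sub>M gauss R) (gauss R) (\<lambda>p. \<lambda>r\<in>R. c * fst p r + s * snd p r))"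
  then have S[measurable]: "S \<in> sets (gauss R)" by simp
  have "emeasure (distr (gauss R \<Otimes>\<^sub>M gauss R) (gauss R) (\<lambda>p. \<lambda>r\<in>R. c * fst p r + s * snd p r)) S
    = (\<integral>\<^sup>+x. indicator S x \<partial>distr (gauss R \<Otimes>\<^sub>M gauss R) (gauss R) (\<lambda>p. \<lambda>r\<in>R. c * fst p r + s * snd p r))"
    by simp
  also have "\<dots> = (\<integral>\<^sup>+p. indicator S (\<lambda>r\<in>R. c * fst p r + s * snd p r) \<partial>(gauss R \<Otimes>\<^sub>M gauss R))"
    by (rule nn_integral_distr[OF m]) simp
  also have "\<dots> = (\<integral>\<^sup>+x. \<integral>\<^sup>+y. indicator S (\<lambda>r\<in>R. c * x r + s * y r) \<partial>gauss R \<partial>gauss R)"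
  proof -
    have "(\<lambda>p. indicator S (\<lambda>r\<in>R. c * fst p r + s * snd p r) :: ennreal) \<in> borel_measurable (gauss R \<Otimes>\<^sub>M gauss R)"
      by measurable
    from G.nn_integral_fst[OF this] show ?thesis by simp
  qed
  also have "\<dots> = (\<integral>\<^sup>+x. \<integral>\<^sup>+y. indicator S x \<partial>gauss R \<partial>gauss R)"
  proof -
    have "(\<lambda>p. indicator S (fst p) :: ennreal) \<in> borel_measurable (gauss R \<Otimes>\<^sub>M gauss R)" by measurable
    from nn_integral_rotate_gauss[OF R cs c this] show ?thesis by simp
  qed
  also have "\<dots> = emeasure (gauss R) S" by (simp add: G.emeasure_space_1)
  finally show "emeasure (distr (gauss R \<Otimes>\<^sub>M gauss R) (gauss R) (\<lambda>p. \<lambda>r\<in>R. c * fst p r + s * snd p r)) S = emeasure (gauss R) S" .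
qed simp

text \<open>For independent \<open>x\<close>, \<open>y\<close> the vector
  \<open>h * x + k * y\<close> is \<open>r\<close> times the first component of the pair rotated by
  \<open>c = h / r\<close>, \<open>s = k / r\<close>. If \<open>h = k = 0\<close> these ratios make
  no sense, and both sides are \<open>f\<close>.\<close>

lemma gavg_semigroup:
  assumes R: "finite R" and f: "bdd_meas f" and h: "h \<ge> 0" and k: "k \<ge> 0"
  shows "gavg R A h (gavg R A k f) = gavg R A (sqrt (h\<^sup>2 + k\<^sup>2)) f"
proof (cases "h = 0 \<and> k = 0")
  case True
  interpret G: prob_space "gauss R" by (rule prob_space_gauss)
  show ?thesis using True by (simp add: gavg_def[abs_def] G.prob_space)
next
  case False
  interpret G: prob_space "gauss R" by (rule prob_space_gauss)
  interpret GG: pair_sigma_finite "gauss R" "gauss R" ..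
  define r where "r = sqrt (h\<^sup>2 + k\<^sup>2)"
  have hk: "h\<^sup>2 + k\<^sup>2 > 0" using False by (auto simp: sum_power2_gt_zero_iff)
  then have r: "r > 0" "r\<^sup>2 = h\<^sup>2 + k\<^sup>2" by (auto simp: r_def)
  define c s where "c = h / r" and "s = k / r"
  have cs: "c\<^sup>2 + s\<^sup>2 = 1"
    unfolding c_def s_def power_divide add_divide_distrib[symmetric] r(2)[symmetric] using r(1) by simp
  have c: "c \<ge> 0" using h r by (simp add: c_def)
  have rc: "r * c = h" "r * s = k" using r by (simp_all add: c_def s_def)
  show ?thesis
  proof
    fix z
    let ?g = "\<lambda>x. f (\<lambda>t. z t + r * ip R (A t) x)"
    have fm: "f \<in> borel_measurable borel" using f by (simp add: bdd_meas_def)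
    have g: "?g \<in> borel_measurable (gauss R)" by (rule measurable_compose[OF shift_measurable1 fm])
    have m: "(\<lambda>p. \<lambda>r\<in>R. c * fst p r + s * snd p r) \<in> gauss R \<Otimes>\<^sub>M gauss R \<rightarrow>\<^sub>M gauss R" by measurable
    have e: "?g (\<lambda>r\<in>R. c * x r + s * y r) = f (\<lambda>t. z t + h * ip R (A t) x + k * ip R (A t) y)" for x y
    proof -
      have "r * ip R (A t) (\<lambda>r\<in>R. c * x r + s * y r) = h * ip R (A t) x + k * ip R (A t) y" for t
      proof -
        have "r * ip R (A t) (\<lambda>r\<in>R. c * x r + s * y r) = (r * c) * ip R (A t) x + (r * s) * ip R (A t) y"
          by (simp add: sum_distrib_left sum.distrib[symmetric] algebra_simps)
        then show ?thesis by (simp only: rc)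
      qed
      then show ?thesis by (simp add: add.assoc)
    qed
    have "gavg R A r f z = (\<integral>x. ?g x \<partial>distr (gauss R \<Otimes>\<^sub>M gauss R) (gauss R) (\<lambda>p. \<lambda>r\<in>R. c * fst p r + s * snd p r))"
      unfolding gavg_def distr_rotate_gauss[OF R cs c] ..
    also have "\<dots> = (\<integral>p. ?g (\<lambda>r\<in>R. c * fst p r + s * snd p r) \<partial>(gauss R \<Otimes>\<^sub>M gauss R))"
      by (rule integral_distr[OF m g])
    also have "\<dots> = (\<integral>p. (case p of (x, y) \<Rightarrow> f (\<lambda>t. z t + h * ip R (A t) x + k * ip R (A t) y)) \<partial>(gauss R \<Otimes>\<^sub>M gauss R))"
      unfolding e by (simp add: case_prod_beta')
    also have "\<dots> = (\<integral>x. \<integral>y. f (\<lambda>t. z t + h * ip R (A t) x + k * ip R (A t) y) \<partial>gauss R \<partial>gauss R)"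
      by (rule GG.integral_fst[symmetric, OF gavg_double_integrable[OF f]])
    finally show "gavg R A h (gavg R A k f) z = gavg R A (sqrt (h\<^sup>2 + k\<^sup>2)) f z"
      unfolding gavg_def r_def by (simp add: add.assoc)
  qed
qed

lemma gavg_pow_bdd: "bdd_meas f \<Longrightarrow> bdd_meas ((gavg R A h ^^ N) f)"
  by (induction N) (auto intro: gavg_bdd_meas)

lemma gavg_pow:
  assumes R: "finite R" and f: "bdd_meas f" and h: "h \<ge> 0"
  shows "(gavg R A h ^^ N) f = gavg R A (h * sqrt (real N)) f"
proof (induction N)
  case 0
  interpret G: prob_space "gauss R" by (rule prob_space_gauss)
  show ?case by (simp add: gavg_def[abs_def] G.prob_space)
next
  case (Suc N)
  have "(gavg R A h ^^ Suc N) f = gavg R A (sqrt (h\<^sup>2 + (h * sqrt (real N))\<^sup>2)) f"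
    using h by (simp add: Suc.IH gavg_semigroup[OF R f])
  also have "h\<^sup>2 + (h * sqrt (real N))\<^sup>2 = h\<^sup>2 * real (Suc N)" by (simp add: power_mult_distrib algebra_simps)
  also have "sqrt \<dots> = h * sqrt (real (Suc N))" using h by (simp add: real_sqrt_mult)
  finally show ?case .
qed

text \<open>The one-step comparison is known for \<open>f\<close> and not for its averages, so the
  step to be replaced must be the innermost one. Commutation then moves the new \<open>B\<close>
  step to the outside, and the induction hypothesis is applied beneath it. Averaging does not
  enlarge additive errors.\<close>

lemma gavg_pow_mono:
  assumes f: "bdd_meas f" and step: "\<And>z. gavg R A h f z \<ge> gavg R B h f z - e"
  shows "(gavg R A h ^^ N) f z \<ge> (gavg R B h ^^ N) f z - real N * e"
proof (induction N arbitrary: z)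
  case (Suc N)
  have comm: "(gavg R A h ^^ N) (gavg R B h f) = gavg R B h ((gavg R A h ^^ N) f)" for N
  proof (induction N)
    case (Suc N)
    then show ?case by (simp add: gavg_commute[OF gavg_pow_bdd[OF f]])
  qed simp
  have mono: "(gavg R A h ^^ N) g z \<ge> (gavg R A h ^^ N) g' z - e"
    if "bdd_meas g" "bdd_meas g'" "\<And>z. g z \<ge> g' z - e" for g g' N z
    using that(3)
  proof (induction N arbitrary: z)
    case (Suc N)
    show ?case
      using gavg_mono[OF gavg_pow_bdd[OF that(1)] gavg_pow_bdd[OF that(2)] Suc.IH[OF Suc.prems]] by simp
  qed simp
  have "(gavg R A h ^^ Suc N) f z = (gavg R A h ^^ N) (gavg R A h f) z"
    by (simp add: funpow_swap1)
  also have "\<dots> \<ge> (gavg R A h ^^ N) (gavg R B h f) z - e"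
    by (rule mono[OF gavg_bdd_meas[OF f] gavg_bdd_meas[OF f] step])
  finally have 1: "(gavg R A h ^^ Suc N) f z \<ge> gavg R B h ((gavg R A h ^^ N) f) z - e"
    by (simp add: comm)
  have "gavg R B h ((gavg R A h ^^ N) f) z \<ge> gavg R B h ((gavg R B h ^^ N) f) z - real N * e"
    by (rule gavg_mono[OF gavg_pow_bdd[OF f] gavg_pow_bdd[OF f] Suc.IH])
  then show ?case using 1 by (simp add: algebra_simps)
qed simp

text \<open>The linear term has mean 0, the mean of the quadratic one is given by the covariance,
  and the cubic remainder is integrable. That \<open>C\<close> does not depend on \<open>h\<close>
  and \<open>z\<close> allows the errors of many steps to be added up.\<close>

lemma gavg_expand:
  assumes R: "finite R" and T: "finite T" and f: "bdd_meas f" and jet: "jet T f f1 f2"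
  shows "\<exists>C\<ge>0. \<forall>h\<ge>0. \<forall>z. \<bar>gavg R A h f z - f z - h\<^sup>2 * (\<Sum>t\<in>T. \<Sum>u\<in>T. f2 z t u * ip R (A t) (A u)) / 2\<bar> \<le> C * h ^ 3"
proof -
  interpret G: prob_space "gauss R" by (rule prob_space_gauss)
  obtain K where K: "K \<ge> 0"
    "\<And>z d. \<bar>f (\<lambda>t. z t + d t) - f z - ip T (f1 z) d - quad T (f2 z) d\<bar>
        \<le> K * l1 T d ^ 3" using jet by (rule jetE) blast
  define S where "S = (\<lambda>x. \<Sum>t\<in>T. \<bar>ip R (A t) x\<bar>)"
  have S0: "S x \<ge> 0" for x unfolding S_def by (rule sum_nonneg) simp
  have [measurable]: "S \<in> borel_measurable (gauss R)" unfolding S_def by measurable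
  define M where "M = (\<Sum>t\<in>T. \<Sum>r\<in>R. \<bar>A t r\<bar>)"
  have SM: "S x \<le> M * l1 R x" for x
  proof -
    have "\<bar>ip R (A t) x\<bar> \<le> (\<Sum>r\<in>R. \<bar>A t r\<bar>) * l1 R x" for t
    proof -
      have "\<bar>ip R (A t) x\<bar> \<le> (\<Sum>r\<in>R. \<bar>A t r\<bar> * \<bar>x r\<bar>)" unfolding abs_mult[symmetric] by (rule sum_abs)
      also have "\<dots> \<le> (\<Sum>r\<in>R. \<bar>A t r\<bar> * l1 R x)"
        using R by (intro sum_mono mult_left_mono member_le_sum) auto
      finally show ?thesis by (simp add: sum_distrib_right)
    qed
    then show ?thesis unfolding S_def M_def sum_distrib_right by (intro sum_mono) (simp add: sum_distrib_right[symmetric])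
  qed
  have i3: "integrable (gauss R) (\<lambda>x. (S x) ^ 3)"
  proof (rule Bochner_Integration.integrable_bound[OF gauss_exp_abs_integrable[OF R, of "3 * M"]])
    show "AE x in gauss R. norm ((S x) ^ 3) \<le> norm (exp (3 * M * l1 R x))"
    proof (rule AE_I2)
      fix x
      have "S x \<le> exp (S x)" using exp_ge_add_one_self[of "S x"] by linarith
      also have "\<dots> \<le> exp (M * l1 R x)" using SM by simp
      finally have "(S x) ^ 3 \<le> exp (M * l1 R x) ^ 3" using S0 by (rule power_mono)
      also have "\<dots> = exp (3 * M * l1 R x)"
        using exp_of_nat_mult[of 3 "M * l1 R x"] by (simp add: mult.assoc)
      finally show "norm ((S x) ^ 3) \<le> norm (exp (3 * M * l1 R x))" using S0 by simp
    qed
  qed measurable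
  show ?thesis
  proof (intro exI[of _ "K * (\<integral>x. (S x) ^ 3 \<partial>gauss R)"] conjI allI impI)
    show "0 \<le> K * (\<integral>x. (S x) ^ 3 \<partial>gauss R)"
      using K(1) S0 by (intro mult_nonneg_nonneg integral_nonneg_AE AE_I2 zero_le_power)
    fix h :: real and z assume h: "h \<ge> 0"
    define L where "L = (\<lambda>x. \<Sum>t\<in>T. f1 z t * (h * ip R (A t) x))"
    define Q where "Q = (\<lambda>x. (\<Sum>t\<in>T. \<Sum>u\<in>T. f2 z t u * (h * ip R (A t) x) * (h * ip R (A u) x)) / 2)"
    define F where "F = (\<lambda>x. f (\<lambda>t. z t + h * ip R (A t) x))"
    have iF: "integrable (gauss R) F" unfolding F_def by (rule bdd_meas_integrable[OF f])
    have iL: "integrable (gauss R) L" "(\<integral>x. L x \<partial>gauss R) = 0"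
      unfolding L_def using gauss_ip(1,2)[OF R] by simp_all
    have Qe: "Q = (\<lambda>x. \<Sum>t\<in>T. \<Sum>u\<in>T. (f2 z t u * h\<^sup>2 / 2) * (ip R (A t) x * ip R (A u) x))"
      unfolding Q_def by (intro ext) (simp add: sum_divide_distrib power2_eq_square mult_ac)
    have iQ: "integrable (gauss R) Q"
      unfolding Qe using gauss_ip(3)[OF R] by (intro Bochner_Integration.integrable_sum integrable_mult_right)
    have "(\<integral>x. Q x \<partial>gauss R) = (\<Sum>t\<in>T. \<Sum>u\<in>T. (f2 z t u * h\<^sup>2 / 2) * ip R (A t) (A u))"
      unfolding Qe using gauss_ip(3)[OF R]
      by (subst integral_sum_sum) (auto simp: gauss_ip(4)[OF R])
    also have "\<dots> = h\<^sup>2 * (\<Sum>t\<in>T. \<Sum>u\<in>T. f2 z t u * ip R (A t) (A u)) / 2"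
      by (simp only: sum_distrib_left sum_divide_distrib) (intro sum.cong refl; simp)
    finally have eQ: "(\<integral>x. Q x \<partial>gauss R) = h\<^sup>2 * (\<Sum>t\<in>T. \<Sum>u\<in>T. f2 z t u * ip R (A t) (A u)) / 2" .
    have pt: "\<bar>F x - f z - L x - Q x\<bar> \<le> K * (h ^ 3 * (S x) ^ 3)" for x
    proof -
      have "(\<Sum>t\<in>T. \<bar>h * ip R (A t) x\<bar>) = h * S x"
        using h unfolding S_def sum_distrib_left[of h "\<lambda>t. \<bar>ip R (A t) x\<bar>"] by (simp only: abs_mult abs_of_nonneg)
      then show ?thesis
        using K(2)[of z "\<lambda>t. h * ip R (A t) x"] by (simp add: F_def L_def Q_def power_mult_distrib)
    qed
    have "gavg R A h f z - f z - h\<^sup>2 * (\<Sum>t\<in>T. \<Sum>u\<in>T. f2 z t u * ip R (A t) (A u)) / 2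
      = (\<integral>x. F x - f z - L x - Q x \<partial>gauss R)"
      using iF iL iQ by (simp add: eQ[symmetric] gavg_def F_def[symmetric] G.prob_space)
    also have "\<bar>\<dots>\<bar> \<le> (\<integral>x. \<bar>F x - f z - L x - Q x\<bar> \<partial>gauss R)" by (rule integral_abs_bound)
    also have "\<dots> \<le> (\<integral>x. K * (h ^ 3 * (S x) ^ 3) \<partial>gauss R)"
      using iF iL iQ i3 pt by (intro integral_mono) auto
    also have "\<dots> = K * (\<integral>x. (S x) ^ 3 \<partial>gauss R) * h ^ 3" by simp
    finally show "\<bar>gavg R A h f z - f z - h\<^sup>2 * (\<Sum>t\<in>T. \<Sum>u\<in>T. f2 z t u * ip R (A t) (A u)) / 2\<bar> \<le> K * (\<integral>x. (S x) ^ 3 \<partial>gauss R) * h ^ 3" .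
  qed
qed

text \<open>Lindeberg's replacement argument: each of \<open>N\<close> increments of scale \<open>1 / sqrt N\<close> loses only \<open>O(N\<^bsup>-3/2\<^esup>)\<close>.\<close>
lemma gaussian_comparison:
  assumes R: "finite R" and T: "finite T" and f: "bdd_meas f" and jet: "jet T f f1 f2"
    and hess: "\<And>z. (\<Sum>t\<in>T. \<Sum>u\<in>T. f2 z t u * (ip R (A t) (A u) - ip R (B t) (B u))) \<ge> 0"
  shows "gavg R A 1 f z \<ge> gavg R B 1 f z"
proof -
  obtain C where C: "C \<ge> 0" "\<And>h z. h \<ge> 0 \<Longrightarrow> \<bar>gavg R A h f z - f z - h\<^sup>2 * (\<Sum>t\<in>T. \<Sum>u\<in>T. f2 z t u * ip R (A t) (A u)) / 2\<bar> \<le> C * h ^ 3"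
    using gavg_expand[OF R T f jet] by blast
  obtain D where D: "D \<ge> 0" "\<And>h z. h \<ge> 0 \<Longrightarrow> \<bar>gavg R B h f z - f z - h\<^sup>2 * (\<Sum>t\<in>T. \<Sum>u\<in>T. f2 z t u * ip R (B t) (B u)) / 2\<bar> \<le> D * h ^ 3"
    using gavg_expand[OF R T f jet] by blast
  have step: "gavg R A h f z \<ge> gavg R B h f z - (C + D) * h ^ 3" if h: "h \<ge> 0" for h z
  proof -
    have "h\<^sup>2 * (\<Sum>t\<in>T. \<Sum>u\<in>T. f2 z t u * ip R (A t) (A u)) / 2 - h\<^sup>2 * (\<Sum>t\<in>T. \<Sum>u\<in>T. f2 z t u * ip R (B t) (B u)) / 2
      = h\<^sup>2 * (\<Sum>t\<in>T. \<Sum>u\<in>T. f2 z t u * (ip R (A t) (A u) - ip R (B t) (B u))) / 2"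
      by (simp add: right_diff_distrib sum_subtractf diff_divide_distrib)
    also have "\<dots> \<ge> 0" using hess[of z] by simp
    finally have "h\<^sup>2 * (\<Sum>t\<in>T. \<Sum>u\<in>T. f2 z t u * ip R (A t) (A u)) / 2 \<ge> h\<^sup>2 * (\<Sum>t\<in>T. \<Sum>u\<in>T. f2 z t u * ip R (B t) (B u)) / 2" by simp
    moreover have "(C + D) * h ^ 3 = C * h ^ 3 + D * h ^ 3" by (rule distrib_right)
    ultimately show ?thesis using C(2)[OF h, of z] D(2)[OF h, of z] by linarith
  qed
  have "gavg R A 1 f z \<ge> gavg R B 1 f z - (C + D) / sqrt (real N)" if N: "N > 0" for N
  proof -
    define h where "h = 1 / sqrt (real N)"
    have h: "h \<ge> 0" "h * sqrt (real N) = 1" using N by (auto simp: h_def)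
    have "real N * ((C + D) * h ^ 3) = (C + D) * h * (h * sqrt (real N))\<^sup>2"
      by (simp add: power_mult_distrib power2_eq_square power3_eq_cube)
    also have "\<dots> = (C + D) / sqrt (real N)" by (simp add: h) (simp add: h_def)
    finally show ?thesis
      using gavg_pow_mono[OF f step[OF h(1)], of N z] by (simp add: gavg_pow[OF R f h(1)] h(2))
  qed
  then have ev: "\<exists>N0. \<forall>N\<ge>N0. gavg R B 1 f z - (C + D) / sqrt (real N) \<le> gavg R A 1 f z"
    by (intro exI[of _ 1]) auto
  have "(\<lambda>N. (C + D) / sqrt (real N)) \<longlonglongrightarrow> 0"
    by (intro tendsto_divide_0[OF tendsto_const] filterlim_at_top_imp_at_infinity
        filterlim_compose[OF sqrt_at_top filterlim_real_sequentially])
  then have "(\<lambda>N. gavg R B 1 f z - (C + D) / sqrt (real N)) \<longlonglongrightarrow> gavg R B 1 f z - 0"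
    by (intro tendsto_diff tendsto_const)
  from LIMSEQ_le_const2[OF this ev] show ?thesis by simp
qed

section \<open>From smooth to sharp events\<close>

lemma logistic_tendsto:
  "(\<lambda>n. logistic (real (Suc n)) x) \<longlonglongrightarrow> (if x > 0 then 1 else if x = 0 then 1 / 2 else 0)"
proof -
  have top: "filterlim (\<lambda>n. real (Suc n)) at_top sequentially"
    using filterlim_compose[OF filterlim_real_sequentially filterlim_Suc] by (simp add: comp_def)
  consider "x > 0" | "x = 0" | "x < 0" by linarith
  then show ?thesis
  proof cases
    case 1
    have "filterlim (\<lambda>n. x * real (Suc n)) at_top sequentially"
      by (rule filterlim_tendsto_pos_mult_at_top[OF tendsto_const 1 top])
    then have "filterlim (\<lambda>n. - (x * real (Suc n))) at_bot sequentially"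
      by (simp add: filterlim_uminus_at_top)
    then have "(\<lambda>n. exp (- (x * real (Suc n)))) \<longlonglongrightarrow> 0"
      by (rule filterlim_compose[OF exp_at_bot])
    then have "(\<lambda>n. 1 / (1 + exp (- (x * real (Suc n))))) \<longlonglongrightarrow> 1 / (1 + 0)"
      by (intro tendsto_divide tendsto_add tendsto_const) auto
    then show ?thesis using 1 by (simp add: logistic_def mult.commute)
  next
    case 2
    then show ?thesis by (simp add: logistic_def)
  next
    case 3
    have "filterlim (\<lambda>n. - x * real (Suc n)) at_top sequentially"
      by (rule filterlim_tendsto_pos_mult_at_top[OF tendsto_const _ top]) (use 3 in simp)
    then have e: "filterlim (\<lambda>n. exp (- x * real (Suc n))) at_top sequentially"
      by (rule filterlim_compose[OF exp_at_top])
    have "filterlim (\<lambda>n. 1 + exp (- x * real (Suc n))) at_top sequentially"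
      by (rule filterlim_tendsto_add_at_top[OF tendsto_const e])
    then have "(\<lambda>n. 1 / (1 + exp (- x * real (Suc n)))) \<longlonglongrightarrow> 0"
      by (intro tendsto_divide_0[OF tendsto_const] filterlim_at_top_imp_at_infinity)
    then show ?thesis using 3 by (simp add: logistic_def mult.commute)
  qed
qed

lemma soft_all_ex_bdd_meas: "bdd_meas (soft_all_ex \<beta> a b)"
proof -
  have [measurable]: "(\<lambda>z. z t) \<in> borel_measurable (borel :: (nat \<times> nat \<Rightarrow> real) measure)" for t
    by (rule measurable_product_coordinates)
  have "soft_all_ex \<beta> a b \<in> borel_measurable borel"
    unfolding soft_all_ex_def[abs_def] logistic_def by measurable
  moreover have "\<bar>soft_all_ex \<beta> a b z\<bar> \<le> 1" for z
    using soft_all_ex_bounds[of \<beta> a b z] by simp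
  ultimately show ?thesis unfolding bdd_meas_def by blast
qed

text \<open>Gordon's inequality; \<open>A\<close> and \<open>B\<close> hold the coefficient vectors of the two Gaussian fields.\<close>
theorem gordon_comparison:
  fixes A B :: "nat \<times> nat \<Rightarrow> 'i \<Rightarrow> real"
  assumes R: "finite R"
    and same: "\<And>i j j'. i < a \<Longrightarrow> j < b \<Longrightarrow> j' < b \<Longrightarrow> ip R (A (i, j)) (A (i, j')) = ip R (B (i, j)) (B (i, j'))"
    and diff: "\<And>i i' j j'. i < a \<Longrightarrow> i' < a \<Longrightarrow> j < b \<Longrightarrow> j' < b \<Longrightarrow> i \<noteq> i' \<Longrightarrow>
        ip R (A (i, j)) (A (i', j')) \<ge> ip R (B (i, j)) (B (i', j'))"
  shows "measure (gauss R) {x \<in> space (gauss R). \<forall>i<a. \<exists>j<b. ip R (A (i, j)) x \<ge> l}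
    \<ge> measure (gauss R) {x \<in> space (gauss R). \<forall>i<a. \<exists>j<b. ip R (B (i, j)) x > l}"
proof -
  interpret G: prob_space "gauss R" by (rule prob_space_gauss)
  define T where "T = {..<a} \<times> {..<b}"
  have T: "finite T" by (simp add: T_def)
  define f where "f = (\<lambda>n. soft_all_ex (real (Suc n)) a b)"
  \<comment> \<open>The pointwise limit of the logistic functions, with value 1/2 at 0. The limit
    \<open>F\<close> of the smoothed indicators therefore lies between the indicators of the events
    with strict and with weak inequality, which is why the two sides of the theorem differ in this
    respect.\<close>
  define h where "h = (\<lambda>x::real. if x > 0 then 1 else if x = 0 then 1 / 2 else (0::real))"
  define F where "F = (\<lambda>z. \<Prod>i<a. 1 - (\<Prod>j<b. 1 - h (z (i, j))))"
  have lim: "(\<lambda>n. f n z) \<longlonglongrightarrow> F z" for z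
    unfolding f_def F_def soft_all_ex_def h_def
    by (intro tendsto_prod tendsto_diff tendsto_const logistic_tendsto)
  have fb: "0 \<le> f n z" "f n z \<le> 1" for n z unfolding f_def by (rule soft_all_ex_bounds)+
  have F0: "0 \<le> F z" for z by (rule LIMSEQ_le_const[OF lim]) (use fb in blast)
  have F1: "F z \<le> 1" for z by (rule LIMSEQ_le_const2[OF lim]) (use fb in blast)
  have fm: "bdd_meas (f n)" for n unfolding f_def by (rule soft_all_ex_bdd_meas)
  have comp: "gavg R A 1 (f n) z \<ge> gavg R B 1 (f n) z" for n z
  proof -
    have "\<exists>f1 f2. jet T (soft_all_ex (real (Suc n)) a b) f1 f2 \<and> (\<forall>z t u. fst t \<noteq> fst u \<longrightarrow> f2 z t u \<ge> 0)"
      by (rule jet_soft_all_ex[OF T]) (auto simp: T_def)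
    then obtain f1 f2 where J: "jet T (f n) f1 f2" "\<And>z t u. fst t \<noteq> fst u \<Longrightarrow> f2 z t u \<ge> 0"
      unfolding f_def by blast
    have "f2 z t u * (ip R (A t) (A u) - ip R (B t) (B u)) \<ge> 0" if "t \<in> T" "u \<in> T" for z t u
    proof (cases "fst t = fst u")
      case True
      then have "ip R (A t) (A u) = ip R (B t) (B u)"
        using that same[of "fst t" "snd t" "snd u"] by (auto simp: T_def)
      then show ?thesis by simp
    next
      case False
      then have "ip R (A t) (A u) \<ge> ip R (B t) (B u)"
        using that diff[of "fst t" "fst u" "snd t" "snd u"] by (auto simp: T_def)
      then show ?thesis using J(2)[OF False] by simp
    qed
    then show ?thesis by (intro gaussian_comparison[OF R T fm J(1)] sum_nonneg)
  qed
  \<comment> \<open>Starting the field at \<open>- l\<close> turns the level \<open>l\<close> into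
    the threshold 0.\<close>
  define X where "X = (\<lambda>(A :: nat \<times> nat \<Rightarrow> 'i \<Rightarrow> real) x t. - l + 1 * ip R (A t) x)"
  have Xm: "(\<lambda>x. f n (X A x)) \<in> borel_measurable (gauss R)" for A n
    unfolding X_def using fm[of n] unfolding bdd_meas_def
    by (intro measurable_compose[OF shift_measurable1]) blast
  have FXm: "(\<lambda>x. F (X A x)) \<in> borel_measurable (gauss R)" for A
    by (rule borel_measurable_LIMSEQ_real[OF lim Xm])
  have conv: "(\<lambda>n. gavg R A 1 (f n) (\<lambda>t. - l)) \<longlonglongrightarrow> (\<integral>x. F (X A x) \<partial>gauss R)" for A
    unfolding gavg_def X_def[symmetric]
  proof (rule integral_dominated_convergence[where w="\<lambda>_. 1"])
    show "AE x in gauss R. (\<lambda>n. f n (\<lambda>t. - l + 1 * ip R (A t) x)) \<longlonglongrightarrow> F (X A x)"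
      unfolding X_def by (intro AE_I2 lim)
    show "AE x in gauss R. norm (f n (\<lambda>t. - l + 1 * ip R (A t) x)) \<le> 1" for n
      using fb by (intro AE_I2) simp
    show "(\<lambda>x. f n (\<lambda>t. - l + 1 * ip R (A t) x)) \<in> borel_measurable (gauss R)" for n
      using Xm[of n A] unfolding X_def .
  qed (use FXm in auto)
  have le: "(\<integral>x. F (X B x) \<partial>gauss R) \<le> (\<integral>x. F (X A x) \<partial>gauss R)"
    by (rule LIMSEQ_le[OF conv conv]) (use comp in blast)
  have Fint: "integrable (gauss R) (\<lambda>x. F (X A x))" for A
    using F0 F1 by (intro G.integrable_const_bound[of _ 1] FXm) auto
  let ?E1 = "{x \<in> space (gauss R). \<forall>i<a. \<exists>j<b. ip R (B (i, j)) x > l}"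
  let ?E2 = "{x \<in> space (gauss R). \<forall>i<a. \<exists>j<b. ip R (A (i, j)) x \<ge> l}"
  have E[measurable]: "?E1 \<in> sets (gauss R)" "?E2 \<in> sets (gauss R)" by measurable
  have Iint: "integrable (gauss R) (indicator E :: _ \<Rightarrow> real)" if "E \<in> sets (gauss R)" for E
    using that by (intro integrable_real_indicator) (auto simp: G.emeasure_eq_measure)
  have low: "indicator ?E1 x \<le> F (X B x)" for x
  proof (cases "x \<in> ?E1")
    case True
    have one: "1 - (\<Prod>j<b. 1 - h (X B x (i, j))) = 1" if i: "i < a" for i
    proof -
      obtain j where j: "j < b" "ip R (B (i, j)) x > l" using True i by auto
      then have "1 - h (X B x (i, j)) = 0" by (simp add: h_def X_def)
      then have "(\<Prod>j<b. 1 - h (X B x (i, j))) = 0" using j(1) by (intro prod_zero) auto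
      then show ?thesis by simp
    qed
    have "F (X B x) = 1" unfolding F_def by (intro prod.neutral ballI one) simp
    then show ?thesis by simp
  qed (use F0 in simp)
  have up: "F (X A x) \<le> indicator ?E2 x" if x: "x \<in> space (gauss R)" for x
  proof (cases "x \<in> ?E2")
    case False
    then obtain i where i: "i < a" "\<And>j. j < b \<Longrightarrow> ip R (A (i, j)) x < l" using x by force
    have "h (X A x (i, j)) = 0" if "j < b" for j using i(2)[OF that] by (simp add: h_def X_def)
    then have "1 - (\<Prod>j<b. 1 - h (X A x (i, j))) = 0" by simp
    then have "F (X A x) = 0" unfolding F_def using i(1) by (intro prod_zero) auto
    then show ?thesis by simp
  qed (use F1 in simp)
  have "measure (gauss R) ?E1 = (\<integral>x. indicator ?E1 x \<partial>gauss R)" by simp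
  also have "\<dots> \<le> (\<integral>x. F (X B x) \<partial>gauss R)"
    by (intro integral_mono Fint Iint E low)
  also have "\<dots> \<le> (\<integral>x. F (X A x) \<partial>gauss R)" by (rule le)
  also have "\<dots> \<le> (\<integral>x. indicator ?E2 x \<partial>gauss R)"
    by (intro integral_mono Fint Iint E up)
  also have "\<dots> = measure (gauss R) ?E2" by simp
  finally show ?thesis .
qed

section \<open>Bilinear forms in a Gaussian matrix\<close>

lemma std_normal_nonpos: "measure N01 {y. y \<le> 0} \<ge> 1 / 2"
proof -
  interpret N: prob_space N01 by (rule prob_space_std_normal)
  \<comment> \<open>The quarter turn \<open>c = 0\<close>, \<open>s = 1\<close> sends the second
    coordinate to \<open>- x\<close>; invariance under it gives the symmetry of the normal
    law.\<close>
  let ?\<phi> = "\<lambda>p :: real \<times> real. indicator {..0} (snd p) :: ennreal"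
  have "(\<integral>\<^sup>+x. \<integral>\<^sup>+y. indicator {..0} (- x) \<partial>N01 \<partial>N01)
     = (\<integral>\<^sup>+x. \<integral>\<^sup>+y. indicator {..0::real} y \<partial>N01 \<partial>N01)"
    using nn_integral_rotate_std_normal[of ?\<phi> 0 1] by simp
  moreover have "(\<integral>\<^sup>+x. \<integral>\<^sup>+y. indicator {..0} (- x) \<partial>N01 \<partial>N01)
     = (\<integral>\<^sup>+x. indicator {0..} x \<partial>N01)"
    using N.emeasure_space_1 by (intro nn_integral_cong) (auto split: split_indicator)
  moreover have "(\<integral>\<^sup>+x. \<integral>\<^sup>+y. indicator {..0::real} y \<partial>N01 \<partial>N01)
     = emeasure N01 {..0}"
    using N.emeasure_space_1 by simp
  ultimately have "emeasure N01 {0..} = emeasure N01 {..0}" by simp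
  then have eq: "measure N01 {0..} = measure N01 {..0}"
    by (simp add: measure_def)
  have "1 = measure N01 ({0..} \<union> {..0})"
  proof -
    have "{0..} \<union> {..0::real} = UNIV" by auto
    then show ?thesis using N.prob_space by simp
  qed
  also have "\<dots> \<le> measure N01 {0..} + measure N01 {..0}"
    by (rule measure_Un_le) auto
  finally show ?thesis using eq by (simp add: atMost_def)
qed

text \<open>The coordinate \<open>r\<close> is independent of those in \<open>J\<close> and
  nonpositive with probability at least 1/2. This is how the sign of the auxiliary scalar is
  fixed.\<close>

lemma gauss_drop_coordinate:
  assumes R: "finite R" and J: "J \<subseteq> R" and r: "r \<in> R" "r \<notin> J" and S: "S \<in> sets (gauss J)"
  shows "measure (gauss J) S \<le> 2 * measure (gauss R) {x \<in> space (gauss R). restrict x J \<in> S \<and> x r \<le> 0}"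
proof -
  interpret product_prob_space "\<lambda>_. N01" by (rule product_prob_space_std_normal)
  interpret G: prob_space "gauss R" by (rule prob_space_gauss)
  interpret GJ: prob_space "gauss J" by (rule prob_space_gauss)
  interpret GI: prob_space "gauss (insert r J)" by (rule prob_space_gauss)
  interpret N: prob_space N01 by (rule prob_space_std_normal)
  have fJ: "finite J" using R J by (rule finite_subset[rotated])
  note [measurable] = S
  have rJ[measurable]: "(\<lambda>x. restrict x J) \<in> gauss (insert r J) \<rightarrow>\<^sub>M gauss J"
    by (rule measurable_restrict_subset) auto
  define S' where "S' = {x \<in> space (gauss (insert r J)). restrict x J \<in> S \<and> x r \<le> 0}"
  have S'[measurable]: "S' \<in> sets (gauss (insert r J))" unfolding S'_def by measurable
  have d: "distr (gauss R) (gauss (insert r J)) (\<lambda>x. restrict x (insert r J)) = gauss (insert r J)"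
    by (rule product_prob_space.distr_PiM_restrict_finite[OF product_prob_space_std_normal]) (use J r fJ in auto)
  have m: "(\<lambda>x. restrict x (insert r J)) \<in> gauss R \<rightarrow>\<^sub>M gauss (insert r J)"
    using J r by (intro measurable_restrict_subset) auto
  have "measure (gauss (insert r J)) S' = measure (gauss R) ((\<lambda>x. restrict x (insert r J)) -` S' \<inter> space (gauss R))"
    by (subst d[symmetric], rule measure_distr[OF m]) simp
  also have "(\<lambda>x. restrict x (insert r J)) -` S' \<inter> space (gauss R) = {x \<in> space (gauss R). restrict x J \<in> S \<and> x r \<le> 0}"
  proof -
    have "restrict (restrict x (insert r J)) J = restrict x J" for x :: "'a \<Rightarrow> real"
      by (auto simp: restrict_def fun_eq_iff)
    moreover have "restrict x (insert r J) \<in> space (gauss (insert r J))" for x :: "'a \<Rightarrow> real"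
      by (auto simp: space_PiM)
    ultimately show ?thesis unfolding S'_def by auto
  qed
  finally have 1: "measure (gauss R) {x \<in> space (gauss R). restrict x J \<in> S \<and> x r \<le> 0} = measure (gauss (insert r J)) S'" ..
  have "emeasure (gauss (insert r J)) S' = (\<integral>\<^sup>+x. indicator S' x \<partial>gauss (insert r J))" by simp
  also have "\<dots> = (\<integral>\<^sup>+x. \<integral>\<^sup>+y. indicator S' (x(r := y)) \<partial>N01 \<partial>gauss J)"
    using fJ r by (intro product_nn_integral_insert) auto
  also have "\<dots> = (\<integral>\<^sup>+x. indicator S x * emeasure N01 {y. y \<le> 0} \<partial>gauss J)"
  proof (rule nn_integral_cong)
    fix x assume x: "x \<in> space (gauss J)"
    have e: "indicator S' (x(r := y)) = indicator S x * (indicator {y. y \<le> 0} y :: ennreal)" for y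
    proof -
      have "x(r := y) \<in> space (gauss (insert r J))" using x by (auto simp: space_PiM PiE_def extensional_def)
      moreover have "restrict (x(r := y)) J = x"
        using x r by (auto simp: space_PiM PiE_def extensional_def fun_eq_iff)
      ultimately show ?thesis unfolding S'_def by (auto split: split_indicator)
    qed
    show "(\<integral>\<^sup>+y. indicator S' (x(r := y)) \<partial>N01) = indicator S x * emeasure N01 {y. y \<le> 0}"
      unfolding e by (subst nn_integral_cmult) auto
  qed
  also have "\<dots> = emeasure (gauss J) S * emeasure N01 {y. y \<le> 0}"
    by (subst nn_integral_multc) auto
  finally have "measure (gauss (insert r J)) S' = measure (gauss J) S * measure N01 {y. y \<le> 0}"
    by (simp add: measure_def enn2real_mult)
  also have "\<dots> \<ge> measure (gauss J) S * (1 / 2)"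
    by (intro mult_left_mono std_normal_nonpos) auto
  finally show ?thesis unfolding 1 by simp
qed

text \<open>Row \<open>m\<close> and column \<open>n\<close> of this array hold the auxiliary Gaussian vectors \<open>g\<close> and \<open>h\<close> of
  Gordon's comparison, and the corner \<open>(m, n)\<close> an independent scalar.\<close>
abbreviation array :: "nat \<Rightarrow> nat \<Rightarrow> (nat \<times> nat) set" where
  "array m n \<equiv> {..<Suc m} \<times> {..<Suc n}"

definition bilin :: "nat \<Rightarrow> nat \<Rightarrow> (nat \<times> nat \<Rightarrow> real) \<Rightarrow> (nat \<Rightarrow> real) \<Rightarrow> (nat \<Rightarrow> real) \<Rightarrow> real" where
  "bilin m n G w \<mu> = (\<Sum>i<m. \<Sum>j<n. w i * \<mu> j * G (i, j))"

definition decoupled :: "nat \<Rightarrow> nat \<Rightarrow> (nat \<times> nat \<Rightarrow> real) \<Rightarrow> (nat \<Rightarrow> real) \<Rightarrow> (nat \<Rightarrow> real) \<Rightarrow> real" where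
  "decoupled m n x w \<mu> = sqrt (sqnorm m w) * (\<Sum>j<n. \<mu> j * x (m, j)) + (\<Sum>i<m. w i * x (i, n))"

lemma sum_array:
  "(\<Sum>r\<in>array m n. c r) = (\<Sum>i<m. \<Sum>j<n. c (i, j)) + (\<Sum>i<m. c (i, n)) + (\<Sum>j<n. c (m, j)) + (c (m, n) :: real)"
  unfolding sum.cartesian_product' by (simp add: sum.distrib)

lemma sum_array_eq:
  fixes c :: "nat \<times> nat \<Rightarrow> real"
  assumes "\<And>i j. i < m \<Longrightarrow> j < n \<Longrightarrow> c (i, j) = c1 i j" "\<And>i. i < m \<Longrightarrow> c (i, n) = c2 i"
    "\<And>j. j < n \<Longrightarrow> c (m, j) = c3 j" "c (m, n) = c4"
  shows "(\<Sum>r\<in>array m n. c r) = (\<Sum>i<m. \<Sum>j<n. c1 i j) + (\<Sum>i<m. c2 i) + (\<Sum>j<n. c3 j) + c4"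
  unfolding sum_array using assms by simp

text \<open>The bilinear field receives the extra summand \<open>sqrt (sqnorm m w)\<close> times the
  corner variable, which raises its variance to that of the decoupled field. The difference of
  covariances then factors as \<open>(|w| * |w'| - <w, w'>) * (1 - <\<mu>, \<mu>'>)\<close>:
  nonnegative by Cauchy-Schwarz, and 0 along a row, where \<open>rows\<close> keeps \<open>w\<close>
  or \<open>\<mu>\<close> constant. A nonpositive corner variable preserves upper bounds on the
  form, hence the factor 2. The sign \<open>sg\<close> gives access to both directions of the
  comparison.\<close>

lemma gordon_bilinear:
  fixes w \<mu> :: "nat \<Rightarrow> nat \<Rightarrow> nat \<Rightarrow> real" and sg :: real
  assumes unit: "\<And>i j. sqnorm n (\<mu> i j) = 1" and sg: "sg * sg = 1"
    and rows: "\<And>i. (\<forall>j j'. w i j = w i j') \<or> (\<forall>j j'. \<mu> i j = \<mu> i j')"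
  shows "measure (gauss_mat m n) {G \<in> space (gauss_mat m n). \<exists>i<a. \<forall>j<b. sg * bilin m n G (w i j) (\<mu> i j) < l}
    \<le> 2 * measure (gauss (array m n)) {x \<in> space (gauss (array m n)). \<exists>i<a. \<forall>j<b. sg * decoupled m n x (w i j) (\<mu> i j) \<le> l}"
proof -
  let ?R = "array m n" and ?J = "{..<m} \<times> {..<n}"
  interpret G: prob_space "gauss ?R" by (rule prob_space_gauss)
  define nw where "nw = (\<lambda>i j. sqrt (sqnorm m (w i j)))"
  define A where "A = (\<lambda>(i, j) (p, q). if p < m \<and> q < n then sg * (w i j p * \<mu> i j q) else if p = m \<and> q = n then nw i j else 0)"
  define B where "B = (\<lambda>(i, j) (p, q). if p = m \<and> q < n then sg * (nw i j * \<mu> i j q) else if p < m \<and> q = n then sg * w i j p else 0)"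
  have Av: "A (i, j) (p, q) = (if p < m \<and> q < n then sg * (w i j p * \<mu> i j q) else if p = m \<and> q = n then nw i j else 0)" for i j p q
    by (simp add: A_def)
  have Bv: "B (i, j) (p, q) = (if p = m \<and> q < n then sg * (nw i j * \<mu> i j q) else if p < m \<and> q = n then sg * w i j p else 0)" for i j p q
    by (simp add: B_def)
  have sg': "sg * x * (sg * y) = x * y" for x y
  proof -
    have "sg * x * (sg * y) = (sg * sg) * (x * y)" by (simp only: mult_ac)
    then show ?thesis by (simp only: sg mult_1)
  qed
  have AX: "ip ?R (A (i, j)) x = sg * bilin m n x (w i j) (\<mu> i j) + nw i j * x (m, n)" for i j x
  proof -
    have "ip ?R (A (i, j)) x = (\<Sum>p<m. \<Sum>q<n. sg * (w i j p * \<mu> i j q * x (p, q))) + (\<Sum>p<m. 0) + (\<Sum>q<n. 0) + nw i j * x (m, n)"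
      by (rule sum_array_eq) (auto simp: Av)
    then show ?thesis by (simp add: bilin_def sum_distrib_left)
  qed
  have BX: "ip ?R (B (i, j)) x = sg * decoupled m n x (w i j) (\<mu> i j)" for i j x
  proof -
    have "ip ?R (B (i, j)) x = (\<Sum>p<m. \<Sum>q<n. 0) + (\<Sum>p<m. sg * (w i j p * x (p, n))) + (\<Sum>q<n. sg * (nw i j * (\<mu> i j q * x (m, q)))) + 0"
      by (rule sum_array_eq) (auto simp: Bv)
    then show ?thesis by (simp add: decoupled_def nw_def sum_distrib_left[symmetric] distrib_left)
  qed
  have cA: "ip ?R (A (i, j)) (A (i', j')) = (\<Sum>p<m. w i j p * w i' j' p) * (\<Sum>q<n. \<mu> i j q * \<mu> i' j' q) + nw i j * nw i' j'" for i j i' j'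
  proof -
    have "ip ?R (A (i, j)) (A (i', j')) = (\<Sum>p<m. \<Sum>q<n. (w i j p * w i' j' p) * (\<mu> i j q * \<mu> i' j' q)) + (\<Sum>p<m. 0) + (\<Sum>q<n. 0) + nw i j * nw i' j'"
      by (rule sum_array_eq) (auto simp: Av sg' sg mult_ac)
    then show ?thesis by (simp add: sum_product)
  qed
  have cB: "ip ?R (B (i, j)) (B (i', j')) = (\<Sum>p<m. w i j p * w i' j' p) + nw i j * nw i' j' * (\<Sum>q<n. \<mu> i j q * \<mu> i' j' q)" for i j i' j'
  proof -
    have "ip ?R (B (i, j)) (B (i', j')) = (\<Sum>p<m. \<Sum>q<n. 0) + (\<Sum>p<m. w i j p * w i' j' p) + (\<Sum>q<n. (nw i j * nw i' j') * (\<mu> i j q * \<mu> i' j' q)) + 0"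
      by (rule sum_array_eq) (auto simp: Bv sg' sg mult_ac)
    then show ?thesis by (simp add: sum_distrib_left)
  qed
  have cs: "(\<Sum>p<k. u p * v p) \<le> sqrt (sqnorm k u) * sqrt (sqnorm k v)" for k and u v :: "nat \<Rightarrow> real"
    unfolding sqnorm_def by (rule ip_le_norm)
  have dif: "ip ?R (A (i, j)) (A (i', j')) - ip ?R (B (i, j)) (B (i', j'))
     = (nw i j * nw i' j' - (\<Sum>p<m. w i j p * w i' j' p)) * (1 - (\<Sum>q<n. \<mu> i j q * \<mu> i' j' q))" for i j i' j'
    unfolding cA cB by (simp add: algebra_simps)
  have gordon: "measure (gauss ?R) {x \<in> space (gauss ?R). \<forall>i<a. \<exists>j<b. ip ?R (A (i, j)) x \<ge> l}
    \<ge> measure (gauss ?R) {x \<in> space (gauss ?R). \<forall>i<a. \<exists>j<b. ip ?R (B (i, j)) x > l}"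
  proof (rule gordon_comparison)
    fix i j j'
    have "nw i j * nw i j' = (\<Sum>p<m. w i j p * w i j' p) \<or> (\<Sum>q<n. \<mu> i j q * \<mu> i j' q) = 1"
    proof (cases "\<forall>j j'. w i j = w i j'")
      case True
      then have "w i j' = w i j" by blast
      then show ?thesis by (simp add: nw_def sqnorm_def power2_eq_square sum_nonneg)
    next
      case False
      then have "\<mu> i j' = \<mu> i j" using rows by blast
      then show ?thesis using unit[of i j] by (simp add: sqnorm_def power2_eq_square)
    qed
    then have "ip ?R (A (i, j)) (A (i, j')) - ip ?R (B (i, j)) (B (i, j')) = 0"
      unfolding dif by auto
    then show "ip ?R (A (i, j)) (A (i, j')) = ip ?R (B (i, j)) (B (i, j'))" by linarith
  next
    fix i i' j j'
    have "(\<Sum>p<m. w i j p * w i' j' p) \<le> nw i j * nw i' j'" unfolding nw_def by (rule cs)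
    moreover have "(\<Sum>q<n. \<mu> i j q * \<mu> i' j' q) \<le> 1" using cs[of "\<mu> i j" "\<mu> i' j'" n] by (simp add: unit)
    ultimately have "ip ?R (A (i, j)) (A (i', j')) - ip ?R (B (i, j)) (B (i', j')) \<ge> 0"
      unfolding dif by simp
    then show "ip ?R (A (i, j)) (A (i', j')) \<ge> ip ?R (B (i, j)) (B (i', j'))" by linarith
  qed simp
  define S where "S = {G \<in> space (gauss ?J). \<exists>i<a. \<forall>j<b. sg * bilin m n G (w i j) (\<mu> i j) < l}"
  have Sm: "S \<in> sets (gauss ?J)" unfolding S_def bilin_def by measurable
  let ?EA = "{x \<in> space (gauss ?R). \<forall>i<a. \<exists>j<b. ip ?R (A (i, j)) x \<ge> l}"
  let ?EB = "{x \<in> space (gauss ?R). \<forall>i<a. \<exists>j<b. ip ?R (B (i, j)) x > l}"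
  have mE[measurable]: "?EA \<in> sets (gauss ?R)" "?EB \<in> sets (gauss ?R)" by measurable
  have "measure (gauss ?J) S \<le> 2 * measure (gauss ?R) {x \<in> space (gauss ?R). restrict x ?J \<in> S \<and> x (m, n) \<le> 0}"
    by (rule gauss_drop_coordinate[OF _ _ _ _ Sm]) auto
  also have "measure (gauss ?R) {x \<in> space (gauss ?R). restrict x ?J \<in> S \<and> x (m, n) \<le> 0}
     \<le> measure (gauss ?R) (space (gauss ?R) - ?EA)"
  proof (rule G.finite_measure_mono)
    show "{x \<in> space (gauss ?R). restrict x ?J \<in> S \<and> x (m, n) \<le> 0} \<subseteq> space (gauss ?R) - ?EA"
    proof safe
      fix x assume x: "x \<in> space (gauss ?R)" "restrict x ?J \<in> S" "x (m, n) \<le> 0"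
        and ex: "\<forall>i<a. \<exists>j<b. l \<le> ip ?R (A (i, j)) x"
      from x(2) obtain i where i: "i < a" "\<And>j. j < b \<Longrightarrow> sg * bilin m n (restrict x ?J) (w i j) (\<mu> i j) < l"
        unfolding S_def by auto
      have br: "bilin m n (restrict x ?J) u v = bilin m n x u v" for u v
        unfolding bilin_def by (intro sum.cong refl) auto
      obtain j where j: "j < b" "l \<le> ip ?R (A (i, j)) x" using ex i(1) by blast
      have "nw i j * x (m, n) \<le> 0" using x(3) by (intro mult_nonneg_nonpos) (auto simp: nw_def sqnorm_def sum_nonneg)
      then show False using j(2) i(2)[OF j(1)] unfolding AX br by linarith
    qed
  qed measurable
  also have "measure (gauss ?R) (space (gauss ?R) - ?EA) \<le> measure (gauss ?R) (space (gauss ?R) - ?EB)"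
    using gordon by (simp add: G.prob_compl[OF mE(1)] G.prob_compl[OF mE(2)])
  also have "space (gauss ?R) - ?EB = {x \<in> space (gauss ?R). \<exists>i<a. \<forall>j<b. sg * decoupled m n x (w i j) (\<mu> i j) \<le> l}"
    unfolding BX not_le[symmetric] by blast
  finally show ?thesis unfolding S_def gauss_mat_def by simp
qed

text \<open>Here \<open>q j\<close> implies the inequality for all outer indices at once, so the
  bound does not depend on \<open>a\<close>. Continuity of the measure then handles the limit in
  \<open>a\<close> (increasing events for the matrix) and in \<open>b\<close> (decreasing events for
  the decoupled field). In \<open>bad\<close> the outer index may depend on \<open>b\<close>; this
  accommodates an inner family that is unbounded. The set \<open>Bad\<close> is merely covered by
  measurable events.\<close>

lemma gordon_limit:
  fixes w \<mu> :: "nat \<Rightarrow> nat \<Rightarrow> nat \<Rightarrow> real" and sg :: real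
  assumes unit: "\<And>i j. sqnorm n (\<mu> i j) = 1" and sg: "sg * sg = 1"
    and rows: "\<And>i. (\<forall>j j'. w i j = w i j') \<or> (\<forall>j j'. \<mu> i j = \<mu> i j')"
    and q[measurable]: "\<And>j. {x \<in> space (gauss (array m n)). q j x} \<in> sets (gauss (array m n))"
    and good: "\<And>i j x. x \<in> space (gauss (array m n)) \<Longrightarrow> q j x \<Longrightarrow> sg * decoupled m n x (w i j) (\<mu> i j) > l"
    and bad: "\<And>b G. G \<in> Bad \<Longrightarrow> G \<in> space (gauss_mat m n) \<and> (\<exists>i. \<forall>j<b. sg * bilin m n G (w i j) (\<mu> i j) < l)"
  shows "measure (gauss_mat m n) Bad \<le> 2 * measure (gauss (array m n)) {x \<in> space (gauss (array m n)). \<forall>j. \<not> q j x}"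
proof -
  let ?P = "gauss (array m n)" and ?M = "gauss_mat m n"
  interpret G: prob_space ?P by (rule prob_space_gauss)
  interpret M: prob_space ?M unfolding gauss_mat_def by (rule prob_space_gauss)
  have b: "measure ?M Bad \<le> 2 * measure ?P {x \<in> space ?P. \<forall>j<b. \<not> q j x}" for b
  proof -
    define E where "E = (\<lambda>a. {G \<in> space ?M. \<exists>i<a. \<forall>j<b. sg * bilin m n G (w i j) (\<mu> i j) < l})"
    have Em: "E a \<in> sets ?M" for a unfolding E_def bilin_def gauss_mat_def by measurable
    have le: "measure ?M (E a) \<le> 2 * measure ?P {x \<in> space ?P. \<forall>j<b. \<not> q j x}" for a
    proof -
      have "measure ?M (E a) \<le> 2 * measure ?P {x \<in> space ?P. \<exists>i<a. \<forall>j<b. sg * decoupled m n x (w i j) (\<mu> i j) \<le> l}"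
        unfolding E_def by (rule gordon_bilinear[OF unit sg rows])
      also have "measure ?P {x \<in> space ?P. \<exists>i<a. \<forall>j<b. sg * decoupled m n x (w i j) (\<mu> i j) \<le> l}
          \<le> measure ?P {x \<in> space ?P. \<forall>j<b. \<not> q j x}"
      proof (rule G.finite_measure_mono)
        show "{x \<in> space ?P. \<exists>i<a. \<forall>j<b. sg * decoupled m n x (w i j) (\<mu> i j) \<le> l} \<subseteq> {x \<in> space ?P. \<forall>j<b. \<not> q j x}"
        proof
          fix x assume x: "x \<in> {x \<in> space ?P. \<exists>i<a. \<forall>j<b. sg * decoupled m n x (w i j) (\<mu> i j) \<le> l}"
          then obtain i where sp: "x \<in> space ?P" and i: "\<And>j. j < b \<Longrightarrow> sg * decoupled m n x (w i j) (\<mu> i j) \<le> l" by auto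
          have "\<not> q j x" if "j < b" for j
            using good[OF sp, of j i] i[OF that] by (meson not_less)
          then show "x \<in> {x \<in> space ?P. \<forall>j<b. \<not> q j x}" using sp by simp
        qed
      qed measurable
      finally show ?thesis by simp
    qed
    have "(\<lambda>a. measure ?M (E a)) \<longlonglongrightarrow> measure ?M (\<Union>a. E a)"
    proof (rule M.finite_Lim_measure_incseq)
      show "range E \<subseteq> sets ?M" using Em by blast
      show "incseq E" unfolding incseq_def E_def by (intro allI impI Collect_mono) (meson less_le_trans)
    qed
    then have "measure ?M (\<Union>a. E a) \<le> 2 * measure ?P {x \<in> space ?P. \<forall>j<b. \<not> q j x}"
      by (rule LIMSEQ_le_const2) (use le in blast)
    moreover have "measure ?M Bad \<le> measure ?M (\<Union>a. E a)"
    proof (rule M.finite_measure_mono)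
      show "Bad \<subseteq> (\<Union>a. E a)"
      proof
        fix G assume "G \<in> Bad"
        from bad[OF this, of b] obtain i where "G \<in> space ?M" "\<forall>j<b. sg * bilin m n G (w i j) (\<mu> i j) < l" by metis
        then have "G \<in> E (Suc i)" unfolding E_def by auto
        then show "G \<in> (\<Union>a. E a)" by blast
      qed
    qed (use Em in auto)
    ultimately show ?thesis by linarith
  qed
  have N: "(\<Inter>b. {x \<in> space ?P. \<forall>j<b. \<not> q j x}) = {x \<in> space ?P. \<forall>j. \<not> q j x}" by auto
  have "(\<lambda>b. measure ?P {x \<in> space ?P. \<forall>j<b. \<not> q j x}) \<longlonglongrightarrow> measure ?P (\<Inter>b. {x \<in> space ?P. \<forall>j<b. \<not> q j x})"
  proof (rule G.finite_Lim_measure_decseq)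
    show "range (\<lambda>b. {x \<in> space ?P. \<forall>j<b. \<not> q j x}) \<subseteq> sets ?P" by (intro image_subsetI) measurable
    show "decseq (\<lambda>b. {x \<in> space ?P. \<forall>j<b. \<not> q j x})"
      unfolding decseq_def by (intro allI impI Collect_mono) (meson less_le_trans)
  qed
  then have "(\<lambda>b. 2 * measure ?P {x \<in> space ?P. \<forall>j<b. \<not> q j x}) \<longlonglongrightarrow> 2 * measure ?P {x \<in> space ?P. \<forall>j. \<not> q j x}"
    unfolding N by (intro tendsto_mult tendsto_const)
  then show ?thesis by (rule LIMSEQ_le_const) (use b in blast)
qed

section \<open>Cones and projections\<close>

text \<open>Stands in for a net: every open condition that is solvable in \<open>S\<close> is solved
  by a member of the sequence.\<close>

lemma dense_sequence:
  fixes S :: "'a::{metric_space, second_countable_topology} set"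
  assumes "S \<noteq> {}"
  obtains s :: "nat \<Rightarrow> 'a" where "\<And>i. s i \<in> S" "\<And>U x. open U \<Longrightarrow> x \<in> S \<Longrightarrow> x \<in> U \<Longrightarrow> \<exists>i. s i \<in> U"
proof -
  obtain T where T: "countable T" "T \<subseteq> S" "S \<subseteq> closure T" using separable by blast
  have ne: "T \<noteq> {}" using T assms by auto
  show ?thesis
  proof (rule that[of "from_nat_into T"])
    show "from_nat_into T i \<in> S" for i using from_nat_into[OF ne] T(2) by blast
    fix U x assume "open U" "x \<in> S" "x \<in> U"
    then obtain y where "y \<in> T" "y \<in> U" using T(3) open_Int_closure_eq_empty[of U T] by blast
    then show "\<exists>i. from_nat_into T i \<in> U" using from_nat_into_surj[OF T(1)] by metis
  qed
qed

lemma continuous_coord[continuous_intros]: "continuous_on S (\<lambda>x. x i :: real)"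
  by (rule continuous_on_subset[OF continuous_on_product_coordinates]) simp

lemma continuous_sqnorm:
  assumes "continuous_on S f"
  shows "continuous_on S (\<lambda>x. sqnorm n (f x))"
  unfolding sqnorm_def
  by (intro continuous_on_sum continuous_on_power continuous_on_product_then_coordinatewise[OF assms])

lemma sqnorm_nonneg: "sqnorm n x \<ge> 0"
  by (simp add: sqnorm_def sum_nonneg)

section \<open>Closest points and the metric projection\<close>

lemma compact_box:
  fixes B :: "'i \<Rightarrow> real"
  shows "compact {x. \<forall>i. \<bar>x i\<bar> \<le> B i}"
proof -
  have "{x. \<forall>i. \<bar>x i\<bar> \<le> B i} = PiE UNIV (\<lambda>i. {- B i..B i})"
    by (auto simp: PiE_def Pi_def abs_le_iff minus_le_iff)
  moreover have "compactin (product_topology (\<lambda>i. euclidean) UNIV) (PiE UNIV (\<lambda>i::'i. {- B i..B i}))"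
    by (subst compactin_PiE) (auto simp: compactin_euclidean_iff)
  ultimately show ?thesis by (simp add: euclidean_product_topology compactin_euclidean_iff)
qed

text \<open>Coordinates from \<open>n\<close> on vanish, so a bound on the first \<open>n\<close>
  places \<open>C\<close> inside a product of compact intervals, to which Tychonoff's theorem
  applies.\<close>

lemma compact_Rn_bounded:
  assumes C: "closed C" "C \<subseteq> Rn n" and b: "\<And>x i. x \<in> C \<Longrightarrow> i < n \<Longrightarrow> \<bar>x i\<bar> \<le> B"
  shows "compact C"
proof -
  have "C \<subseteq> {x. \<forall>i. \<bar>x i\<bar> \<le> (if i < n then B else 0)}"
    using C(2) b by (auto simp: Rn_def)
  then have "C = C \<inter> {x. \<forall>i. \<bar>x i\<bar> \<le> (if i < n then B else 0)}" by blast
  also have "compact \<dots>" by (rule closed_Int_compact[OF C(1) compact_box])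
  finally show ?thesis .
qed

lemma coord_le_sqnorm: "i < n \<Longrightarrow> (x i)\<^sup>2 \<le> sqnorm n x"
  unfolding sqnorm_def by (rule member_le_sum) auto

text \<open>Existence comes from compactness of a sublevel set of the distance, the variational
  inequality from moving a little from \<open>p\<close> towards \<open>y\<close>.\<close>

lemma closest_point_Rn:
  assumes C: "closed C" "C \<subseteq> Rn n" and c0: "c0 \<in> C"
    and conv: "\<And>x y t. x \<in> C \<Longrightarrow> y \<in> C \<Longrightarrow> 0 \<le> t \<Longrightarrow> t \<le> 1 \<Longrightarrow> (\<lambda>i. (1 - t) * x i + t * y i) \<in> C"
  obtains p where "p \<in> C" "\<And>y. y \<in> C \<Longrightarrow> sqnorm n (\<lambda>i. q i - p i) \<le> sqnorm n (\<lambda>i. q i - y i)"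
    "\<And>y. y \<in> C \<Longrightarrow> (\<Sum>i<n. (q i - p i) * (y i - p i)) \<le> 0"
proof -
  define f where "f = (\<lambda>x. sqnorm n (\<lambda>i. q i - x i))"
  have fc: "continuous_on S f" for S unfolding f_def by (intro continuous_sqnorm continuous_intros)
  define C' where "C' = C \<inter> {x. f x \<le> f c0}"
  have "compact C'"
  proof (rule compact_Rn_bounded)
    show "closed C'" unfolding C'_def using C(1) fc by (intro closed_Int closed_Collect_le) auto
    show "C' \<subseteq> Rn n" using C(2) by (auto simp: C'_def)
    fix x i assume x: "x \<in> C'" and i: "i < n"
    have "(q i - x i)\<^sup>2 \<le> f c0" using coord_le_sqnorm[OF i, of "\<lambda>i. q i - x i"] x by (simp add: C'_def f_def)
    then have "\<bar>q i - x i\<bar> \<le> sqrt (f c0)" by (simp add: real_le_rsqrt)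
    moreover have "\<bar>q i\<bar> \<le> (\<Sum>i<n. \<bar>q i\<bar>)" using i by (intro member_le_sum) auto
    ultimately show "\<bar>x i\<bar> \<le> sqrt (f c0) + (\<Sum>i<n. \<bar>q i\<bar>)" by linarith
  qed
  moreover have "C' \<noteq> {}" using c0 by (auto simp: C'_def)
  ultimately obtain p where p: "p \<in> C'" "\<And>y. y \<in> C' \<Longrightarrow> f p \<le> f y"
    using continuous_attains_inf[OF _ _ fc] by metis
  have pC: "p \<in> C" using p by (simp add: C'_def)
  have min: "f p \<le> f y" if "y \<in> C" for y
    using p that by (cases "f y \<le> f c0") (auto simp: C'_def)
  have var: "(\<Sum>i<n. (q i - p i) * (y i - p i)) \<le> 0" if y: "y \<in> C" for y
  proof (rule ccontr)
    define a where "a = (\<Sum>i<n. (q i - p i) * (y i - p i))"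
    define b where "b = sqnorm n (\<lambda>i. y i - p i)"
    assume "\<not> (\<Sum>i<n. (q i - p i) * (y i - p i)) \<le> 0"
    then have a: "a > 0" by (simp add: a_def)
    have b: "b \<ge> 0" unfolding b_def by (rule sqnorm_nonneg)
    \<comment> \<open>With this step size the quadratic cost \<open>t\<^sup>2 * b\<close> is at most
      \<open>t * a\<close>, less than the linear gain \<open>2 * t * a\<close>. The summand
      \<open>a\<close> in the denominator ensures \<open>t \<le> 1\<close> and covers
      \<open>b = 0\<close>.\<close>
    define t where "t = a / (a + b)"
    have t: "0 < t" "t \<le> 1" using a b by (auto simp: t_def)
    have "f p \<le> f (\<lambda>i. (1 - t) * p i + t * y i)" using t by (intro min conv pC y) auto
    also have "\<dots> = f p - 2 * t * a + t\<^sup>2 * b"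
      unfolding f_def sqnorm_def a_def b_def sum_distrib_left sum_subtractf[symmetric] sum.distrib[symmetric]
      by (intro sum.cong refl) (simp add: power2_eq_square algebra_simps)
    finally have "t * (2 * a) \<le> t * (t * b)" by (simp add: power2_eq_square mult_ac)
    then have "2 * a \<le> t * b" using t by simp
    also have "t * b \<le> a"
    proof -
      have "b \<le> a + b" using a by simp
      then have "a * b / (a + b) \<le> a" using a b by (simp add: field_simps)
      then show ?thesis by (simp add: t_def)
    qed
    finally show False using a by simp
  qed
  show ?thesis by (rule that[OF pC]) (use min var in \<open>auto simp: f_def\<close>)
qed

lemma coneD:
  assumes "nontrivial_closed_convex_cone n K"
  shows "K \<subseteq> Rn n" "(\<lambda>_. 0) \<in> K" "closed K" "\<And>x t. x \<in> K \<Longrightarrow> t \<ge> 0 \<Longrightarrow> (\<lambda>i. t * x i) \<in> K"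
    "\<And>x y. x \<in> K \<Longrightarrow> y \<in> K \<Longrightarrow> (\<lambda>i. x i + y i) \<in> K" "K \<noteq> {\<lambda>_. 0}"
  using assms unfolding nontrivial_closed_convex_cone_def by auto

lemma cone_convex:
  assumes "nontrivial_closed_convex_cone n K" "x \<in> K" "y \<in> K" "0 \<le> t" "t \<le> 1"
  shows "(\<lambda>i. (1 - t) * x i + t * y i) \<in> K"
  using coneD(5)[OF assms(1) coneD(4)[OF assms(1,2), of "1 - t"] coneD(4)[OF assms(1,3), of t]] assms(4,5) by simp

text \<open>Moreau's decomposition: the variational inequality tested at 0 and at twice the
  projection makes \<open>g - p\<close> orthogonal to \<open>p\<close>, and what remains of it says
  that \<open>g - p\<close> lies in the polar cone.\<close>

lemma proj_cone_props:
  fixes g :: "nat \<Rightarrow> real"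
  assumes K: "nontrivial_closed_convex_cone n K"
  defines "p \<equiv> proj_cone n K g"
  shows "p \<in> K" "(\<Sum>i<n. p i * g i) = sqnorm n p" "\<And>y. y \<in> K \<Longrightarrow> (\<Sum>i<n. y i * g i) \<le> (\<Sum>i<n. y i * p i)"
proof -
  obtain p' where p': "p' \<in> K" "\<And>y. y \<in> K \<Longrightarrow> sqnorm n (\<lambda>i. g i - p' i) \<le> sqnorm n (\<lambda>i. g i - y i)"
    "\<And>y. y \<in> K \<Longrightarrow> (\<Sum>i<n. (g i - p' i) * (y i - p' i)) \<le> 0"
    by (rule closest_point_Rn[OF coneD(3,1)[OF K] coneD(2)[OF K] cone_convex[OF K], of g]) (assumption+, rule that)
  \<comment> \<open>The definite description needs uniqueness, which the variational inequality
    gives below \<open>n\<close>. From \<open>n\<close> on, where \<open>sqnorm n\<close> sees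
    nothing, two candidates agree as members of \<open>Rn n\<close>.\<close>
  have "p = p'" unfolding p_def proj_cone_def
  proof (rule the_equality)
    fix y assume y: "y \<in> K \<and> (\<forall>z\<in>K. sqnorm n (\<lambda>i. g i - y i) \<le> sqnorm n (\<lambda>i. g i - z i))"
    have "sqnorm n (\<lambda>i. g i - y i) = sqnorm n (\<lambda>i. g i - p' i) - 2 * (\<Sum>i<n. (g i - p' i) * (y i - p' i)) + sqnorm n (\<lambda>i. y i - p' i)"
      unfolding sqnorm_def sum_distrib_left sum_subtractf[symmetric] sum.distrib[symmetric]
      by (intro sum.cong refl) (simp add: power2_eq_square algebra_simps)
    moreover have "sqnorm n (\<lambda>i. g i - y i) \<le> sqnorm n (\<lambda>i. g i - p' i)" using y p'(1) by blast
    ultimately have "sqnorm n (\<lambda>i. y i - p' i) \<le> 0" using p'(3)[of y] y by linarith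
    then have "(y i - p' i)\<^sup>2 \<le> 0" if "i < n" for i using coord_le_sqnorm[OF that, of "\<lambda>i. y i - p' i"] by linarith
    then have "y i = p' i" if "i < n" for i using that by simp
    moreover have "y i = p' i" if "\<not> i < n" for i
    proof -
      have "y \<in> Rn n" "p' \<in> Rn n" using y p'(1) coneD(1)[OF K] by auto
      then show ?thesis using that by (simp add: Rn_def not_less)
    qed
    ultimately show "y = p'" by (intro ext) metis
  qed (use p' in auto)
  note p = p'[folded \<open>p = p'\<close>]
  show "p \<in> K" by (rule p)
  have e: "(\<Sum>i<n. (g i - p i) * (c * p i - p i)) = (c - 1) * (\<Sum>i<n. (g i - p i) * p i)" for c
    unfolding sum_distrib_left by (intro sum.cong refl) (simp add: algebra_simps)
  have z: "(\<Sum>i<n. (g i - p i) * p i) = 0"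
    using p(3)[OF coneD(4)[OF K p(1), of 0]] p(3)[OF coneD(4)[OF K p(1), of 2]] unfolding e by simp
  have "(\<Sum>i<n. (g i - p i) * p i) = (\<Sum>i<n. p i * g i) - sqnorm n p"
    unfolding sqnorm_def sum_subtractf[symmetric]
    by (intro sum.cong refl) (simp add: power2_eq_square algebra_simps)
  then show "(\<Sum>i<n. p i * g i) = sqnorm n p" using z by linarith
  fix y assume y: "y \<in> K"
  have "(\<Sum>i<n. (g i - p i) * (y i - p i)) = (\<Sum>i<n. y i * g i) - (\<Sum>i<n. y i * p i) - (\<Sum>i<n. (g i - p i) * p i)"
    unfolding sum_subtractf[symmetric] by (intro sum.cong refl) (simp add: algebra_simps)
  then show "(\<Sum>i<n. y i * g i) \<le> (\<Sum>i<n. y i * p i)" using p(3)[OF y] z by linarith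
qed

section \<open>The norm of the projection as a support function\<close>

text \<open>For a cone this is the maximum of \<open>\<Sum>i<n. y i * g i\<close> over its part
  \<open>y\<close> in the unit ball; it is used in that form.\<close>

definition cone_norm :: "nat \<Rightarrow> (nat \<Rightarrow> real) set \<Rightarrow> (nat \<Rightarrow> real) \<Rightarrow> real" where
  "cone_norm n K g = sqrt (sqnorm n (proj_cone n K g))"

lemma cauchy_schwarz_sqnorm: "(\<Sum>i<n. x i * y i) \<le> sqrt (sqnorm n x) * sqrt (sqnorm n y)"
  unfolding sqnorm_def by (rule ip_le_norm)

lemma sqnorm_scale: "sqnorm n (\<lambda>i. c * x i) = c\<^sup>2 * sqnorm n x"
  by (simp add: sqnorm_def power_mult_distrib sum_distrib_left)

lemma cone_norm_nonneg: "cone_norm n K g \<ge> 0"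
  by (simp add: cone_norm_def sqnorm_nonneg)

lemma cone_norm_upper:
  assumes K: "nontrivial_closed_convex_cone n K" and y: "y \<in> K" "sqnorm n y \<le> 1"
  shows "(\<Sum>i<n. y i * g i) \<le> cone_norm n K g"
proof -
  have "(\<Sum>i<n. y i * g i) \<le> (\<Sum>i<n. y i * proj_cone n K g i)" by (rule proj_cone_props(3)[OF K y(1)])
  also have "\<dots> \<le> sqrt (sqnorm n y) * cone_norm n K g" unfolding cone_norm_def by (rule cauchy_schwarz_sqnorm)
  also have "\<dots> \<le> 1 * cone_norm n K g" using y(2) by (intro mult_right_mono cone_norm_nonneg) simp
  finally show ?thesis by simp
qed

abbreviation cone_sphere :: "nat \<Rightarrow> (nat \<Rightarrow> real) set \<Rightarrow> (nat \<Rightarrow> real) set" where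
  "cone_sphere n K \<equiv> {\<mu> \<in> K. sqnorm n \<mu> = 1}"

text \<open>The maximiser is the normalised projection. If the projection is 0, the maximum over the
  sphere can be negative, hence the positivity assumption.\<close>

lemma cone_norm_attained:
  assumes K: "nontrivial_closed_convex_cone n K" and pos: "cone_norm n K g > 0"
  obtains s where "s \<in> cone_sphere n K" "(\<Sum>i<n. s i * g i) = cone_norm n K g"
proof
  define p where "p = proj_cone n K g"
  define c where "c = cone_norm n K g"
  have sq: "sqnorm n p = c\<^sup>2" by (simp add: c_def p_def cone_norm_def sqnorm_nonneg)
  have c: "c > 0" using pos by (simp add: c_def)
  have "sqnorm n (\<lambda>i. (1 / c) * p i) = 1" unfolding sqnorm_scale sq using c by (simp add: power_divide)
  moreover have "(\<lambda>i. (1 / c) * p i) \<in> K"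
    using coneD(4)[OF K proj_cone_props(1)[OF K], of "1 / c" g] c unfolding p_def by auto
  ultimately show "(\<lambda>i. (1 / c) * p i) \<in> cone_sphere n K" by blast
  have "(\<Sum>i<n. (1 / c) * p i * g i) = (1 / c) * (\<Sum>i<n. p i * g i)" by (simp add: sum_distrib_left mult_ac)
  also have "\<dots> = (1 / c) * c\<^sup>2" using proj_cone_props(2)[OF K, of g] by (simp add: p_def[symmetric] sq)
  also have "\<dots> = c" using c by (simp add: power2_eq_square)
  finally show "(\<Sum>i<n. (1 / c) * p i * g i) = cone_norm n K g" by (simp add: c_def)
qed

lemma cone_sphere_nonempty:
  assumes K: "nontrivial_closed_convex_cone n K"
  shows "cone_sphere n K \<noteq> {}"
proof -
  obtain x where x: "x \<in> K" "x \<noteq> (\<lambda>_. 0)" using coneD(2,6)[OF K] by blast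
  then obtain i where i: "x i \<noteq> 0" by blast
  have "x \<in> Rn n" using x(1) coneD(1)[OF K] by blast
  then have "i < n" using i by (intro not_le_imp_less) (auto simp: Rn_def)
  moreover have "(x i)\<^sup>2 > 0" using i by simp
  ultimately have pos: "sqnorm n x > 0" using coord_le_sqnorm[of i n x] by linarith
  have "sqnorm n (\<lambda>i. (1 / sqrt (sqnorm n x)) * x i) = 1"
    unfolding sqnorm_scale using pos by (simp add: power_divide)
  moreover have "(\<lambda>i. (1 / sqrt (sqnorm n x)) * x i) \<in> K"
    using coneD(4)[OF K x(1), of "1 / sqrt (sqnorm n x)"] pos by auto
  ultimately show ?thesis by blast
qed

text \<open>As \<open>proj_cone\<close> is a definite description, measurability is read off the
  variational formula: for \<open>a \<ge> 0\<close> the superlevel set is a countable union of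
  half-spaces, one for each member of a dense sequence in \<open>cone_sphere n K\<close>.\<close>

lemma cone_norm_measurable:
  assumes K: "nontrivial_closed_convex_cone n K" and f: "\<And>i. i < n \<Longrightarrow> (\<lambda>x. f x i) \<in> borel_measurable M"
  shows "(\<lambda>x. cone_norm n K (f x)) \<in> borel_measurable M"
proof -
  obtain s where s: "\<And>j. s j \<in> cone_sphere n K"
    "\<And>U x. open U \<Longrightarrow> x \<in> cone_sphere n K \<Longrightarrow> x \<in> U \<Longrightarrow> \<exists>j. (s :: nat \<Rightarrow> nat \<Rightarrow> real) j \<in> U"
    by (rule dense_sequence[OF cone_sphere_nonempty[OF K]]) (rule that)
  have eq: "cone_norm n K g > a \<longleftrightarrow> (\<exists>j. (\<Sum>i<n. s j i * g i) > a)" if a: "a \<ge> 0" for a g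
  proof
    assume gt: "cone_norm n K g > a"
    then obtain t where t: "t \<in> cone_sphere n K" "(\<Sum>i<n. t i * g i) = cone_norm n K g"
      using cone_norm_attained[OF K, of g] a by (metis le_less_trans)
    have "open {t. (\<Sum>i<n. t i * g i) > a}" by (intro open_Collect_less continuous_intros)
    from s(2)[OF this t(1)] show "\<exists>j. (\<Sum>i<n. s j i * g i) > a" using t(2) gt by auto
  next
    assume "\<exists>j. (\<Sum>i<n. s j i * g i) > a"
    then obtain j where "(\<Sum>i<n. s j i * g i) > a" by blast
    moreover have "(\<Sum>i<n. s j i * g i) \<le> cone_norm n K g" using s(1)[of j] by (intro cone_norm_upper[OF K]) auto
    ultimately show "cone_norm n K g > a" by linarith
  qed
  show ?thesis
    unfolding borel_measurable_iff_greater
  proof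
    fix a :: real
    show "{x \<in> space M. a < cone_norm n K (f x)} \<in> sets M"
    proof (cases "a \<ge> 0")
      case True
      have m: "(\<lambda>x. \<Sum>i<n. s j i * f x i) \<in> borel_measurable M" for j
        using f by (intro borel_measurable_sum borel_measurable_times) auto
      show ?thesis unfolding eq[OF True] using m by measurable
    next
      case False
      then have "{x \<in> space M. a < cone_norm n K (f x)} = space M"
        using less_le_trans[OF _ cone_norm_nonneg] by (simp add: not_le)
      then show ?thesis by simp
    qed
  qed
qed

lemma support_fun_cone_norm:
  assumes K: "nontrivial_closed_convex_cone n K"
  shows "support_fun (array m n) (\<lambda>x. cone_norm n K (\<lambda>j. x (m, j)))"
  unfolding support_fun_def
proof (intro conjI allI)
  show "(\<lambda>x. cone_norm n K (\<lambda>j. x (m, j))) \<in> borel_measurable (gauss (array m n))"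
    by (rule cone_norm_measurable[OF K]) measurable
  fix x :: "nat \<times> nat \<Rightarrow> real"
  define g where "g = (\<lambda>j. x (m, j))"
  have "\<exists>s\<in>K. sqnorm n s \<le> 1 \<and> (\<Sum>i<n. s i * g i) = cone_norm n K g"
  proof (cases "cone_norm n K g > 0")
    case True
    then obtain s where "s \<in> cone_sphere n K" "(\<Sum>i<n. s i * g i) = cone_norm n K g"
      by (rule cone_norm_attained[OF K])
    then show ?thesis by (intro bexI[of _ s]) auto
  next
    case False
    then have "cone_norm n K g = 0" using cone_norm_nonneg[of n K g] by simp
    then show ?thesis using coneD(2)[OF K] by (intro bexI[of _ "\<lambda>_. 0"]) (auto simp: sqnorm_def)
  qed
  then obtain s where s: "s \<in> K" "sqnorm n s \<le> 1" "(\<Sum>i<n. s i * g i) = cone_norm n K g" by blast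
  \<comment> \<open>The maximiser placed in row \<open>m\<close>, where the vector \<open>g\<close>
    sits, and extended by 0 to the whole array.\<close>
  define S where "S = (\<lambda>(p, q). if p = m \<and> q < n then s q else 0)"
  have S: "ip (array m n) S y = (\<Sum>i<n. s i * y (m, i))" for y
    by (subst sum_array_eq[of m n _ "\<lambda>_ _. 0" "\<lambda>_. 0" "\<lambda>i. s i * y (m, i)" 0]) (auto simp: S_def)
  have S2: "(\<Sum>r\<in>array m n. (S r)\<^sup>2) = sqnorm n s"
    by (subst sum_array_eq[of m n _ "\<lambda>_ _. 0" "\<lambda>_. 0" "\<lambda>i. (s i)\<^sup>2" 0]) (auto simp: S_def sqnorm_def)
  show "\<exists>S. (\<Sum>r\<in>array m n. (S r)\<^sup>2) \<le> 1 \<and> cone_norm n K (\<lambda>j. x (m, j)) = ip (array m n) S x \<and>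
      (\<forall>y. ip (array m n) S y \<le> cone_norm n K (\<lambda>j. y (m, j)))"
  proof (intro exI[of _ S] conjI allI)
    show "(\<Sum>r\<in>array m n. (S r)\<^sup>2) \<le> 1" unfolding S2 by (rule s)
    show "cone_norm n K (\<lambda>j. x (m, j)) = ip (array m n) S x" unfolding S using s(3) by (simp add: g_def)
    show "ip (array m n) S y \<le> cone_norm n K (\<lambda>j. y (m, j))" for y
      unfolding S by (rule cone_norm_upper[OF K s(1,2)])
  qed
qed

lemma cone_norm_mean_square:
  assumes K: "nontrivial_closed_convex_cone n K"
  shows "(\<integral>x. (cone_norm n K (\<lambda>j. x (m, j)))\<^sup>2 \<partial>gauss (array m n)) = stat_dim n K"
proof -
  have d: "distr (gauss (array m n)) (gauss {..<n}) (\<lambda>x. \<lambda>j\<in>{..<n}. x (m, j)) = gauss {..<n}"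
    by (rule distr_PiM_reindex) (auto intro: prob_space_std_normal simp: inj_on_def)
  have m: "(\<lambda>x. \<lambda>j\<in>{..<n}. x (m, j)) \<in> gauss (array m n) \<rightarrow>\<^sub>M gauss {..<n}" by measurable
  have cg: "cone_norm n K (\<lambda>j\<in>{..<n}. x (m, j)) = cone_norm n K (\<lambda>j. x (m, j))" for x :: "nat \<times> nat \<Rightarrow> real"
  proof -
    have "sqnorm n (\<lambda>i. (\<lambda>j\<in>{..<n}. x (m, j)) i - y i) = sqnorm n (\<lambda>i. x (m, i) - y i)" for y
      by (simp add: sqnorm_def)
    then show ?thesis unfolding cone_norm_def proj_cone_def by (simp only:)
  qed
  have cm: "(\<lambda>g. (cone_norm n K g)\<^sup>2) \<in> borel_measurable (gauss {..<n})"
    by (intro borel_measurable_power cone_norm_measurable[OF K]) measurable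
  have "stat_dim n K = (\<integral>g. (cone_norm n K g)\<^sup>2 \<partial>gauss {..<n})"
    by (simp add: stat_dim_def gauss_vec_def cone_norm_def sqnorm_nonneg)
  also have "\<dots> = (\<integral>g. (cone_norm n K g)\<^sup>2 \<partial>distr (gauss (array m n)) (gauss {..<n}) (\<lambda>x. \<lambda>j\<in>{..<n}. x (m, j)))"
    unfolding d ..
  also have "\<dots> = (\<integral>x. (cone_norm n K (\<lambda>j\<in>{..<n}. x (m, j)))\<^sup>2 \<partial>gauss (array m n))"
    by (rule integral_distr[OF m cm])
  finally show ?thesis by (simp only: cg)
qed

section \<open>Norms of blocks of coordinates\<close>

definition coord_norm :: "'i set \<Rightarrow> ('i \<Rightarrow> real) \<Rightarrow> real" where
  "coord_norm Q x = sqrt (\<Sum>r\<in>Q. (x r)\<^sup>2)"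

lemma coord_norm_nonneg: "coord_norm Q x \<ge> 0"
  by (simp add: coord_norm_def sum_nonneg)

lemma coord_norm_cs: "(\<Sum>r\<in>Q. u r * x r) \<le> sqrt (\<Sum>r\<in>Q. (u r)\<^sup>2) * coord_norm Q x"
  unfolding coord_norm_def by (rule ip_le_norm)

lemma support_fun_coord_norm:
  assumes R: "finite R" and Q: "Q \<subseteq> R"
  shows "support_fun R (coord_norm Q)" "(\<integral>x. (coord_norm Q x)\<^sup>2 \<partial>gauss R) = real (card Q)"
proof -
  have fQ: "finite Q" using R Q by (rule finite_subset[rotated])
  show "support_fun R (coord_norm Q)"
    unfolding support_fun_def
  proof (intro conjI allI)
    have "(\<lambda>x. x r) \<in> borel_measurable (gauss R)" if "r \<in> Q" for r using that Q by auto
    then show "coord_norm Q \<in> borel_measurable (gauss R)" unfolding coord_norm_def[abs_def] by measurable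
    fix x :: "'a \<Rightarrow> real"
    define c where "c = coord_norm Q x"
    \<comment> \<open>For \<open>c = 0\<close> the quotient is 0 by convention, and the zero vector
      is a valid subgradient there; the identity \<open>c\<^sup>2 / c = c\<close> used below also
      holds in that case.\<close>
    define s where "s = (\<lambda>r. if r \<in> Q then x r / c else 0)"
    have c2: "(\<Sum>r\<in>Q. (x r)\<^sup>2) = c\<^sup>2" by (simp add: c_def coord_norm_def sum_nonneg)
    have sR: "ip R s y = (\<Sum>r\<in>Q. (x r / c) * y r)" for y
    proof -
      have "ip R s y = ip Q s y" using R Q by (intro sum.mono_neutral_right) (auto simp: s_def)
      then show ?thesis by (simp add: s_def)
    qed
    have s2: "(\<Sum>r\<in>R. (s r)\<^sup>2) = (\<Sum>r\<in>Q. (x r / c)\<^sup>2)"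
    proof -
      have "(\<Sum>r\<in>R. (s r)\<^sup>2) = (\<Sum>r\<in>Q. (s r)\<^sup>2)" using R Q by (intro sum.mono_neutral_right) (auto simp: s_def)
      then show ?thesis by (simp add: s_def)
    qed
    have s1: "(\<Sum>r\<in>Q. (x r / c)\<^sup>2) \<le> 1"
      by (cases "c = 0") (auto simp: power_divide sum_divide_distrib[symmetric] c2)
    show "\<exists>s. (\<Sum>r\<in>R. (s r)\<^sup>2) \<le> 1 \<and> coord_norm Q x = ip R s x \<and> (\<forall>y. ip R s y \<le> coord_norm Q y)"
    proof (intro exI[of _ s] conjI allI)
      show "(\<Sum>r\<in>R. (s r)\<^sup>2) \<le> 1" unfolding s2 by (rule s1)
      have "ip R s x = (\<Sum>r\<in>Q. (x r)\<^sup>2) / c" unfolding sR by (simp add: sum_divide_distrib power2_eq_square)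
      also have "\<dots> = c" unfolding c2 by (simp add: power2_eq_square)
      finally show "coord_norm Q x = ip R s x" by (simp add: c_def)
      fix y
      have "ip R s y \<le> sqrt (\<Sum>r\<in>Q. (x r / c)\<^sup>2) * coord_norm Q y" unfolding sR by (rule coord_norm_cs)
      also have "\<dots> \<le> 1 * coord_norm Q y" using s1 by (intro mult_right_mono coord_norm_nonneg) simp
      finally show "ip R s y \<le> coord_norm Q y" by simp
    qed
  qed
  have "(\<integral>x. (coord_norm Q x)\<^sup>2 \<partial>gauss R) = (\<integral>x. (\<Sum>r\<in>Q. x r * x r) \<partial>gauss R)"
    by (simp add: coord_norm_def sum_nonneg power2_eq_square)
  also have "\<dots> = (\<Sum>r\<in>Q. \<integral>x. x r * x r \<partial>gauss R)"
    using gauss_cov(1)[OF R] Q by (intro Bochner_Integration.integral_sum) blast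
  also have "\<dots> = (\<Sum>r\<in>Q. 1)" using gauss_cov(2)[OF R] Q by (intro sum.cong refl) (simp add: subset_iff)
  finally show "(\<integral>x. (coord_norm Q x)\<^sup>2 \<partial>gauss R) = real (card Q)" by simp
qed

section \<open>The section of the image of the cone\<close>

abbreviation (input) slice :: "nat \<Rightarrow> nat \<Rightarrow> nat \<Rightarrow> nat \<Rightarrow> (nat \<times> nat \<Rightarrow> real) \<Rightarrow> (nat \<Rightarrow> real) set \<Rightarrow> (nat \<Rightarrow> real) set" where
  "slice k l m n G K \<equiv> proj_first k ` (Lsub m l \<inter> GK m n G K)"

lemma in_slice:
  "y \<in> slice k l m n G K \<longleftrightarrow> (\<exists>\<mu>\<in>cone_ball n K. (\<forall>i\<in>{l..<m}. matvec m n G \<mu> i = 0) \<and> y = proj_first k (matvec m n G \<mu>))"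
proof -
  have "matvec m n G \<mu> \<in> Rn m" for \<mu> by (auto simp: Rn_def matvec_def)
  then have "matvec m n G \<mu> \<in> Lsub m l \<longleftrightarrow> (\<forall>i\<in>{l..<m}. matvec m n G \<mu> i = 0)" for \<mu>
    by (auto simp: Lsub_def)
  moreover have "y \<in> slice k l m n G K \<longleftrightarrow> (\<exists>\<mu>\<in>cone_ball n K. matvec m n G \<mu> \<in> Lsub m l \<and> y = proj_first k (matvec m n G \<mu>))"
    unfolding GK_def by blast
  ultimately show ?thesis by simp
qed

lemma sqnorm_proj_first: "sqnorm k (proj_first k z) = sqnorm k z"
  by (simp add: sqnorm_def proj_first_def)

lemma bilin_matvec: "bilin m n G w \<mu> = (\<Sum>i<m. w i * matvec m n G \<mu> i)"
  unfolding bilin_def matvec_def by (intro sum.cong refl) (simp add: sum_distrib_left mult_ac)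

lemma scale_ballk:
  assumes "a > 0"
  shows "scale_set a (ballk k r) = ballk k (a * r)"
proof
  have n: "sqrt (sqnorm k (\<lambda>i. a * x i)) = a * sqrt (sqnorm k x)" for x
    unfolding sqnorm_scale using assms by (simp add: real_sqrt_mult)
  show "scale_set a (ballk k r) \<subseteq> ballk k (a * r)"
    using assms by (auto simp: scale_set_def ballk_def Rn_def n)
  show "ballk k (a * r) \<subseteq> scale_set a (ballk k r)"
  proof
    fix y assume y: "y \<in> ballk k (a * r)"
    define x where "x = (\<lambda>i. y i / a)"
    have yx: "y = (\<lambda>i. a * x i)" using assms by (simp add: x_def)
    have "a * sqrt (sqnorm k x) \<le> a * r" using y n[of x] by (simp add: ballk_def yx[symmetric])
    then have "x \<in> ballk k r" using y assms by (auto simp: ballk_def Rn_def x_def)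
    then show "y \<in> scale_set a (ballk k r)" unfolding scale_set_def yx by blast
  qed
qed

lemma cone_ball_coord:
  assumes "\<mu> \<in> cone_ball n K" "i < n"
  shows "\<bar>\<mu> i\<bar> \<le> 1"
proof -
  have "(\<mu> i)\<^sup>2 \<le> 1" using coord_le_sqnorm[OF assms(2), of \<mu>] assms(1) by (simp add: cone_ball_def)
  then show ?thesis by (simp add: abs_square_le_1)
qed

lemma compact_cone_ball:
  assumes K: "nontrivial_closed_convex_cone n K"
  shows "compact (cone_ball n K)"
proof (rule compact_Rn_bounded)
  have "cone_ball n K = K \<inter> {\<mu>. sqnorm n \<mu> \<le> 1}" by (auto simp: cone_ball_def)
  moreover have "closed {\<mu>. sqnorm n \<mu> \<le> 1}"
    by (intro closed_Collect_le continuous_sqnorm continuous_on_const continuous_on_id)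
  ultimately show "closed (cone_ball n K)" using coneD(3)[OF K] by (simp add: closed_Int)
  show "cone_ball n K \<subseteq> Rn n" using coneD(1)[OF K] by (auto simp: cone_ball_def)
qed (rule cone_ball_coord)

lemma zero_in_cone_ball:
  assumes K: "nontrivial_closed_convex_cone n K"
  shows "(\<lambda>_. 0) \<in> cone_ball n K"
  using coneD(2)[OF K] by (simp add: cone_ball_def sqnorm_def)

lemma cone_ball_convex:
  assumes K: "nontrivial_closed_convex_cone n K" and x: "x \<in> cone_ball n K" and y: "y \<in> cone_ball n K"
    and t: "0 \<le> t" "t \<le> 1"
  shows "(\<lambda>i. (1 - t) * x i + t * y i) \<in> cone_ball n K"
proof -
  have "sqnorm n (\<lambda>i. (1 - t) * x i + t * y i) \<le> (1 - t) * sqnorm n x + t * sqnorm n y"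
    unfolding sqnorm_def sum_distrib_left sum.distrib[symmetric]
  proof (rule sum_mono)
    fix i
    have "((1 - t) * x i + t * y i)\<^sup>2 + (1 - t) * t * (x i - y i)\<^sup>2 = (1 - t) * (x i)\<^sup>2 + t * (y i)\<^sup>2"
      by (simp add: power2_eq_square algebra_simps)
    moreover have "(1 - t) * t * (x i - y i)\<^sup>2 \<ge> 0" using t by simp
    ultimately show "((1 - t) * x i + t * y i)\<^sup>2 \<le> (1 - t) * (x i)\<^sup>2 + t * (y i)\<^sup>2" by linarith
  qed
  also have "\<dots> \<le> (1 - t) * 1 + t * 1"
    using x y t by (intro add_mono mult_left_mono) (auto simp: cone_ball_def)
  finally show ?thesis using cone_convex[OF K _ _ t] x y by (simp add: cone_ball_def)
qed

lemma matvec_continuous: "continuous_on S (\<lambda>\<mu>. matvec m n G \<mu> i)"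
  unfolding matvec_def by (cases "i < m") (auto intro!: continuous_on_sum continuous_on_mult continuous_on_const continuous_coord)

lemma matvec_measurable[measurable]: "(\<lambda>G. matvec m n G \<mu> i) \<in> borel_measurable (gauss_mat m n)"
proof (cases "i < m")
  case True
  have [measurable]: "(\<lambda>G. G (i, j)) \<in> borel_measurable (gauss_mat m n)" if "j < n" for j
    unfolding gauss_mat_def using True that
      measurable_component_singleton[of "(i, j)" "{..<m} \<times> {..<n}" "\<lambda>_. N01"] by simp
  show ?thesis unfolding matvec_def using True by simp
qed (simp add: matvec_def)

section \<open>Measurability of the inclusion events\<close>

text \<open>By compactness the minimum is attained, so it is at most 0 as soon as every positive
  level is undercut on a dense sequence. This is a countable condition.\<close>

lemma measurable_exists_compact:
  fixes C :: "'a::{metric_space, second_countable_topology} set" and \<Phi> :: "'b \<Rightarrow> 'a \<Rightarrow> real"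
  assumes C: "compact C" "C \<noteq> {}" and cont: "\<And>G. continuous_on UNIV (\<Phi> G)"
    and meas: "\<And>\<mu>. (\<lambda>G. \<Phi> G \<mu>) \<in> borel_measurable M"
  shows "{G \<in> space M. \<exists>\<mu>\<in>C. \<Phi> G \<mu> \<le> 0} \<in> sets M"
proof -
  obtain s where s: "\<And>i. s i \<in> C" "\<And>U x. open U \<Longrightarrow> x \<in> C \<Longrightarrow> x \<in> U \<Longrightarrow> \<exists>i. (s :: nat \<Rightarrow> 'a) i \<in> U"
    by (rule dense_sequence[OF C(2)]) (rule that)
  have eq: "(\<exists>\<mu>\<in>C. \<Phi> G \<mu> \<le> 0) \<longleftrightarrow> (\<forall>q::nat. \<exists>i. \<Phi> G (s i) < 1 / real (Suc q))" for G
  proof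
    assume "\<exists>\<mu>\<in>C. \<Phi> G \<mu> \<le> 0"
    then obtain \<mu> where \<mu>: "\<mu> \<in> C" "\<Phi> G \<mu> \<le> 0" by blast
    show "\<forall>q::nat. \<exists>i. \<Phi> G (s i) < 1 / real (Suc q)"
    proof
      fix q :: nat
      have "open {\<mu>. \<Phi> G \<mu> < 1 / real (Suc q)}" by (intro open_Collect_less cont continuous_on_const)
      moreover have "\<mu> \<in> {\<mu>. \<Phi> G \<mu> < 1 / real (Suc q)}" using le_less_trans[OF \<mu>(2), of "1 / real (Suc q)"] by simp
      ultimately show "\<exists>i. \<Phi> G (s i) < 1 / real (Suc q)" using s(2)[OF _ \<mu>(1)] by blast
    qed
  next
    assume ex: "\<forall>q::nat. \<exists>i. \<Phi> G (s i) < 1 / real (Suc q)"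
    obtain \<mu> where \<mu>: "\<mu> \<in> C" "\<And>y. y \<in> C \<Longrightarrow> \<Phi> G \<mu> \<le> \<Phi> G y"
      using continuous_attains_inf[OF C continuous_on_subset[OF cont]] by blast
    have "\<Phi> G \<mu> \<le> 0"
    proof (rule ccontr)
      assume "\<not> \<Phi> G \<mu> \<le> 0"
      then obtain q where "1 / real (Suc q) < \<Phi> G \<mu>"
        using nat_approx_posE[of "\<Phi> G \<mu>"] by (metis not_le)
      moreover obtain i where "\<Phi> G (s i) < 1 / real (Suc q)" using ex by blast
      ultimately show False using \<mu>(2)[OF s(1)[of i]] by linarith
    qed
    then show "\<exists>\<mu>\<in>C. \<Phi> G \<mu> \<le> 0" using \<mu>(1) by blast
  qed
  show ?thesis unfolding eq using meas by measurable
qed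

text \<open>Since \<open>measure\<close> is 0 on nonmeasurable sets, a bound on the failure events
  yields nothing for the event itself unless measurability is known. The first inclusion is tested
  on a dense sequence of the ball; the second is negated and exhausted by countably many closed
  conditions.\<close>

lemma slice_event_measurable:
  assumes K: "nontrivial_closed_convex_cone n K"
  shows "{G \<in> space (gauss_mat m n). ballk k r \<subseteq> slice k l m n G K} \<in> sets (gauss_mat m n)"
    and "{G \<in> space (gauss_mat m n). slice k l m n G K \<subseteq> ballk k R} \<in> sets (gauss_mat m n)"
proof -
  let ?M = "gauss_mat m n"
  \<comment> \<open>Nonnegative, and 0 exactly when \<open>\<mu>\<close> satisfies the constraint
    and is mapped to the point \<open>y\<close> of \<open>Rn k\<close>.\<close>
  define \<Phi> where "\<Phi> = (\<lambda>y G \<mu>. (\<Sum>i<k. \<bar>matvec m n G \<mu> i - y i\<bar>) + (\<Sum>i\<in>{l..<m}. \<bar>matvec m n G \<mu> i\<bar>))"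
  have \<Phi>c: "continuous_on S (\<Phi> y G)" for S y G
    unfolding \<Phi>_def by (intro continuous_on_add continuous_on_sum continuous_on_rabs continuous_on_diff matvec_continuous continuous_on_const)
  have \<Phi>m: "(\<lambda>G. \<Phi> y G \<mu>) \<in> borel_measurable ?M" for y \<mu> unfolding \<Phi>_def by measurable
  have CB: "compact (cone_ball n K)" "cone_ball n K \<noteq> {}" using compact_cone_ball[OF K] zero_in_cone_ball[OF K] by auto
  have sl: "y \<in> slice k l m n G K \<longleftrightarrow> (\<exists>\<mu>\<in>cone_ball n K. \<Phi> y G \<mu> \<le> 0)" if y: "y \<in> Rn k" for y G
  proof -
    have "\<Phi> y G \<mu> \<le> 0 \<longleftrightarrow> (\<forall>i\<in>{l..<m}. matvec m n G \<mu> i = 0) \<and> y = proj_first k (matvec m n G \<mu>)" for \<mu>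
    proof -
      have a: "(\<Sum>i<k. \<bar>matvec m n G \<mu> i - y i\<bar>) \<ge> 0" "(\<Sum>i\<in>{l..<m}. \<bar>matvec m n G \<mu> i\<bar>) \<ge> 0" by (auto intro: sum_nonneg)
      have "\<Phi> y G \<mu> \<le> 0 \<longleftrightarrow> (\<Sum>i<k. \<bar>matvec m n G \<mu> i - y i\<bar>) = 0 \<and> (\<Sum>i\<in>{l..<m}. \<bar>matvec m n G \<mu> i\<bar>) = 0"
        unfolding \<Phi>_def using a by linarith
      also have "\<dots> \<longleftrightarrow> (\<forall>i<k. matvec m n G \<mu> i = y i) \<and> (\<forall>i\<in>{l..<m}. matvec m n G \<mu> i = 0)"
        by (subst sum_nonneg_eq_0_iff, simp, simp)+ auto
      also have "(\<forall>i<k. matvec m n G \<mu> i = y i) \<longleftrightarrow> y = proj_first k (matvec m n G \<mu>)"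
        using y by (auto simp: proj_first_def Rn_def fun_eq_iff)
      finally show ?thesis by blast
    qed
    then show ?thesis unfolding in_slice by blast
  qed
  show "{G \<in> space ?M. ballk k r \<subseteq> slice k l m n G K} \<in> sets ?M"
  proof (cases "ballk k r = {}")
    case False
    obtain s where s: "\<And>i. s i \<in> ballk k r" "\<And>U x. open U \<Longrightarrow> x \<in> ballk k r \<Longrightarrow> x \<in> U \<Longrightarrow> \<exists>i. (s :: nat \<Rightarrow> nat \<Rightarrow> real) i \<in> U"
      by (rule dense_sequence[OF False]) (rule that)
    have bR: "y \<in> Rn k" if "y \<in> ballk k r" for y using that by (simp add: ballk_def)
    have "ballk k r \<subseteq> slice k l m n G K \<longleftrightarrow> (\<forall>j. \<exists>\<mu>\<in>cone_ball n K. \<Phi> (s j) G \<mu> \<le> 0)" for G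
    proof
      assume sub: "ballk k r \<subseteq> slice k l m n G K"
      show "\<forall>j. \<exists>\<mu>\<in>cone_ball n K. \<Phi> (s j) G \<mu> \<le> 0"
        using subsetD[OF sub s(1)] sl[OF bR[OF s(1)]] by blast
    next
      assume all: "\<forall>j. \<exists>\<mu>\<in>cone_ball n K. \<Phi> (s j) G \<mu> \<le> 0"
      show "ballk k r \<subseteq> slice k l m n G K"
      proof
        fix y assume y: "y \<in> ballk k r"
        obtain \<mu> where \<mu>: "\<mu> \<in> cone_ball n K" "\<And>\<nu>. \<nu> \<in> cone_ball n K \<Longrightarrow> \<Phi> y G \<mu> \<le> \<Phi> y G \<nu>"
          using continuous_attains_inf[OF CB \<Phi>c] by blast
        have "\<Phi> y G \<mu> \<le> 0"
        proof (rule ccontr)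
          assume "\<not> \<Phi> y G \<mu> \<le> 0"
          then have pos: "\<Phi> y G \<mu> > 0" by simp
          have "open {z. (\<Sum>i<k. \<bar>y i - z i\<bar>) < \<Phi> y G \<mu>}"
            by (intro open_Collect_less continuous_on_sum continuous_on_rabs continuous_on_diff continuous_on_const continuous_coord)
          from s(2)[OF this y] pos obtain j where j: "(\<Sum>i<k. \<bar>y i - s j i\<bar>) < \<Phi> y G \<mu>" by auto
          obtain \<nu> where \<nu>: "\<nu> \<in> cone_ball n K" "\<Phi> (s j) G \<nu> \<le> 0" using all by blast
          have "(\<Sum>i<k. \<bar>matvec m n G \<nu> i - y i\<bar>) \<le> (\<Sum>i<k. \<bar>matvec m n G \<nu> i - s j i\<bar> + \<bar>y i - s j i\<bar>)"
            by (intro sum_mono) linarith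
          then have "\<Phi> y G \<nu> \<le> \<Phi> (s j) G \<nu> + (\<Sum>i<k. \<bar>y i - s j i\<bar>)"
            unfolding \<Phi>_def by (simp add: sum.distrib)
          then show False using \<mu>(2)[OF \<nu>(1)] \<nu>(2) j by linarith
        qed
        then show "y \<in> slice k l m n G K" using sl[OF bR[OF y]] \<mu>(1) by blast
      qed
    qed
    then show ?thesis using measurable_exists_compact[OF CB \<Phi>c \<Phi>m] by (simp add: sets.sets_Collect_countable_All)
  qed simp
  \<comment> \<open>Both summands are nonnegative, so a zero encodes the constraint together with a
    weak inequality. The slack \<open>1 / real (Suc p)\<close> resolves the strict inequality for
    leaving the ball into countably many weak ones.\<close>
  define \<Psi> where "\<Psi> = (\<lambda>(p::nat) G \<mu>. (\<Sum>i\<in>{l..<m}. \<bar>matvec m n G \<mu> i\<bar>) + max 0 (R + 1 / real (Suc p) - sqrt (\<Sum>i<k. (matvec m n G \<mu> i)\<^sup>2)))"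
  have \<Psi>c: "continuous_on S (\<Psi> p G)" for S p G
    unfolding \<Psi>_def by (intro continuous_on_add continuous_on_sum continuous_on_rabs continuous_on_diff matvec_continuous
        continuous_on_const continuous_on_max continuous_on_real_sqrt continuous_on_power)
  have \<Psi>m: "(\<lambda>G. \<Psi> p G \<mu>) \<in> borel_measurable ?M" for p \<mu> unfolding \<Psi>_def by measurable
  have "\<not> slice k l m n G K \<subseteq> ballk k R \<longleftrightarrow> (\<exists>p. \<exists>\<mu>\<in>cone_ball n K. \<Psi> p G \<mu> \<le> 0)" for G
  proof -
    have nn: "(\<Sum>i\<in>{l..<m}. \<bar>matvec m n G \<mu> i\<bar>) \<ge> 0" for \<mu> by (auto intro: sum_nonneg)
    have z: "(\<Sum>i\<in>{l..<m}. \<bar>matvec m n G \<mu> i\<bar>) = 0 \<longleftrightarrow> (\<forall>i\<in>{l..<m}. matvec m n G \<mu> i = 0)" for \<mu>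
      by (subst sum_nonneg_eq_0_iff) auto
    have "\<not> slice k l m n G K \<subseteq> ballk k R \<longleftrightarrow> (\<exists>y\<in>slice k l m n G K. y \<notin> ballk k R)" by blast
    also have "\<dots> \<longleftrightarrow> (\<exists>\<mu>\<in>cone_ball n K. (\<forall>i\<in>{l..<m}. matvec m n G \<mu> i = 0) \<and> proj_first k (matvec m n G \<mu>) \<notin> ballk k R)"
      unfolding Bex_def in_slice by blast
    also have "\<dots> \<longleftrightarrow> (\<exists>\<mu>\<in>cone_ball n K. (\<forall>i\<in>{l..<m}. matvec m n G \<mu> i = 0) \<and> R < sqrt (\<Sum>i<k. (matvec m n G \<mu> i)\<^sup>2))"
    proof -
      have "proj_first k z \<notin> ballk k R \<longleftrightarrow> R < sqrt (\<Sum>i<k. (z i)\<^sup>2)" for z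
        using sqnorm_proj_first[of k z] by (auto simp: ballk_def Rn_def proj_first_def sqnorm_def)
      then show ?thesis by simp
    qed
    also have "\<dots> \<longleftrightarrow> (\<exists>\<mu>\<in>cone_ball n K. \<exists>p. \<Psi> p G \<mu> \<le> 0)"
    proof (intro bex_cong refl)
      fix \<mu>
      have "(\<exists>p::nat. R + 1 / real (Suc p) \<le> N) \<longleftrightarrow> R < N" for N
      proof
        assume "\<exists>p::nat. R + 1 / real (Suc p) \<le> N"
        then obtain p :: nat where "R + 1 / real (Suc p) \<le> N" by blast
        moreover have "1 / real (Suc p) > 0" by simp
        ultimately show "R < N" by linarith
      next
        assume "R < N"
        then obtain p where "1 / real (Suc p) < N - R" using nat_approx_posE[of "N - R"] by auto
        then show "\<exists>p::nat. R + 1 / real (Suc p) \<le> N" by (intro exI[of _ p]) linarith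
      qed
      moreover have "\<Psi> p G \<mu> \<le> 0 \<longleftrightarrow> (\<forall>i\<in>{l..<m}. matvec m n G \<mu> i = 0) \<and> R + 1 / real (Suc p) \<le> sqrt (\<Sum>i<k. (matvec m n G \<mu> i)\<^sup>2)" for p
        unfolding z[symmetric] \<Psi>_def using nn[of \<mu>] by linarith
      ultimately show "((\<forall>i\<in>{l..<m}. matvec m n G \<mu> i = 0) \<and> R < sqrt (\<Sum>i<k. (matvec m n G \<mu> i)\<^sup>2)) = (\<exists>p. \<Psi> p G \<mu> \<le> 0)"
        by blast
    qed
    finally show ?thesis by blast
  qed
  then have "{G \<in> space ?M. \<not> slice k l m n G K \<subseteq> ballk k R} \<in> sets ?M"
    using measurable_exists_compact[OF CB \<Psi>c \<Psi>m] by (simp add: sets.sets_Collect_countable_Ex)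
  then show "{G \<in> space ?M. slice k l m n G K \<subseteq> ballk k R} \<in> sets ?M"
    using sets.sets_Collect_neg by fastforce
qed

text \<open>Separating the point \<open>y0\<close> from the compact convex image of the cone under the rows \<open>i < k\<close> and
  \<open>l \<le> i < m\<close> handles the constraint \<open>x \<in> L\<close> and the projection at once; the components
  \<open>w i\<close> with \<open>l \<le> i\<close> act as Lagrange multipliers.\<close>
lemma slice_separation:
  assumes K: "nontrivial_closed_convex_cone n K" and kl: "k \<le> l" "l \<le> m"
    and nsub: "\<not> ballk k r \<subseteq> slice k l m n G K"
  obtains w \<eta> where "w \<in> Rn m" "\<And>i. k \<le> i \<Longrightarrow> i < l \<Longrightarrow> w i = 0" "sqnorm k w = 1" "\<eta> > 0"
    "\<And>\<mu>. \<mu> \<in> cone_sphere n K \<Longrightarrow> bilin m n G w \<mu> \<le> r - \<eta>"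
proof -
  obtain y0 where y0: "y0 \<in> Rn k" "sqrt (sqnorm k y0) \<le> r" "y0 \<notin> slice k l m n G K"
    using nsub by (auto simp: ballk_def)
  \<comment> \<open>Rows from \<open>k\<close> up to \<open>l\<close> are erased before separating:
    the constraint leaves them free and the projection forgets them. This is why \<open>w\<close>
    vanishes there.\<close>
  define h where "h = (\<lambda>\<mu> i. if i < k \<or> l \<le> i then matvec m n G \<mu> i else 0)"
  define C where "C = h ` cone_ball n K"
  have hc: "continuous_on S h" for S
  proof (rule continuous_on_coordinatewise_then_product)
    show "continuous_on S (\<lambda>\<mu>. h \<mu> i)" for i
      unfolding h_def by (cases "i < k \<or> l \<le> i") (auto intro: matvec_continuous)
  qed
  have "compact C" unfolding C_def by (rule compact_continuous_image[OF hc compact_cone_ball[OF K]])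
  then have C1: "closed C" by (rule compact_imp_closed)
  have C2: "C \<subseteq> Rn m" by (auto simp: C_def h_def Rn_def matvec_def)
  have h0: "h (\<lambda>_. 0) = (\<lambda>_. 0)" by (auto simp: h_def matvec_def)
  then have C0: "(\<lambda>_. 0) \<in> C" unfolding C_def using zero_in_cone_ball[OF K] by (metis imageI)
  have C3: "(\<lambda>i. (1 - t) * x i + t * y i) \<in> C" if xy: "x \<in> C" "y \<in> C" and t: "0 \<le> t" "t \<le> 1" for x y t
  proof -
    obtain \<mu> \<nu> where mn: "\<mu> \<in> cone_ball n K" "x = h \<mu>" "\<nu> \<in> cone_ball n K" "y = h \<nu>" using xy by (auto simp: C_def)
    have "(\<lambda>i. (1 - t) * x i + t * y i) = h (\<lambda>i. (1 - t) * \<mu> i + t * \<nu> i)"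
      unfolding mn h_def matvec_def by (auto simp: fun_eq_iff sum_distrib_left sum.distrib[symmetric] algebra_simps)
    then show ?thesis unfolding C_def using cone_ball_convex[OF K mn(1,3) t] by blast
  qed
  obtain c where c: "c \<in> C" "\<And>y. y \<in> C \<Longrightarrow> sqnorm m (\<lambda>i. y0 i - c i) \<le> sqnorm m (\<lambda>i. y0 i - y i)"
    "\<And>y. y \<in> C \<Longrightarrow> (\<Sum>i<m. (y0 i - c i) * (y i - c i)) \<le> 0"
    by (rule closest_point_Rn[OF C1 C2 C0 C3, of y0]) (assumption+, rule that)
  have km: "k \<le> m" using kl by simp
  have y0m: "y0 \<in> Rn m" using y0(1) km by (auto simp: Rn_def)
  have y0C: "y0 \<notin> C"
  proof
    assume "y0 \<in> C"
    then obtain \<mu> where \<mu>: "\<mu> \<in> cone_ball n K" "y0 = h \<mu>" by (auto simp: C_def)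
    have "y0 i = 0" if "i \<ge> k" for i using y0(1) that by (simp add: Rn_def)
    then have "matvec m n G \<mu> i = 0" if "i \<in> {l..<m}" for i
      using fun_cong[OF \<mu>(2), of i] that kl by (simp add: h_def)
    moreover have "y0 = proj_first k (matvec m n G \<mu>)"
      using \<mu>(2) y0(1) by (auto simp: proj_first_def h_def Rn_def fun_eq_iff)
    ultimately show False using y0(3) \<mu>(1) unfolding in_slice by blast
  qed
  define d where "d = (\<lambda>i. y0 i - c i)"
  have dR: "d i = 0" if "i \<ge> m" for i using that y0m C2 c(1) by (auto simp: d_def Rn_def subset_iff)
  have dmid: "d i = 0" if "k \<le> i" "i < l" for i
  proof -
    have "c i = 0" using c(1) that by (auto simp: C_def h_def)
    then show ?thesis using y0(1) that by (simp add: d_def Rn_def)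
  qed
  have d2: "sqnorm m d > 0"
  proof (rule ccontr)
    assume "\<not> sqnorm m d > 0"
    then have "(d i)\<^sup>2 \<le> 0" if "i < m" for i using coord_le_sqnorm[OF that, of d] by linarith
    then have "d i = 0" for i using dR[of i] by (cases "i < m") auto
    then have "y0 = c" by (auto simp: d_def fun_eq_iff)
    then show False using c(1) y0C by simp
  qed
  have ub: "(\<Sum>i<m. d i * z i) \<le> (\<Sum>i<m. d i * y0 i) - sqnorm m d" if "z \<in> C" for z
  proof -
    have "(\<Sum>i<m. d i * (z i - c i)) = (\<Sum>i<m. d i * z i) - ((\<Sum>i<m. d i * y0 i) - sqnorm m d)"
      unfolding sqnorm_def sum_subtractf[symmetric]
      by (intro sum.cong refl) (simp add: d_def power2_eq_square algebra_simps)
    then show ?thesis using c(3)[OF that] by (simp add: d_def)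
  qed
  have dy: "(\<Sum>i<m. d i * y0 i) = (\<Sum>i<k. d i * y0 i)"
    using y0(1) km by (intro sum.mono_neutral_right) (auto simp: Rn_def)
  define a where "a = sqrt (sqnorm k d)"
  have dy_le: "(\<Sum>i<k. d i * y0 i) \<le> a * r"
  proof -
    have "(\<Sum>i<k. d i * y0 i) \<le> a * sqrt (sqnorm k y0)" unfolding a_def by (rule cauchy_schwarz_sqnorm)
    also have "\<dots> \<le> a * r" using y0(2) by (intro mult_left_mono) (auto simp: a_def sqnorm_nonneg)
    finally show ?thesis .
  qed
  \<comment> \<open>If the first \<open>k\<close> entries of the separating direction vanished, it
    could not distinguish \<open>y0\<close> from the point 0, which belongs to
    \<open>C\<close>.\<close>
  have a: "a > 0"
  proof (rule ccontr)
    assume "\<not> a > 0"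
    moreover have "a \<ge> 0" by (simp add: a_def sqnorm_nonneg)
    ultimately have "a = 0" by simp
    then have "(\<Sum>i<k. d i * y0 i) \<le> 0" using dy_le by simp
    then show False using ub[OF C0] d2 dy by simp
  qed
  define w where "w = (\<lambda>i. (1 / a) * d i)"
  show ?thesis
  \<comment> \<open>The margin comes from the squared distance of \<open>y0\<close> to
    \<open>C\<close>, divided by the normalisation \<open>a\<close>. Its strict positivity pays for
    replacing \<open>w\<close> by a member of a dense sequence.\<close>
  proof (rule that[of w "sqnorm m d / a"])
    show "w \<in> Rn m" using dR by (simp add: w_def Rn_def)
    show "w i = 0" if "k \<le> i" "i < l" for i using dmid[OF that] by (simp add: w_def)
    have "sqnorm k d = a\<^sup>2" by (simp add: a_def sqnorm_nonneg)
    then show "sqnorm k w = 1" unfolding w_def sqnorm_scale using a by (simp add: power_divide)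
    show "sqnorm m d / a > 0" using a d2 by simp
    fix \<mu> assume "\<mu> \<in> cone_sphere n K"
    then have "h \<mu> \<in> C" unfolding C_def by (intro imageI) (simp add: cone_ball_def)
    have "bilin m n G w \<mu> = (\<Sum>i<m. w i * h \<mu> i)"
      unfolding bilin_matvec
      by (intro sum.cong refl) (use dmid in \<open>auto simp: h_def w_def not_less not_le\<close>)
    also have "\<dots> = (1 / a) * (\<Sum>i<m. d i * h \<mu> i)" by (simp add: w_def sum_distrib_left)
    also have "\<dots> \<le> (1 / a) * (a * r - sqnorm m d)"
      using ub[OF \<open>h \<mu> \<in> C\<close>] dy dy_le a by (intro mult_left_mono) auto
    also have "\<dots> = r - sqnorm m d / a" using a by (simp add: field_simps)
    finally show "bilin m n G w \<mu> \<le> r - sqnorm m d / a" .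
  qed
qed

text \<open>Normalising the escaping point and its preimage gives \<open>u\<close> and
  \<open>\<mu>\<close>. The image vanishes in the rows from \<open>l\<close> on, so \<open>v\<close>
  has no effect, and since the preimage has norm at most 1, normalising it can only increase the
  value.\<close>

lemma slice_escape:
  assumes K: "nontrivial_closed_convex_cone n K" and kl: "k \<le> l" "l \<le> m" and R: "R \<ge> 0"
    and nsub: "\<not> slice k l m n G K \<subseteq> ballk k R"
  obtains u \<mu> where "u \<in> Rn k" "sqnorm k u = 1" "\<mu> \<in> cone_sphere n K"
    "\<forall>v. (\<forall>i<l. v i = 0) \<longrightarrow> bilin m n G (\<lambda>i. u i + v i) \<mu> > R"
proof -
  obtain y where y: "y \<in> slice k l m n G K" "y \<notin> ballk k R" using nsub by blast
  then obtain \<nu> where \<nu>: "\<nu> \<in> cone_ball n K" "\<And>i. i \<in> {l..<m} \<Longrightarrow> matvec m n G \<nu> i = 0" "y = proj_first k (matvec m n G \<nu>)"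
    unfolding in_slice by blast
  have yk: "y \<in> Rn k" using \<nu>(3) by (simp add: proj_first_def Rn_def)
  define b where "b = sqrt (sqnorm k y)"
  have bR: "b > R" using y(2) yk by (simp add: ballk_def b_def)
  then have b: "b > 0" using R by simp
  have b2: "sqnorm k y = b\<^sup>2" by (simp add: b_def sqnorm_nonneg)
  define a where "a = sqrt (sqnorm n \<nu>)"
  have a2: "sqnorm n \<nu> = a\<^sup>2" by (simp add: a_def sqnorm_nonneg)
  have a1: "a \<le> 1" using \<nu>(1) by (simp add: a_def cone_ball_def)
  have a: "a > 0"
  proof (rule ccontr)
    assume "\<not> a > 0"
    moreover have "a \<ge> 0" by (simp add: a_def sqnorm_nonneg)
    ultimately have "sqnorm n \<nu> = 0" using a2 by simp
    then have "(\<nu> j)\<^sup>2 \<le> 0" if "j < n" for j using coord_le_sqnorm[OF that, of \<nu>] by linarith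
    then have "matvec m n G \<nu> i = 0" for i by (auto simp: matvec_def intro!: sum.neutral)
    then have "sqnorm k y = 0" using \<nu>(3) by (simp add: proj_first_def sqnorm_def)
    then show False using b b2 by simp
  qed
  define u where "u = (\<lambda>i. (1 / b) * y i)"
  define \<mu> where "\<mu> = (\<lambda>i. (1 / a) * \<nu> i)"
  show ?thesis
  proof (rule that[of u \<mu>])
    show "u \<in> Rn k" using yk by (simp add: u_def Rn_def)
    show "sqnorm k u = 1" unfolding u_def sqnorm_scale b2 using b by (simp add: power_divide)
    have "sqnorm n \<mu> = 1" unfolding \<mu>_def sqnorm_scale a2 using a by (simp add: power_divide)
    moreover have "\<mu> \<in> K" unfolding \<mu>_def using \<nu>(1) a by (intro coneD(4)[OF K]) (auto simp: cone_ball_def)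
    ultimately show "\<mu> \<in> cone_sphere n K" by blast
    show "\<forall>v. (\<forall>i<l. v i = 0) \<longrightarrow> bilin m n G (\<lambda>i. u i + v i) \<mu> > R"
    proof (intro allI impI)
      fix v :: "nat \<Rightarrow> real" assume v: "\<forall>i<l. v i = 0"
      have mv: "matvec m n G \<mu> i = (1 / a) * matvec m n G \<nu> i" for i
        unfolding matvec_def \<mu>_def by (simp add: sum_divide_distrib mult_ac)
      have "bilin m n G (\<lambda>i. u i + v i) \<mu> = (\<Sum>i<m. u i * ((1 / a) * matvec m n G \<nu> i))"
        unfolding bilin_matvec mv
      proof (intro sum.cong refl)
        fix i assume "i \<in> {..<m}"
        then show "(u i + v i) * ((1 / a) * matvec m n G \<nu> i) = u i * ((1 / a) * matvec m n G \<nu> i)"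
          using v \<nu>(2)[of i] by (cases "i < l") auto
      qed
      also have "\<dots> = (\<Sum>i<k. u i * ((1 / a) * matvec m n G \<nu> i))"
        using \<open>u \<in> Rn k\<close> kl by (intro sum.mono_neutral_right) (auto simp: Rn_def)
      also have "\<dots> = (\<Sum>i<k. (1 / (a * b)) * (y i)\<^sup>2)"
        by (intro sum.cong refl) (simp add: u_def \<nu>(3) proj_first_def power2_eq_square)
      also have "\<dots> = (1 / (a * b)) * b\<^sup>2" unfolding sum_distrib_left[symmetric] b2[symmetric] by (simp add: sqnorm_def)
      also have "\<dots> = b / a" using b by (simp add: power2_eq_square)
      also have "\<dots> \<ge> b" using a a1 b by (simp add: le_divide_eq mult_left_le)
      finally show "bilin m n G (\<lambda>i. u i + v i) \<mu> > R" using bR by linarith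
    qed
  qed
qed

section \<open>Failure of the inclusions\<close>

lemma sum_split_gap:
  fixes f :: "nat \<Rightarrow> real"
  assumes "k \<le> l" "l \<le> m" and "\<And>i. k \<le> i \<Longrightarrow> i < l \<Longrightarrow> f i = 0"
  shows "(\<Sum>i<m. f i) = (\<Sum>i<k. f i) + (\<Sum>i\<in>{l..<m}. f i)"
proof -
  have "(\<Sum>i<m. f i) = (\<Sum>i\<in>{..<k} \<union> {l..<m}. f i)"
    using assms(1,2) by (intro sum.mono_neutral_right) (auto, metis assms(3) not_le)
  also have "\<dots> = (\<Sum>i<k. f i) + (\<Sum>i\<in>{l..<m}. f i)"
    using assms by (intro sum.union_disjoint) auto
  finally show ?thesis .
qed

lemma column_cs:
  "(\<Sum>i\<in>I. w i * x (i, n)) \<le> sqrt (\<Sum>i\<in>I. (w i)\<^sup>2) * coord_norm (I \<times> {n}) x"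
  "- (sqrt (\<Sum>i\<in>I. (w i)\<^sup>2) * coord_norm (I \<times> {n}) x) \<le> (\<Sum>i\<in>I. w i * x (i, n))"
proof -
  have le: "(\<Sum>i\<in>I. w i * x (i, n)) \<le> sqrt (\<Sum>i\<in>I. (w i)\<^sup>2) * coord_norm (I \<times> {n}) x" for w
    using coord_norm_cs[of "\<lambda>r. w (fst r)" x "I \<times> {n}"] by (simp add: sum.cartesian_product')
  show "(\<Sum>i\<in>I. w i * x (i, n)) \<le> sqrt (\<Sum>i\<in>I. (w i)\<^sup>2) * coord_norm (I \<times> {n}) x" by (rule le)
  show "- (sqrt (\<Sum>i\<in>I. (w i)\<^sup>2) * coord_norm (I \<times> {n}) x) \<le> (\<Sum>i\<in>I. w i * x (i, n))"
    using le[of "\<lambda>i. - w i"] by (simp add: sum_negf)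
qed

text \<open>\<open>sqrt (a\<^sup>2 - h\<^sup>2)\<close> is the minimum of \<open>t \<mapsto> sqrt (1 + t\<^sup>2) * a - t * h\<close>.\<close>
lemma hyperbola_min:
  fixes a h t :: real
  assumes "0 \<le> h" "h < a"
  shows "sqrt (a\<^sup>2 - h\<^sup>2) \<le> sqrt (1 + t\<^sup>2) * a - t * h"
proof -
  define s where "s = sqrt (a\<^sup>2 - h\<^sup>2)"
  have "h\<^sup>2 \<le> a\<^sup>2" using assms by (intro power_mono) auto
  then have a2: "a\<^sup>2 = s\<^sup>2 + h\<^sup>2" by (simp add: s_def)
  have "(s + t * h)\<^sup>2 + (t * s - h)\<^sup>2 = (1 + t\<^sup>2) * (s\<^sup>2 + h\<^sup>2)"
    by (simp add: power2_eq_square algebra_simps)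
  moreover have "0 \<le> (t * s - h)\<^sup>2" by simp
  ultimately have "(s + t * h)\<^sup>2 \<le> (1 + t\<^sup>2) * a\<^sup>2" unfolding a2 by linarith
  also have "\<dots> = (sqrt (1 + t\<^sup>2) * a)\<^sup>2" by (simp add: power_mult_distrib)
  finally have "s + t * h \<le> sqrt (1 + t\<^sup>2) * a"
    by (rule power2_le_imp_le) (use assms in simp)
  then show ?thesis by (simp add: s_def)
qed

text \<open>Sufficient for the optimum of the decoupled field to lie strictly between
  \<open>r\<close> and \<open>R\<close>. The inequalities are strict so that the condition is open
  and optimisers can be replaced by members of a dense sequence.\<close>

definition concentrated :: "nat \<Rightarrow> nat \<Rightarrow> nat \<Rightarrow> nat \<Rightarrow> (nat \<Rightarrow> real) set \<Rightarrow> real \<Rightarrow> real \<Rightarrow> (nat \<times> nat \<Rightarrow> real) \<Rightarrow> bool" where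
  "concentrated k l m n K r R x \<longleftrightarrow>
    (let A = cone_norm n K (\<lambda>j. x (m, j)); h = coord_norm ({l..<m} \<times> {n}) x; h' = coord_norm ({..<k} \<times> {n}) x
     in h < A \<and> r < sqrt (A\<^sup>2 - h\<^sup>2) - h' \<and> sqrt (A\<^sup>2 - h\<^sup>2) + h' < R)"

lemma coord_norm_measurable:
  assumes "finite R" "Q \<subseteq> R"
  shows "coord_norm Q \<in> borel_measurable (gauss R)"
  by (rule support_fun_measurable[OF support_fun_coord_norm(1)[OF assms]])

lemma concentrated_measurable:
  assumes K: "nontrivial_closed_convex_cone n K" and km: "k \<le> m"
  shows "{x \<in> space (gauss (array m n)). \<not> concentrated k l m n K r R x} \<in> sets (gauss (array m n))"
proof -
  have [measurable]: "(\<lambda>x. cone_norm n K (\<lambda>j. x (m, j))) \<in> borel_measurable (gauss (array m n))"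
    by (rule support_fun_measurable[OF support_fun_cone_norm[OF K]])
  have [measurable]: "coord_norm ({l..<m} \<times> {n}) \<in> borel_measurable (gauss (array m n))"
    "coord_norm ({..<k} \<times> {n}) \<in> borel_measurable (gauss (array m n))"
    using km by (auto intro!: coord_norm_measurable)
  show ?thesis unfolding concentrated_def Let_def by measurable
qed

text \<open>A Lipschitz bound in \<open>w\<close>, uniform over unit \<open>\<mu>\<close>, so that
  one approximant of the separating direction serves all \<open>\<mu>\<close> at once.\<close>

lemma bilin_perturb:
  assumes "\<mu> \<in> cone_sphere n K"
  shows "bilin m n G w' \<mu> \<le> bilin m n G w \<mu> + (\<Sum>i<m. \<bar>w i - w' i\<bar> * (\<Sum>j<n. \<bar>G (i, j)\<bar>))"
proof -
  have \<mu>: "\<bar>\<mu> j\<bar> \<le> 1" if "j < n" for j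
    using assms that by (intro cone_ball_coord[of _ n K]) (auto simp: cone_ball_def)
  have "bilin m n G w' \<mu> - bilin m n G w \<mu> = (\<Sum>i<m. \<Sum>j<n. (w' i - w i) * (\<mu> j * G (i, j)))"
    unfolding bilin_def sum_subtractf[symmetric] by (intro sum.cong refl) (simp add: algebra_simps)
  also have "\<dots> \<le> (\<Sum>i<m. \<Sum>j<n. \<bar>w i - w' i\<bar> * \<bar>G (i, j)\<bar>)"
  proof (intro sum_mono)
    fix i j assume j: "j \<in> {..<n}"
    have "(w' i - w i) * (\<mu> j * G (i, j)) \<le> \<bar>w' i - w i\<bar> * (\<bar>\<mu> j\<bar> * \<bar>G (i, j)\<bar>)"
      unfolding abs_mult[symmetric] by (rule abs_ge_self)
    also have "\<dots> \<le> \<bar>w' i - w i\<bar> * (1 * \<bar>G (i, j)\<bar>)"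
      using \<mu> j by (intro mult_left_mono mult_right_mono) auto
    finally show "(w' i - w i) * (\<mu> j * G (i, j)) \<le> \<bar>w i - w' i\<bar> * \<bar>G (i, j)\<bar>"
      by (simp add: abs_minus_commute)
  qed
  finally show ?thesis by (simp add: sum_distrib_left)
qed

text \<open>Failure provides a direction \<open>w\<close> along which every \<open>\<mu>\<close>
  gives a value below \<open>r\<close>, hence \<open>w\<close> is the outer index and
  \<open>\<mu>\<close> the inner one. On the decoupled side a single \<open>\<mu>\<close> that
  nearly maximises \<open>ga \<mu> x\<close> exceeds \<open>r\<close> against every
  \<open>w\<close>; this is what \<open>q\<close> expresses.\<close>

lemma lower_inclusion_failure:
  assumes K: "nontrivial_closed_convex_cone n K" and kl: "1 \<le> k" "k \<le> l" "l \<le> m"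
  shows "measure (gauss_mat m n) {G \<in> space (gauss_mat m n). \<not> ballk k r \<subseteq> slice k l m n G K}
    \<le> 2 * measure (gauss (array m n)) {x \<in> space (gauss (array m n)). \<not> concentrated k l m n K r R x}"
proof -
  let ?P = "gauss (array m n)"
  interpret P: prob_space ?P by (rule prob_space_gauss)
  define W where "W = {w \<in> Rn m. (\<forall>i. k \<le> i \<and> i < l \<longrightarrow> w i = 0) \<and> sqnorm k w = 1}"
  have "(\<lambda>i. if i = 0 then 1 else 0) \<in> W"
  proof -
    have "sqnorm k (\<lambda>i. if i = 0 then 1 else 0) = (\<Sum>i<k. if i = 0 then 1 else 0)"
      unfolding sqnorm_def by (intro sum.cong) auto
    also have "\<dots> = 1" using kl by simp
    finally show ?thesis using kl by (auto simp: W_def Rn_def)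
  qed
  then have "W \<noteq> {}" by blast
  then obtain ws where ws: "\<And>i. ws i \<in> W" "\<And>U x. open U \<Longrightarrow> x \<in> W \<Longrightarrow> x \<in> U \<Longrightarrow> \<exists>i. (ws :: nat \<Rightarrow> nat \<Rightarrow> real) i \<in> U"
    by (rule dense_sequence) (rule that)
  obtain \<mu>s where \<mu>s: "\<And>j. \<mu>s j \<in> cone_sphere n K"
    "\<And>U x. open U \<Longrightarrow> x \<in> cone_sphere n K \<Longrightarrow> x \<in> U \<Longrightarrow> \<exists>j. (\<mu>s :: nat \<Rightarrow> nat \<Rightarrow> real) j \<in> U"
    by (rule dense_sequence[OF cone_sphere_nonempty[OF K]]) (rule that)
  define h where "h = coord_norm ({l..<m} \<times> {n})"
  define h' where "h' = coord_norm ({..<k} \<times> {n})"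
  define ga where "ga = (\<lambda>\<mu> (x :: nat \<times> nat \<Rightarrow> real). \<Sum>j<n. \<mu> j * x (m, j))"
  define q where "q = (\<lambda>j x. h x < ga (\<mu>s j) x \<and> r < sqrt ((ga (\<mu>s j) x)\<^sup>2 - (h x)\<^sup>2) - h' x)"
  have [measurable]: "h \<in> borel_measurable ?P" "h' \<in> borel_measurable ?P"
    unfolding h_def h'_def using kl by (auto intro!: coord_norm_measurable)
  have [measurable]: "ga \<mu> \<in> borel_measurable ?P" for \<mu> unfolding ga_def by measurable
  have "measure (gauss_mat m n) {G \<in> space (gauss_mat m n). \<not> ballk k r \<subseteq> slice k l m n G K}
    \<le> 2 * measure ?P {x \<in> space ?P. \<forall>j. \<not> q j x}"
  proof (rule gordon_limit[where w="\<lambda>i j. ws i" and \<mu>="\<lambda>i j. \<mu>s j" and sg=1 and l=r])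
    show "sqnorm n (\<mu>s j) = 1" for j using \<mu>s(1)[of j] by simp
    show "{x \<in> space ?P. q j x} \<in> sets ?P" for j unfolding q_def by measurable
    show "r < 1 * decoupled m n x (ws i) (\<mu>s j)" if x: "x \<in> space ?P" "q j x" for i j x
    proof -
      let ?w = "ws i" and ?a = "ga (\<mu>s j) x"
      have w: "\<And>i. k \<le> i \<Longrightarrow> i < l \<Longrightarrow> ?w i = 0" "sqnorm k ?w = 1" using ws(1)[of i] by (auto simp: W_def)
      \<comment> \<open>The norm of the multiplier part of \<open>w\<close>. The bound depends on
        the multiplier through \<open>t\<close> alone, which reduces the optimisation to
        \<open>hyperbola_min\<close>.\<close>
      define t where "t = sqrt (\<Sum>i\<in>{l..<m}. (?w i)\<^sup>2)"
      have t2: "t\<^sup>2 = (\<Sum>i\<in>{l..<m}. (?w i)\<^sup>2)" by (simp add: t_def sum_nonneg)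
      have "sqnorm m ?w = 1 + t\<^sup>2"
        unfolding t2 using w kl by (subst sqnorm_def, subst sum_split_gap[of k l m]) (auto simp: sqnorm_def)
      moreover have "(\<Sum>i<m. ?w i * x (i, n)) = (\<Sum>i<k. ?w i * x (i, n)) + (\<Sum>i\<in>{l..<m}. ?w i * x (i, n))"
        using w kl by (intro sum_split_gap) auto
      moreover have "- h' x \<le> (\<Sum>i<k. ?w i * x (i, n))"
        using column_cs(2)[of ?w "{..<k}" n x] w(2) by (simp add: h'_def sqnorm_def)
      moreover have "- (t * h x) \<le> (\<Sum>i\<in>{l..<m}. ?w i * x (i, n))"
        unfolding t_def h_def by (rule column_cs(2))
      moreover have "sqrt (?a\<^sup>2 - (h x)\<^sup>2) \<le> sqrt (1 + t\<^sup>2) * ?a - t * h x"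
        using x(2) by (intro hyperbola_min) (auto simp: q_def h_def coord_norm_nonneg)
      ultimately show ?thesis using x(2) unfolding decoupled_def q_def by (simp add: ga_def)
    qed
    fix b :: nat and G assume "G \<in> {G \<in> space (gauss_mat m n). \<not> ballk k r \<subseteq> slice k l m n G K}"
    then have G: "G \<in> space (gauss_mat m n)" "\<not> ballk k r \<subseteq> slice k l m n G K" by auto
    obtain w \<eta> where w: "w \<in> Rn m" "\<And>i. k \<le> i \<Longrightarrow> i < l \<Longrightarrow> w i = 0" "sqnorm k w = 1" "\<eta> > 0"
      "\<And>\<mu>. \<mu> \<in> cone_sphere n K \<Longrightarrow> bilin m n G w \<mu> \<le> r - \<eta>"
      by (rule slice_separation[OF K kl(2,3) G(2)]) (rule that)
    have "w \<in> W" using w by (auto simp: W_def)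
    moreover have "open {w'. (\<Sum>i<m. \<bar>w i - w' i\<bar> * (\<Sum>j<n. \<bar>G (i, j)\<bar>)) < \<eta>}"
      by (intro open_Collect_less continuous_on_sum continuous_on_mult continuous_on_rabs continuous_on_diff
          continuous_on_const continuous_coord)
    moreover have "w \<in> {w'. (\<Sum>i<m. \<bar>w i - w' i\<bar> * (\<Sum>j<n. \<bar>G (i, j)\<bar>)) < \<eta>}" using w(4) by simp
    ultimately obtain i where i: "(\<Sum>p<m. \<bar>w p - ws i p\<bar> * (\<Sum>j<n. \<bar>G (p, j)\<bar>)) < \<eta>" using ws(2) by blast
    have "bilin m n G (ws i) (\<mu>s j) < r" for j
      using bilin_perturb[OF \<mu>s(1)[of j], of m G "ws i" w] w(5)[OF \<mu>s(1)[of j]] i by linarith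
    then show "G \<in> space (gauss_mat m n) \<and> (\<exists>i. \<forall>j<b. 1 * bilin m n G (ws i) (\<mu>s j) < r)" using G(1) by auto
  qed auto
  also have "measure ?P {x \<in> space ?P. \<forall>j. \<not> q j x} \<le> measure ?P {x \<in> space ?P. \<not> concentrated k l m n K r R x}"
  proof (rule P.finite_measure_mono)
    show "{x \<in> space ?P. \<forall>j. \<not> q j x} \<subseteq> {x \<in> space ?P. \<not> concentrated k l m n K r R x}"
    proof safe
      fix x assume nq: "\<forall>j. \<not> q j x" and c: "concentrated k l m n K r R x"
      define A where "A = cone_norm n K (\<lambda>j. x (m, j))"
      have A: "h x < A" "r < sqrt (A\<^sup>2 - (h x)\<^sup>2) - h' x"
        using c by (auto simp: concentrated_def Let_def A_def h_def h'_def)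
      have "A > 0" using A(1) coord_norm_nonneg[of "{l..<m} \<times> {n}" x] by (simp add: h_def)
      then obtain s where s: "s \<in> cone_sphere n K" "ga s x = A"
        unfolding A_def ga_def by (rule cone_norm_attained[OF K])
      have gac: "continuous_on UNIV (\<lambda>\<mu>. ga \<mu> x)"
        unfolding ga_def by (intro continuous_on_sum continuous_on_mult continuous_on_const continuous_coord)
      \<comment> \<open>The condition holds at the maximiser \<open>s\<close> and is open in
        \<open>\<mu>\<close>, so some member of the dense sequence satisfies it.\<close>
      have "open {\<mu>. h x < ga \<mu> x \<and> r < sqrt ((ga \<mu> x)\<^sup>2 - (h x)\<^sup>2) - h' x}"
        by (intro open_Collect_conj open_Collect_less continuous_on_diff continuous_on_real_sqrt continuous_on_power gac continuous_on_const)
      then obtain j where "h x < ga (\<mu>s j) x \<and> r < sqrt ((ga (\<mu>s j) x)\<^sup>2 - (h x)\<^sup>2) - h' x"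
        using \<mu>s(2)[OF _ s(1)] s(2) A by blast
      then show False using nq by (auto simp: q_def)
    qed
    show "{x \<in> space ?P. \<not> concentrated k l m n K r R x} \<in> sets ?P"
      using kl by (intro concentrated_measurable[OF K]) auto
  qed
  finally show ?thesis by simp
qed

text \<open>The obstruction is a pair of \<open>u\<close> and \<open>\<mu>\<close> whose value
  exceeds \<open>R\<close> for every multiplier, so the pair is the outer index, the multiplier the
  inner one, and \<open>sg = -1\<close> reverses the signs. On the decoupled side one nearly optimal
  multiplier keeps the value below \<open>R\<close> for all pairs.\<close>

lemma upper_inclusion_failure:
  assumes K: "nontrivial_closed_convex_cone n K" and kl: "1 \<le> k" "k \<le> l" "l \<le> m" and R: "R \<ge> 0"
  shows "measure (gauss_mat m n) {G \<in> space (gauss_mat m n). \<not> slice k l m n G K \<subseteq> ballk k R}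
    \<le> 2 * measure (gauss (array m n)) {x \<in> space (gauss (array m n)). \<not> concentrated k l m n K r R x}"
proof -
  let ?P = "gauss (array m n)"
  interpret P: prob_space ?P by (rule prob_space_gauss)
  define U where "U = {u \<in> Rn k. sqnorm k u = 1} \<times> cone_sphere n K"
  have "(\<lambda>i. if i = 0 then 1 else 0) \<in> {u \<in> Rn k. sqnorm k u = 1}"
  proof -
    have "sqnorm k (\<lambda>i. if i = 0 then 1 else 0) = (\<Sum>i<k. if i = 0 then 1 else 0)"
      unfolding sqnorm_def by (intro sum.cong) auto
    also have "\<dots> = 1" using kl by simp
    finally show ?thesis using kl by (auto simp: Rn_def)
  qed
  then have "U \<noteq> {}" using cone_sphere_nonempty[OF K] by (auto simp: U_def)
  then obtain us where us: "\<And>i. us i \<in> U"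
    "\<And>V x. open V \<Longrightarrow> x \<in> U \<Longrightarrow> x \<in> V \<Longrightarrow> \<exists>i. (us :: nat \<Rightarrow> (nat \<Rightarrow> real) \<times> (nat \<Rightarrow> real)) i \<in> V"
    by (rule dense_sequence) (rule that)
  define V where "V = {v :: nat \<Rightarrow> real. \<forall>i. i < l \<or> m \<le> i \<longrightarrow> v i = 0}"
  have "(\<lambda>_. 0) \<in> V" by (simp add: V_def)
  then have "V \<noteq> {}" by blast
  then obtain vs where vs: "\<And>j. vs j \<in> V" "\<And>S x. open S \<Longrightarrow> x \<in> V \<Longrightarrow> x \<in> S \<Longrightarrow> \<exists>j. (vs :: nat \<Rightarrow> nat \<Rightarrow> real) j \<in> S"
    by (rule dense_sequence) (rule that)
  have u: "fst (us i) \<in> Rn k" "sqnorm k (fst (us i)) = 1" "snd (us i) \<in> cone_sphere n K" for i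
    using us(1)[of i] by (auto simp: U_def)
  have v: "vs j i = 0" if "i < l" for i j using vs(1)[of j] that by (auto simp: V_def)
  define h' where "h' = coord_norm ({..<k} \<times> {n})"
  define A where "A = (\<lambda>x. cone_norm n K (\<lambda>j. x (m, j)))"
  define \<Phi> where "\<Phi> = (\<lambda>v (x :: nat \<times> nat \<Rightarrow> real). sqrt (1 + (\<Sum>i\<in>{l..<m}. (v i)\<^sup>2)) * A x + (\<Sum>i\<in>{l..<m}. v i * x (i, n)) + h' x)"
  define q where "q = (\<lambda>j x. \<Phi> (vs j) x < R)"
  have [measurable]: "h' \<in> borel_measurable ?P"
    unfolding h'_def using kl by (auto intro!: coord_norm_measurable)
  have [measurable]: "A \<in> borel_measurable ?P"
    unfolding A_def by (rule support_fun_measurable[OF support_fun_cone_norm[OF K]])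
  have [measurable]: "\<Phi> v \<in> borel_measurable ?P" for v
  proof -
    have [measurable]: "(\<lambda>x. \<Sum>i\<in>{l..<m}. v i * x (i, n)) \<in> borel_measurable ?P"
      by (intro borel_measurable_sum borel_measurable_times borel_measurable_const) auto
    show ?thesis unfolding \<Phi>_def by measurable
  qed
  have "measure (gauss_mat m n) {G \<in> space (gauss_mat m n). \<not> slice k l m n G K \<subseteq> ballk k R}
    \<le> 2 * measure ?P {x \<in> space ?P. \<forall>j. \<not> q j x}"
  proof (rule gordon_limit[where w="\<lambda>i j p. fst (us i) p + vs j p" and \<mu>="\<lambda>i j. snd (us i)" and sg="-1" and l="-R"])
    show "sqnorm n (snd (us i)) = 1" for i using u(3)[of i] by simp
    show "{x \<in> space ?P. q j x} \<in> sets ?P" for j unfolding q_def by measurable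
    show "- R < - 1 * decoupled m n x (\<lambda>p. fst (us i) p + vs j p) (snd (us i))" if x: "x \<in> space ?P" "q j x" for i j x
    proof -
      let ?w = "\<lambda>p. fst (us i) p + vs j p"
      have u0: "fst (us i) p = 0" if "p \<ge> k" for p using u(1)[of i] that by (simp add: Rn_def)
      have w0: "?w p = 0" if "k \<le> p" "p < l" for p using u0[OF that(1)] v[OF that(2)] by simp
      have wk: "?w p = fst (us i) p" if "p < k" for p using v[of p j] that kl by simp
      have wl: "?w p = vs j p" if "p \<in> {l..<m}" for p using u0[of p] that kl by simp
      have "sqnorm m ?w = (\<Sum>p<k. (?w p)\<^sup>2) + (\<Sum>p\<in>{l..<m}. (?w p)\<^sup>2)"
        unfolding sqnorm_def using w0 kl by (intro sum_split_gap) auto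
      also have "(\<Sum>p<k. (?w p)\<^sup>2) = 1" using u(2)[of i] wk by (simp add: sqnorm_def)
      also have "(\<Sum>p\<in>{l..<m}. (?w p)\<^sup>2) = (\<Sum>p\<in>{l..<m}. (vs j p)\<^sup>2)" using wl by (intro sum.cong) auto
      finally have sq: "sqnorm m ?w = 1 + (\<Sum>p\<in>{l..<m}. (vs j p)\<^sup>2)" .
      have "(\<Sum>p<m. ?w p * x (p, n)) = (\<Sum>p<k. ?w p * x (p, n)) + (\<Sum>p\<in>{l..<m}. ?w p * x (p, n))"
        using w0 kl by (intro sum_split_gap) auto
      also have "(\<Sum>p<k. ?w p * x (p, n)) = (\<Sum>p<k. fst (us i) p * x (p, n))" using wk by (intro sum.cong) auto
      also have "(\<Sum>p\<in>{l..<m}. ?w p * x (p, n)) = (\<Sum>p\<in>{l..<m}. vs j p * x (p, n))" using wl by (intro sum.cong) auto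
      finally have ip: "(\<Sum>p<m. ?w p * x (p, n)) = (\<Sum>p<k. fst (us i) p * x (p, n)) + (\<Sum>p\<in>{l..<m}. vs j p * x (p, n))" .
      have "(\<Sum>p<k. fst (us i) p * x (p, n)) \<le> h' x"
        using column_cs(1)[of "fst (us i)" x n "{..<k}"] u(2)[of i] by (simp add: h'_def sqnorm_def)
      moreover have "(\<Sum>p<n. snd (us i) p * x (m, p)) \<le> A x"
        unfolding A_def using u(3)[of i] by (intro cone_norm_upper[OF K]) auto
      then have "sqrt (sqnorm m ?w) * (\<Sum>p<n. snd (us i) p * x (m, p)) \<le> sqrt (sqnorm m ?w) * A x"
        by (intro mult_left_mono) (auto simp: sqnorm_nonneg)
      ultimately show ?thesis using x(2) unfolding decoupled_def q_def \<Phi>_def ip sq[symmetric] by simp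
    qed
    fix b :: nat and G assume "G \<in> {G \<in> space (gauss_mat m n). \<not> slice k l m n G K \<subseteq> ballk k R}"
    then have G: "G \<in> space (gauss_mat m n)" "\<not> slice k l m n G K \<subseteq> ballk k R" by auto
    obtain u \<mu> where u\<mu>: "u \<in> Rn k" "sqnorm k u = 1" "\<mu> \<in> cone_sphere n K"
      "\<forall>v. (\<forall>i<l. v i = 0) \<longrightarrow> bilin m n G (\<lambda>i. u i + v i) \<mu> > R"
      by (rule slice_escape[OF K kl(2,3) R G(2)]) (rule that)
    have bc: "continuous_on UNIV (\<lambda>p. bilin m n G (\<lambda>i. fst p i + vs j i) (snd p))" for j
      unfolding bilin_def
      by (intro continuous_on_sum continuous_on_mult continuous_on_add continuous_on_const
          continuous_on_product_then_coordinatewise[OF continuous_on_fst[OF continuous_on_id]]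
          continuous_on_product_then_coordinatewise[OF continuous_on_snd[OF continuous_on_id]])
    \<comment> \<open>The multipliers are unbounded, so a neighbourhood of the pair need not work
      for all \<open>j\<close>. For the finitely many \<open>j < b\<close> it does, and
      \<open>gordon_limit\<close> admits an outer index that depends on \<open>b\<close>.\<close>
    have "open (\<Inter>j\<in>{..<b}. {p. R < bilin m n G (\<lambda>i. fst p i + vs j i) (snd p)})"
      by (intro open_INT finite_lessThan ballI open_Collect_less bc continuous_on_const)
    moreover have "(u, \<mu>) \<in> U" using u\<mu> by (simp add: U_def)
    moreover have "(u, \<mu>) \<in> (\<Inter>j\<in>{..<b}. {p. R < bilin m n G (\<lambda>i. fst p i + vs j i) (snd p)})"
      using u\<mu>(4) v by simp
    ultimately obtain i where "us i \<in> (\<Inter>j\<in>{..<b}. {p. R < bilin m n G (\<lambda>i. fst p i + vs j i) (snd p)})"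
      using us(2) by blast
    then show "G \<in> space (gauss_mat m n) \<and> (\<exists>i. \<forall>j<b. - 1 * bilin m n G (\<lambda>p. fst (us i) p + vs j p) (snd (us i)) < - R)"
      using G(1) by auto
  qed auto
  also have "measure ?P {x \<in> space ?P. \<forall>j. \<not> q j x} \<le> measure ?P {x \<in> space ?P. \<not> concentrated k l m n K r R x}"
  proof (rule P.finite_measure_mono)
    show "{x \<in> space ?P. \<forall>j. \<not> q j x} \<subseteq> {x \<in> space ?P. \<not> concentrated k l m n K r R x}"
    proof safe
      fix x assume nq: "\<forall>j. \<not> q j x" and c: "concentrated k l m n K r R x"
      define h where "h = coord_norm ({l..<m} \<times> {n}) x"
      define s where "s = sqrt ((A x)\<^sup>2 - h\<^sup>2)"
      have A: "h < A x" "s + h' x < R"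
        using c by (auto simp: concentrated_def Let_def A_def h_def h'_def s_def)
      have h0: "h \<ge> 0" by (simp add: h_def coord_norm_nonneg)
      have "h\<^sup>2 < (A x)\<^sup>2" using A(1) h0 by (intro power_strict_mono) auto
      then have s: "s > 0" "s\<^sup>2 = (A x)\<^sup>2 - h\<^sup>2" by (auto simp: s_def)
      have h2: "(\<Sum>i\<in>{l..<m}. (x (i, n))\<^sup>2) = h\<^sup>2"
        by (simp add: h_def coord_norm_def sum_nonneg sum.cartesian_product')
      \<comment> \<open>The minimiser of \<open>sqrt (1 + |v|^2) * A x + <v, x>\<close>: opposite to
        the column vector and of length \<open>h / s\<close>. The minimum is \<open>s\<close>, the
        same value as in \<open>hyperbola_min\<close>.\<close>
      define v0 where "v0 = (\<lambda>i. if l \<le> i \<and> i < m then - x (i, n) / s else 0)"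
      have "(\<Sum>i\<in>{l..<m}. (v0 i)\<^sup>2) = h\<^sup>2 / s\<^sup>2"
        unfolding h2[symmetric] sum_divide_distrib by (intro sum.cong) (auto simp: v0_def power_divide)
      then have "1 + (\<Sum>i\<in>{l..<m}. (v0 i)\<^sup>2) = (s\<^sup>2 + h\<^sup>2) / s\<^sup>2"
        using s(1) by (simp add: add_divide_distrib)
      also have "\<dots> = (A x / s)\<^sup>2" unfolding s(2) power_divide by simp
      finally have "1 + (\<Sum>i\<in>{l..<m}. (v0 i)\<^sup>2) = (A x / s)\<^sup>2" .
      then have v1: "sqrt (1 + (\<Sum>i\<in>{l..<m}. (v0 i)\<^sup>2)) = A x / s"
        using s(1) A(1) h0 by simp
      have v2: "(\<Sum>i\<in>{l..<m}. v0 i * x (i, n)) = - (h\<^sup>2 / s)"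
        unfolding h2[symmetric] sum_divide_distrib sum_negf[symmetric]
        by (intro sum.cong) (auto simp: v0_def power2_eq_square)
      have "\<Phi> v0 x = ((A x)\<^sup>2 - h\<^sup>2) / s + h' x"
        unfolding \<Phi>_def v1 v2 by (simp add: power2_eq_square diff_divide_distrib)
      also have "\<dots> = s + h' x" unfolding s(2)[symmetric] by (simp add: power2_eq_square)
      finally have "\<Phi> v0 x < R" using A(2) by simp
      moreover have "v0 \<in> V" by (auto simp: V_def v0_def)
      moreover have "open {v. \<Phi> v x < R}" unfolding \<Phi>_def
        by (intro open_Collect_less continuous_on_add continuous_on_mult continuous_on_real_sqrt continuous_on_sum
            continuous_on_power continuous_on_const continuous_coord)
      ultimately obtain j where "\<Phi> (vs j) x < R" using vs(2) by blast
      then show False using nq by (auto simp: q_def)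
    qed
    show "{x \<in> space ?P. \<not> concentrated k l m n K r R x} \<in> sets ?P"
      using kl by (intro concentrated_measurable[OF K]) auto
  qed
  finally show ?thesis by simp
qed

section \<open>Probability estimates\<close>

text \<open>For \<open>b < t\<close> the bound \<open>b - t\<close> is negative and cannot be
  squared, but then the right-hand side is at most 0.\<close>

lemma square_ge_of_shift:
  fixes a b t :: real
  assumes "a \<ge> 0" "b \<ge> 0" "t \<ge> 0" "a \<ge> b - t"
  shows "a\<^sup>2 \<ge> b\<^sup>2 - 2 * b * t"
proof (cases "b \<ge> t")
  case True
  have "(b - t)\<^sup>2 \<le> a\<^sup>2" using assms True by (intro power_mono) auto
  moreover have "(b - t)\<^sup>2 = b\<^sup>2 - 2 * b * t + t\<^sup>2" by (simp add: power2_eq_square algebra_simps)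
  ultimately show ?thesis using zero_le_power2[of t] by linarith
next
  case False
  have "b * b \<le> b * (2 * t)" using assms False by (intro mult_left_mono) auto
  then have "b\<^sup>2 - 2 * b * t \<le> 0" by (simp add: power2_eq_square mult_ac)
  moreover have "0 \<le> a\<^sup>2" by simp
  ultimately show ?thesis by linarith
qed

text \<open>The budget of constants. With \<open>e = \<theta> * \<epsilon>\<close>, the squares of
  \<open>A\<close> and \<open>H\<close> differ from \<open>\<delta>\<close> and \<open>p\<close> by
  at most \<open>3 * (e * \<delta>)\<close>: two parts from the cross term, one from
  \<open>T\<^sup>2\<close> above or from the variance bound 26 below. As
  \<open>\<delta> - p \<ge> \<tau> * \<delta>\<close>, the difference of the squares has relative
  error at most \<open>3 / 25 * \<epsilon>\<close>, and \<open>C\<close> adds less than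
  \<open>\<epsilon> / 25\<close> relative to \<open>sqrt (\<delta> - p)\<close>; together these stay
  below \<open>\<epsilon>\<close>.\<close>

lemma concentrated_numeric:
  fixes \<tau> \<epsilon> \<delta> p a0 b0 c0 A H C :: real
  assumes \<tau>: "0 < \<tau>" "\<tau> < 1 / 2" and \<epsilon>: "0 < \<epsilon>" "\<epsilon> < 1 / 2" and \<delta>: "\<delta> > 0" and p: "0 \<le> p" "p \<le> (1 - \<tau>) * \<delta>"
    and th: "\<theta> = \<tau> / 50" and T: "T = \<theta> * \<epsilon> * sqrt \<delta>" and big: "26 \<le> \<theta> * \<epsilon> * \<delta>"
    and a0: "0 \<le> a0" "a0\<^sup>2 \<le> \<delta>" "\<delta> \<le> a0\<^sup>2 + 26" and b0: "0 \<le> b0" "b0\<^sup>2 \<le> p" "p \<le> b0\<^sup>2 + 26"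
    and c0: "c0 \<le> T" and A: "0 \<le> A" "a0 - T < A" "A < a0 + T" and H: "0 \<le> H" "b0 - T < H" "H < b0 + T"
    and C: "0 \<le> C" "C < c0 + T"
  shows "H < A" "(1 - \<epsilon>) * sqrt (\<delta> - p) < sqrt (A\<^sup>2 - H\<^sup>2) - C" "sqrt (A\<^sup>2 - H\<^sup>2) + C < (1 + \<epsilon>) * sqrt (\<delta> - p)"
proof -
  define D where "D = sqrt \<delta>"
  define e where "e = \<theta> * \<epsilon>"
  have D: "D > 0" "D * D = \<delta>" using \<delta> by (auto simp: D_def)
  have "0 < \<theta>" "\<theta> \<le> 1" using \<tau> by (auto simp: th)
  then have e: "0 < e" "e \<le> 1" unfolding e_def using \<epsilon> by (auto intro!: mult_le_one)
  have TD: "T = e * D" by (simp add: T e_def D_def)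
  have T0: "T > 0" using e D by (simp add: TD)
  have DT: "D * T = e * \<delta>" using D by (simp add: TD mult_ac)
  have TT: "T\<^sup>2 \<le> e * \<delta>"
  proof -
    have "T\<^sup>2 = e * (e * \<delta>)" using D(2) by (simp add: TD power2_eq_square mult_ac)
    also have "\<dots> \<le> 1 * (e * \<delta>)" using e \<delta> by (intro mult_right_mono) auto
    finally show ?thesis by simp
  qed
  have aD: "a0 \<le> D" unfolding D_def using a0 by (simp add: real_le_rsqrt)
  have pd: "p \<le> \<delta>"
  proof -
    have "(1 - \<tau>) * \<delta> \<le> 1 * \<delta>" using \<tau> \<delta> by (intro mult_right_mono) auto
    then show ?thesis using p(2) by linarith
  qed
  have bD: "b0 \<le> D" unfolding D_def using b0(2) pd by (intro real_le_rsqrt) linarith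
  have aT: "a0 * T \<le> e * \<delta>" using mult_right_mono[OF aD, of T] T0 DT by simp
  have bT: "b0 * T \<le> e * \<delta>" using mult_right_mono[OF bD, of T] T0 DT by simp
  have A2u: "A\<^sup>2 \<le> \<delta> + 3 * (e * \<delta>)"
  proof -
    have "A\<^sup>2 \<le> (a0 + T)\<^sup>2" using A by (intro power_mono) auto
    also have "\<dots> = a0\<^sup>2 + 2 * (a0 * T) + T\<^sup>2" by (simp add: power2_eq_square algebra_simps)
    finally show ?thesis using a0(2) aT TT by linarith
  qed
  have A2l: "A\<^sup>2 \<ge> \<delta> - 3 * (e * \<delta>)"
  proof -
    have "a0\<^sup>2 - 2 * a0 * T \<le> A\<^sup>2" using A a0 T0 by (intro square_ge_of_shift) auto
    then show ?thesis using a0(3) aT big[folded e_def] by (simp add: mult.assoc)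
  qed
  have H2u: "H\<^sup>2 \<le> p + 3 * (e * \<delta>)"
  proof -
    have "H\<^sup>2 \<le> (b0 + T)\<^sup>2" using H by (intro power_mono) auto
    also have "\<dots> = b0\<^sup>2 + 2 * (b0 * T) + T\<^sup>2" by (simp add: power2_eq_square algebra_simps)
    finally show ?thesis using b0(2) bT TT by linarith
  qed
  have H2l: "H\<^sup>2 \<ge> p - 3 * (e * \<delta>)"
  proof -
    have "b0\<^sup>2 - 2 * b0 * T \<le> H\<^sup>2" using H b0 T0 by (intro square_ge_of_shift) auto
    then show ?thesis using b0(3) bT big[folded e_def] by (simp add: mult.assoc)
  qed
  define S where "S = \<delta> - p"
  define \<rho> where "\<rho> = sqrt S"
  have S\<tau>: "\<tau> * \<delta> \<le> S" using p(2) by (simp add: S_def algebra_simps)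
  then have S0: "S > 0" using \<tau>(1) \<delta> by (smt (verit) mult_pos_pos)
  have \<rho>: "\<rho> > 0" "\<rho>\<^sup>2 = S" using S0 by (auto simp: \<rho>_def)
  \<comment> \<open>This is \<open>6 * \<theta> * \<epsilon> / \<tau>\<close> with
    \<open>\<theta> = \<tau> / 50\<close>; the 6 collects the errors of the two squares.\<close>
  define y where "y = 3 / 25 * \<epsilon>"
  have y: "0 < y" "y < 1" using \<epsilon> by (auto simp: y_def)
  have "6 * (e * \<delta>) = y * (\<tau> * \<delta>)" by (simp add: e_def th y_def)
  also have "\<dots> \<le> y * S" using S\<tau> y by (intro mult_left_mono) auto
  finally have e6: "6 * (e * \<delta>) \<le> y * S" .
  have up: "A\<^sup>2 - H\<^sup>2 \<le> (1 + y) * S" using A2u H2l e6 by (simp add: S_def algebra_simps)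
  have lo: "(1 - y) * S \<le> A\<^sup>2 - H\<^sup>2" using A2l H2u e6 by (simp add: S_def algebra_simps)
  have "0 < (1 - y) * S" using y S0 by simp
  then have "H\<^sup>2 < A\<^sup>2" using lo by linarith
  then show "H < A" using A(1) by (rule power2_less_imp_less)
  have sup: "sqrt (A\<^sup>2 - H\<^sup>2) \<le> (1 + y) * \<rho>"
  proof (rule real_le_lsqrt)
    have "(1 + y) * S \<le> (1 + y) * ((1 + y) * S)" using y S0 by (intro mult_left_mono) (auto simp: algebra_simps)
    also have "\<dots> = ((1 + y) * \<rho>)\<^sup>2" unfolding \<rho>(2)[symmetric] by (simp add: power2_eq_square mult_ac)
    finally show "A\<^sup>2 - H\<^sup>2 \<le> ((1 + y) * \<rho>)\<^sup>2" using up by linarith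
  qed (use y \<rho> \<open>H\<^sup>2 < A\<^sup>2\<close> in auto)
  have slo: "(1 - y) * \<rho> \<le> sqrt (A\<^sup>2 - H\<^sup>2)"
  proof (rule real_le_rsqrt)
    have "((1 - y) * \<rho>)\<^sup>2 = (1 - y) * ((1 - y) * S)" unfolding \<rho>(2)[symmetric] by (simp add: power2_eq_square mult_ac)
    also have "\<dots> \<le> (1 - y) * S" using y S0 by (intro mult_left_mono) (auto simp: algebra_simps)
    finally show "((1 - y) * \<rho>)\<^sup>2 \<le> A\<^sup>2 - H\<^sup>2" using lo by linarith
  qed
  \<comment> \<open>Rests on \<open>\<tau> \<le> sqrt \<tau>\<close>, as \<open>\<tau> < 1\<close>,
    and puts \<open>2 * T\<close> on the scale of \<open>\<rho>\<close>.\<close>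
  have "\<tau> * D \<le> \<rho>" unfolding \<rho>_def
  proof (rule real_le_rsqrt)
    have "(\<tau> * D)\<^sup>2 = \<tau> * (\<tau> * \<delta>)" using D(2) by (simp add: power2_eq_square mult_ac)
    also have "\<dots> \<le> 1 * (\<tau> * \<delta>)" using \<tau> \<delta> by (intro mult_right_mono) auto
    finally show "(\<tau> * D)\<^sup>2 \<le> S" using S\<tau> by simp
  qed
  then have "\<epsilon> / 25 * (\<tau> * D) \<le> \<epsilon> / 25 * \<rho>" using \<epsilon> by (intro mult_left_mono) auto
  moreover have "2 * T = \<epsilon> / 25 * (\<tau> * D)" by (simp add: TD e_def th)
  ultimately have C2: "C < \<epsilon> / 25 * \<rho>" using C c0 by linarith
  have \<epsilon>\<rho>: "0 < \<epsilon> * \<rho>" using \<epsilon> \<rho> by simp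
  have yr: "y * \<rho> = 3 / 25 * (\<epsilon> * \<rho>)" by (simp add: y_def)
  show "(1 - \<epsilon>) * sqrt (\<delta> - p) < sqrt (A\<^sup>2 - H\<^sup>2) - C"
    unfolding S_def[symmetric] \<rho>_def[symmetric] using slo C2 \<epsilon>\<rho> yr by (simp add: left_diff_distrib)
  show "sqrt (A\<^sup>2 - H\<^sup>2) + C < (1 + \<epsilon>) * sqrt (\<delta> - p)"
    unfolding S_def[symmetric] \<rho>_def[symmetric] using sup C2 \<epsilon>\<rho> yr by (simp add: distrib_right)
qed

text \<open>A union bound over five one-sided deviations at the common scale
  \<open>T = \<theta> * \<epsilon> * sqrt \<delta>\<close>: on both sides for the cone norm and for
  the last rows, from above for the first \<open>k\<close> rows, whose norm has mean at most
  \<open>T\<close> by the bound on \<open>k\<close>.\<close>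

lemma not_concentrated_bound:
  fixes \<tau> \<epsilon> :: real
  assumes K: "nontrivial_closed_convex_cone n K" and kl: "k \<le> l" "l \<le> m"
    and \<tau>: "0 < \<tau>" "\<tau> < 1 / 2" and \<epsilon>: "0 < \<epsilon>" "\<epsilon> < 1 / 2"
    and p: "real m - real l \<le> (1 - \<tau>) * stat_dim n K"
    and th: "\<theta> = \<tau> / 50" and big: "26 \<le> \<theta> * \<epsilon> * stat_dim n K"
    and k: "real k \<le> (\<theta> * \<epsilon>)\<^sup>2 * stat_dim n K"
  defines "\<rho> \<equiv> sqrt (stat_dim n K - real m + real l)"
  shows "measure (gauss (array m n)) {x \<in> space (gauss (array m n)). \<not> concentrated k l m n K ((1 - \<epsilon>) * \<rho>) ((1 + \<epsilon>) * \<rho>) x}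
    \<le> 5 * exp (- (\<theta>\<^sup>2 * (\<epsilon>\<^sup>2 * stat_dim n K)) / 8)"
proof -
  let ?P = "gauss (array m n)"
  interpret P: prob_space ?P by (rule prob_space_gauss)
  define \<delta> where "\<delta> = stat_dim n K"
  have th0: "\<theta> > 0" using \<tau> th by simp
  have \<delta>: "\<delta> > 0"
  proof (rule ccontr)
    assume "\<not> \<delta> > 0"
    then have "\<theta> * \<epsilon> * \<delta> \<le> 0" using th0 \<epsilon> by (intro mult_nonneg_nonpos) auto
    then show False using big by (simp add: \<delta>_def)
  qed
  define T where "T = \<theta> * \<epsilon> * sqrt \<delta>"
  have T: "T > 0" using th0 \<epsilon> \<delta> by (simp add: T_def)
  have T2: "T\<^sup>2 = \<theta>\<^sup>2 * (\<epsilon>\<^sup>2 * \<delta>)" using \<delta> by (simp add: T_def power_mult_distrib)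
  have fin: "finite (array m n)" by simp
  define A where "A = (\<lambda>x. cone_norm n K (\<lambda>j. x (m, j)))"
  define H where "H = coord_norm ({l..<m} \<times> {n})"
  define C where "C = coord_norm ({..<k} \<times> {n})"
  have subH: "{l..<m} \<times> {n} \<subseteq> array m n" and subC: "{..<k} \<times> {n} \<subseteq> array m n" using kl by auto
  have sA: "support_fun (array m n) A" unfolding A_def by (rule support_fun_cone_norm[OF K])
  have sH: "support_fun (array m n) H" unfolding H_def by (rule support_fun_coord_norm(1)[OF fin subH])
  have sC: "support_fun (array m n) C" unfolding C_def by (rule support_fun_coord_norm(1)[OF fin subC])
  have A0: "A x \<ge> 0" for x unfolding A_def by (rule cone_norm_nonneg)
  have H0: "H x \<ge> 0" for x unfolding H_def by (rule coord_norm_nonneg)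
  have C0: "C x \<ge> 0" for x unfolding C_def by (rule coord_norm_nonneg)
  define a0 where "a0 = (\<integral>x. A x \<partial>?P)"
  define b0 where "b0 = (\<integral>x. H x \<partial>?P)"
  define c0 where "c0 = (\<integral>x. C x \<partial>?P)"
  have nn: "a0 \<ge> 0" "b0 \<ge> 0" "c0 \<ge> 0" unfolding a0_def b0_def c0_def using A0 H0 C0 by (auto intro: integral_nonneg_AE)
  have EA: "(\<integral>x. (A x)\<^sup>2 \<partial>?P) = \<delta>" unfolding A_def \<delta>_def by (rule cone_norm_mean_square[OF K])
  have EH: "(\<integral>x. (H x)\<^sup>2 \<partial>?P) = real m - real l"
    unfolding H_def using support_fun_coord_norm(2)[OF fin subH] kl by (simp add: card_cartesian_product of_nat_diff)
  have EC: "(\<integral>x. (C x)\<^sup>2 \<partial>?P) = real k"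
    unfolding C_def using support_fun_coord_norm(2)[OF fin subC] by (simp add: card_cartesian_product)
  have a: "a0\<^sup>2 \<le> \<delta>" "\<delta> \<le> a0\<^sup>2 + 26" using support_fun_mean[OF fin sA] unfolding EA a0_def by auto
  have b: "b0\<^sup>2 \<le> real m - real l" "real m - real l \<le> b0\<^sup>2 + 26"
    using support_fun_mean[OF fin sH] unfolding EH b0_def by auto
  have c: "c0 \<le> T"
  proof (rule power2_le_imp_le)
    have "c0\<^sup>2 \<le> real k" using support_fun_mean(1)[OF fin sC] unfolding EC c0_def .
    then show "c0\<^sup>2 \<le> T\<^sup>2" using k unfolding T2 \<delta>_def by (simp add: power_mult_distrib mult.assoc)
  qed (use T in simp)
  let ?U = "\<lambda>F f0. {x \<in> space ?P. F x \<ge> f0 + T}" and ?L = "\<lambda>F f0. {x \<in> space ?P. F x \<le> f0 - T}"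
  note [measurable] = support_fun_measurable[OF sA] support_fun_measurable[OF sH] support_fun_measurable[OF sC]
  have "{x \<in> space ?P. \<not> concentrated k l m n K ((1 - \<epsilon>) * \<rho>) ((1 + \<epsilon>) * \<rho>) x}
    \<subseteq> ?U A a0 \<union> (?L A a0 \<union> (?U H b0 \<union> (?L H b0 \<union> ?U C c0)))"
  proof (rule subsetI, rule ccontr)
    fix x assume x: "x \<in> {x \<in> space ?P. \<not> concentrated k l m n K ((1 - \<epsilon>) * \<rho>) ((1 + \<epsilon>) * \<rho>) x}"
      and nx: "x \<notin> ?U A a0 \<union> (?L A a0 \<union> (?U H b0 \<union> (?L H b0 \<union> ?U C c0)))"
    have sp: "x \<in> space ?P" using x by simp
    have ax: "a0 - T < A x" "A x < a0 + T" "b0 - T < H x" "H x < b0 + T" "C x < c0 + T"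
      using nx sp by (auto simp: not_le)
    have \<rho>: "\<rho> = sqrt (\<delta> - (real m - real l))" by (simp add: \<rho>_def \<delta>_def algebra_simps)
    note num = concentrated_numeric[OF \<tau> \<epsilon> \<delta> _ p[folded \<delta>_def] th T_def big[folded \<delta>_def] nn(1) a nn(2) b c A0 ax(1,2) H0 ax(3,4) C0 ax(5)]
    have "concentrated k l m n K ((1 - \<epsilon>) * \<rho>) ((1 + \<epsilon>) * \<rho>) x"
      unfolding concentrated_def Let_def A_def[symmetric] H_def[symmetric] C_def[symmetric] \<rho>
      using num kl unfolding A_def by simp
    then show False using x by simp
  qed
  then have "measure ?P {x \<in> space ?P. \<not> concentrated k l m n K ((1 - \<epsilon>) * \<rho>) ((1 + \<epsilon>) * \<rho>) x}
    \<le> measure ?P (?U A a0 \<union> (?L A a0 \<union> (?U H b0 \<union> (?L H b0 \<union> ?U C c0))))"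
    by (rule P.finite_measure_mono) measurable
  also have "\<dots> \<le> measure ?P (?U A a0) + (measure ?P (?L A a0) + (measure ?P (?U H b0) + (measure ?P (?L H b0) + measure ?P (?U C c0))))"
  proof -
    have un: "measure ?P (X \<union> Y) \<le> measure ?P X + y"
      if "X \<in> sets ?P" "Y \<in> sets ?P" "measure ?P Y \<le> y" for X Y y
      using measure_Un_le[OF that(1,2)] that(3) by linarith
    show ?thesis by (intro un order_refl) measurable
  qed
  also have "\<dots> \<le> exp (- T\<^sup>2 / 8) + (exp (- T\<^sup>2 / 8) + (exp (- T\<^sup>2 / 8) + (exp (- T\<^sup>2 / 8) + exp (- T\<^sup>2 / 8))))"
    unfolding a0_def b0_def c0_def
    by (intro add_mono support_fun_concentration[OF fin sA T] support_fun_concentration[OF fin sH T] support_fun_concentration(1)[OF fin sC T])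
  also have "\<dots> = 5 * exp (- (\<theta>\<^sup>2 * (\<epsilon>\<^sup>2 * stat_dim n K)) / 8)" by (simp add: T2 \<delta>_def)
  finally show ?thesis .
qed

lemma Lfun_le: "x \<ge> 0 \<Longrightarrow> Lfun x \<le> x"
proof -
  assume x: "x \<ge> 0"
  have "ln (exp 1) \<le> ln (max (exp 1) (1 / x))" by (subst ln_le_cancel_iff) (auto simp: less_max_iff_disj)
  then have "1 \<le> ln (max (exp 1) (1 / x))" by simp
  then have "x / ln (max (exp 1) (1 / x)) \<le> x / 1" using x by (intro divide_left_mono) auto
  then show ?thesis by (simp add: Lfun_def)
qed

text \<open>The prefactor is 20 = 2 * 2 * 5: two inclusions, the factor 2 of Gordon's comparison for
  each, five deviations. The denominator 64 in \<open>c\<close> makes the available exponent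
  \<open>\<theta>\<^sup>2 * x / 8\<close> equal to \<open>8 * (c * x)\<close>, of which seven parts
  absorb the prefactor and one remains.\<close>

lemma slice_probability:
  fixes \<tau> \<epsilon> :: real
  assumes \<tau>: "0 < \<tau>" "\<tau> < 1 / 2" and c: "c = (\<tau> / 50)\<^sup>2 / 64"
    and K: "nontrivial_closed_convex_cone n K" and l: "l \<le> m"
    and p: "real m - real l \<le> (1 - \<tau>) * stat_dim n K"
    and \<epsilon>: "0 < \<epsilon>" "\<epsilon> < 1 / 2" and k: "1 \<le> k" "k \<le> l" "real k \<le> c * Lfun (\<epsilon>\<^sup>2 * stat_dim n K)"
  shows "measure (gauss_mat m n)
          {G \<in> space (gauss_mat m n).
             scale_set (1 - \<epsilon>) (ballk k (sqrt (stat_dim n K - real m + real l))) \<subseteq> slice k l m n G K \<and>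
             slice k l m n G K \<subseteq> scale_set (1 + \<epsilon>) (ballk k (sqrt (stat_dim n K - real m + real l)))}
        \<ge> 1 - exp (- c * \<epsilon>\<^sup>2 * stat_dim n K)"
proof -
  let ?M = "gauss_mat m n"
  interpret M: prob_space ?M unfolding gauss_mat_def by (rule prob_space_gauss)
  define \<theta> where "\<theta> = \<tau> / 50"
  define \<delta> where "\<delta> = stat_dim n K"
  define x where "x = \<epsilon>\<^sup>2 * \<delta>"
  define \<rho> where "\<rho> = sqrt (stat_dim n K - real m + real l)"
  have \<theta>: "0 < \<theta>" "\<theta> < 1 / 100" using \<tau> by (auto simp: \<theta>_def)
  have c': "c = \<theta>\<^sup>2 / 64" using c by (simp add: \<theta>_def)
  have c0: "c > 0" unfolding c' using \<theta>(1) by simp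
  have "\<delta> \<ge> 0" unfolding \<delta>_def stat_dim_def by (intro integral_nonneg_AE AE_I2 sqnorm_nonneg)
  then have x0: "x \<ge> 0" by (simp add: x_def)
  have "c * Lfun x \<le> c * x" using c0 by (intro mult_left_mono Lfun_le x0) simp
  then have kx: "real k \<le> c * x" using k(3) by (simp only: x_def \<delta>_def)
  then have cx: "1 \<le> c * x" using k(1) by linarith
  have tx: "64 \<le> \<theta>\<^sup>2 * x" using cx by (simp add: c')
  \<comment> \<open>From \<open>64 \<le> \<theta>\<^sup>2 * x = (\<theta> * \<epsilon>) * (\<theta>
    * \<epsilon> * \<delta>)\<close>, whose first factor is at most 1.\<close>
  have big: "26 \<le> \<theta> * \<epsilon> * \<delta>"
  proof -
    have "\<theta>\<^sup>2 * x = (\<theta> * \<epsilon>) * (\<theta> * \<epsilon> * \<delta>)" by (simp add: x_def power2_eq_square)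
    also have "\<dots> \<le> 1 * (\<theta> * \<epsilon> * \<delta>)"
      using \<theta> \<epsilon> \<open>\<delta> \<ge> 0\<close> by (intro mult_right_mono mult_le_one mult_nonneg_nonneg) auto
    finally show ?thesis using tx by simp
  qed
  have kk: "real k \<le> (\<theta> * \<epsilon>)\<^sup>2 * \<delta>"
  proof -
    have "c * x \<le> \<theta>\<^sup>2 * x" using x0 by (intro mult_right_mono) (auto simp: c')
    also have "\<dots> = (\<theta> * \<epsilon>)\<^sup>2 * \<delta>" by (simp add: x_def power_mult_distrib mult.assoc)
    finally show ?thesis using kx by linarith
  qed
  define N where "N = measure (gauss (array m n)) {x \<in> space (gauss (array m n)). \<not> concentrated k l m n K ((1 - \<epsilon>) * \<rho>) ((1 + \<epsilon>) * \<rho>) x}"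
  have N: "N \<le> 5 * exp (- (\<theta>\<^sup>2 * x) / 8)"
    unfolding N_def \<rho>_def x_def \<delta>_def
    by (rule not_concentrated_bound[OF K k(2) l \<tau> \<epsilon> p \<theta>_def big[unfolded \<delta>_def] kk[unfolded \<delta>_def]])
  \<comment> \<open>The real \<open>sqrt\<close> is negative at negative arguments, so the sign of
    the radicand has to be checked.\<close>
  have R0: "(1 + \<epsilon>) * \<rho> \<ge> 0"
  proof -
    have "(1 - \<tau>) * \<delta> \<le> 1 * \<delta>" using \<tau> \<open>\<delta> \<ge> 0\<close> by (intro mult_right_mono) auto
    then have "0 \<le> stat_dim n K - real m + real l" using p by (simp add: \<delta>_def)
    then show ?thesis using \<epsilon> by (simp add: \<rho>_def)
  qed
  let ?L = "{G \<in> space ?M. \<not> ballk k ((1 - \<epsilon>) * \<rho>) \<subseteq> slice k l m n G K}"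
  let ?U = "{G \<in> space ?M. \<not> slice k l m n G K \<subseteq> ballk k ((1 + \<epsilon>) * \<rho>)}"
  let ?E = "{G \<in> space ?M. ballk k ((1 - \<epsilon>) * \<rho>) \<subseteq> slice k l m n G K \<and> slice k l m n G K \<subseteq> ballk k ((1 + \<epsilon>) * \<rho>)}"
  have L: "?L \<in> sets ?M" by (intro sets.sets_Collect_neg slice_event_measurable(1)[OF K])
  have U: "?U \<in> sets ?M" by (intro sets.sets_Collect_neg slice_event_measurable(2)[OF K])
  have E: "?E \<in> sets ?M"
    by (intro sets.sets_Collect_conj slice_event_measurable(1)[OF K] slice_event_measurable(2)[OF K])
  have "measure ?M ?L \<le> 2 * N" unfolding N_def by (rule lower_inclusion_failure[OF K k(1,2) l])
  moreover have "measure ?M ?U \<le> 2 * N" unfolding N_def by (rule upper_inclusion_failure[OF K k(1,2) l R0])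
  moreover have "measure ?M (space ?M - ?E) \<le> measure ?M ?L + measure ?M ?U"
  proof -
    have "space ?M - ?E = ?L \<union> ?U" by blast
    then show ?thesis using measure_Un_le[OF L U] by simp
  qed
  moreover have "measure ?M (space ?M - ?E) = 1 - measure ?M ?E" by (rule M.prob_compl[OF E])
  ultimately have "measure ?M ?E \<ge> 1 - 4 * N" by linarith
  moreover have "4 * N \<le> exp (- (c * x))"
  proof -
    \<comment> \<open>The chain is
      \<open>20 \<le> 2 ^ 7 \<le> exp 7 \<le> exp (7 * (c * x))\<close>, the last step because
      \<open>k \<ge> 1\<close> forces \<open>c * x \<ge> 1\<close>.\<close>
    have "(2::real) ^ 7 \<le> exp 1 ^ 7" using exp_ge_add_one_self[of "1::real"] by (intro power_mono) auto
    also have "exp 1 ^ 7 = exp (7 * 1 :: real)" using exp_of_nat_mult[of 7 "1::real"] by simp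
    also have "\<dots> \<le> exp (7 * (c * x))" using cx by simp
    finally have "20 \<le> exp (7 * (c * x))" by simp
    then have "20 * exp (- (8 * (c * x))) \<le> exp (7 * (c * x)) * exp (- (8 * (c * x)))" by (intro mult_right_mono) auto
    also have "\<dots> = exp (- (c * x))" by (simp add: exp_add[symmetric])
    finally have "20 * exp (- (8 * (c * x))) \<le> exp (- (c * x))" .
    moreover have "- (\<theta>\<^sup>2 * x) / 8 = - (8 * (c * x))" by (simp add: c')
    ultimately show ?thesis using N by (simp only:)
  qed
  ultimately have "measure ?M ?E \<ge> 1 - exp (- (c * x))" by linarith
  then show ?thesis
    using \<epsilon> by (simp add: scale_ballk \<rho>_def[symmetric] x_def \<delta>_def mult.assoc)
qed

theorem theorem1p6:
  fixes \<tau> :: real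
  assumes "0 < \<tau>" "\<tau> < 1/2"
  shows "\<exists>c>0. \<forall>(n::nat) (m::nat) (l::nat) K.
     nontrivial_closed_convex_cone n K \<and>
     max 1 (max (real m - stat_dim n K) 0) \<le> real l \<and> l \<le> m \<and>
     real m - real l \<le> (1 - \<tau>) * stat_dim n K \<longrightarrow>
     (\<forall>(\<epsilon>::real) (k::nat). 0 < \<epsilon> \<and> \<epsilon> < 1/2 \<and> 1 \<le> k \<and> k \<le> l \<and>
        real k \<le> c * Lfun (\<epsilon>^2 * stat_dim n K) \<longrightarrow>
        measure (gauss_mat m n)
          {G \<in> space (gauss_mat m n).
             scale_set (1 - \<epsilon>) (ballk k (sqrt (stat_dim n K - real m + real l)))
               \<subseteq> proj_first k ` (Lsub m l \<inter> GK m n G K) \<and>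
             proj_first k ` (Lsub m l \<inter> GK m n G K)
               \<subseteq> scale_set (1 + \<epsilon>) (ballk k (sqrt (stat_dim n K - real m + real l)))}
        \<ge> 1 - exp (- c * \<epsilon>^2 * stat_dim n K))"
proof -
  define c where "c = (\<tau> / 50)\<^sup>2 / 64"
  have "c > 0" using assms(1) by (simp add: c_def)
  moreover note slice_probability[OF assms c_def]
  ultimately show ?thesis by (intro exI[of _ c]) blast
qed

end
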